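(* Assume that there exist constants $\epsilon>0$, $K>0$ such that, almost surely, $\epsilon<\hat\beta(X)$, $\beta(X)\in(\epsilon,K)$, $\hat\lambda(X)\in(-K,K)$, $\mathrm{var}(Y|X)<K$, $E[\{Y-\mu(X)\}^4|X]<K$ and $E[\{A-\pi(X)\}^4|X]<K$. Suppose also that at least one of the following two conditions holds: 1. (Sample-splitting) $\hat\pi(x),\hat\mu(x),\hat\lambda(x)$ and $\hat\beta(x)$ are obtained from a sample independent of the one used to construct $\hat\psi$. 2. (Donsker condition) The quantities $$\hat\lambda(X),\qquad \frac{\{A-\hat\pi(X)\}\{Y-\hat\mu(X)\}}{\hat\beta(X)},\qquad \frac{\hat\lambda(X)\{A-\hat\pi(X)\}^2}{\hat\beta(X)}$$ fall within a $P$-Donsker class with probability approaching $1$. Finally, letting $\|\cdot\|$ denote the $\mathcal{L}_2(X)$ norm, assume: (A1) $\|\pi-\hat\pi\|=o_P(n^{-\nu/4})$ and $\|\mu-\hat\mu\|=o_P(n^{-\tau/4})$, where $\nu\ge1$, $\tau\ge0$ and $\nu+\tau\ge2$; (A2) the product of $\|\lambda-\hat\lambda\|$ and $\|\beta-\hat\beta\|$ is $o_P(n^{-1/2})$. Then $\hat\psi$ is regular asymptotically linear (RAL) with influence curve $\phi_\psi(O)$, and hence $\sqrt{n}(\hat\psi-\psi)$ converges in distribution to a mean-zero normal random variable with variance $E\{\phi_\psi^2(O)\}$.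
   Context: $o_i=(y_i,a_i,x_i)$, $i=1,\dots,n$, are i.i.d. observations of $O=(Y,A,X)$, with $Y\in\mathbb{R}$, $A\in\mathbb{R}$, $X\in\mathbb{R}^p$. Define $\mu(X)=E(Y|X)$, $\pi(X)=E(A|X)$, $\beta(X)=\mathrm{var}(A|X)$, $\lambda(X)=\mathrm{cov}(A,Y|X)/\beta(X)$, and the estimand $$\psi=E\left\{\frac{\mathrm{cov}(A,Y|X)}{\mathrm{var}(A|X)}\right\}=E\{\lambda(X)\}.$$ $\hat\mu,\hat\pi,\hat\lambda,\hat\beta$ denote consistent function estimators of $\mu,\pi,\lambda,\beta$ (consistent in $\mathcal{L}_2(X)$ norm, i.e. the norm of the error is $o_P(1)$). The $\mathcal{L}_2(X)$ norm is $\|g\|=[E\{g(X)^2\}]^{1/2}$, where for estimated functions the expectation is over a fresh $X$ with the estimated function held fixed. The estimator is $$\hat\psi=n^{-1}\sum_{i=1}^n\left(\frac{\{a_i-\hat\pi(x_i)\}}{\hat\beta(x_i)}\big[y_i-\hat\mu(x_i)-\hat\lambda(x_i)\{a_i-\hat\pi(x_i)\}\big]+\hat\lambda(x_i)\right),$$ and the influence curve is, for $o=(y,a,x)$, $$\phi_\psi(o)=\frac{\{a-\pi(x)\}}{\beta(x)}\big[y-\mu(x)-\lambda(x)\{a-\pi(x)\}\big]+\lambda(x)-\psi.$$ Asymptotic linearity with influence curve $\phi$ means $\hat\psi-\psi=n^{-1}\sum_{i=1}^n\phi(o_i)+o_P(n^{-1/2})$. *)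

theory Defs
  imports "HOL-Probability.Probability"
begin

section \<open>Observations and conditional moments\<close>

text \<open>An observation is a triple \<open>(y, a, x)\<close>; the joint law of \<open>O = (Y, A, X)\<close> is a Borel probability
  measure \<open>P\<close> on such triples, and all functionals below are functionals of \<open>P\<close>.\<close>

type_synonym 'p obs = "real \<times> real \<times> (real ^ 'p)"

abbreviation resp :: "'p::finite obs \<Rightarrow> real" where "resp ob \<equiv> fst ob"
abbreviation trt :: "'p::finite obs \<Rightarrow> real" where "trt ob \<equiv> fst (snd ob)"
abbreviation covs :: "'p::finite obs \<Rightarrow> real ^ 'p" where "covs ob \<equiv> snd (snd ob)"

definition sigma_X :: "'p::finite obs measure \<Rightarrow> 'p obs measure" where
  "sigma_X P = vimage_algebra (space P) covs borel"

text \<open>A Borel version \<open>x \<mapsto> E(f(O) | X = x)\<close> of the conditional expectation, unique up to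
  \<open>P\<close>-null sets of values of \<open>X\<close>.  It exists by \<open>cond_mean_version\<close> below.\<close>

definition cond_mean :: "'p::finite obs measure \<Rightarrow> ('p obs \<Rightarrow> real) \<Rightarrow> real ^ 'p \<Rightarrow> real" where
  "cond_mean P f = (SOME r. r \<in> borel_measurable borel \<and>
     (AE ob in P. r (covs ob) = real_cond_exp P (sigma_X P) f ob))"

definition mu_fun :: "'p::finite obs measure \<Rightarrow> real ^ 'p \<Rightarrow> real" where
  "mu_fun P = cond_mean P resp"

definition pi_fun :: "'p::finite obs measure \<Rightarrow> real ^ 'p \<Rightarrow> real" where
  "pi_fun P = cond_mean P trt"

definition beta_fun :: "'p::finite obs measure \<Rightarrow> real ^ 'p \<Rightarrow> real" where
  "beta_fun P = cond_mean P (\<lambda>ob. (trt ob - pi_fun P (covs ob))\<^sup>2)"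

definition cov_fun :: "'p::finite obs measure \<Rightarrow> real ^ 'p \<Rightarrow> real" where
  "cov_fun P = cond_mean P (\<lambda>ob. (trt ob - pi_fun P (covs ob)) * (resp ob - mu_fun P (covs ob)))"

definition lambda_fun :: "'p::finite obs measure \<Rightarrow> real ^ 'p \<Rightarrow> real" where
  "lambda_fun P x = cov_fun P x / beta_fun P x"

definition psi :: "'p::finite obs measure \<Rightarrow> real" where
  "psi P = (\<integral>ob. lambda_fun P (covs ob) \<partial>P)"

text \<open>The assertion \<open>E{f(O) | X} < K\<close> a.s. for nonnegative \<open>f\<close>.  It uses the extended-valued conditional
  expectation because \<open>real_cond_exp\<close> is \<open>0\<close> where the conditional expectation of \<open>f\<close> is infinite.\<close>

definition cond_mean_below ::
  "'p::finite obs measure \<Rightarrow> ('p obs \<Rightarrow> real) \<Rightarrow> real \<Rightarrow> bool" where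
  "cond_mean_below P f K \<longleftrightarrow>
     (AE ob in P. nn_cond_exp P (sigma_X P) (\<lambda>ob. ennreal (f ob)) ob < ennreal K)"

lemma vimage_algebra_factor:
  fixes f :: "'a \<Rightarrow> real" and X :: "'a \<Rightarrow> 'b::topological_space"
  assumes f: "f \<in> borel_measurable (vimage_algebra \<Omega> X borel)"
  shows "\<exists>r\<in>borel_measurable borel. \<forall>w\<in>\<Omega>. r (X w) = f w"
proof -
  have "\<exists>B\<in>sets borel. {w\<in>\<Omega>. f w < q} = X -` B \<inter> \<Omega>" for q
  proof -
    have "f -` {..<q} \<inter> space (vimage_algebra \<Omega> X borel) \<in> sets (vimage_algebra \<Omega> X borel)"
      by (rule measurable_sets[OF f]) auto
    then have "{w\<in>\<Omega>. f w < q} \<in> sets (vimage_algebra \<Omega> X borel)"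
      by (simp add: vimage_def Int_def conj_commute)
    then show ?thesis
      by (auto simp: sets_vimage_algebra2)
  qed
  then obtain B where B: "\<And>q. B q \<in> sets borel" "\<And>q. {w\<in>\<Omega>. f w < q} = X -` B q \<inter> \<Omega>"
    by metis
  define g where "g x = (INF q\<in>\<rat>. if x \<in> B q then ereal q else \<infinity>)" for x
  have "{x \<in> space borel. x \<in> B q} \<in> sets borel" for q
    using B(1)[of q] by simp
  then have [measurable]: "g \<in> borel_measurable borel"
    unfolding g_def by (intro borel_measurable_INF countable_rat measurable_If) auto
  have "g (X w) = ereal (f w)" if w: "w \<in> \<Omega>" for w
  proof (rule antisym)
    have iff: "X w \<in> B q \<longleftrightarrow> f w < q" for q
      using B(2)[of q] w by auto
    show "ereal (f w) \<le> g (X w)"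
      unfolding g_def by (rule INF_greatest) (auto simp: iff)
    show "g (X w) \<le> ereal (f w)"
    proof (rule ereal_le_epsilon2)
      fix e :: real assume "e > 0"
      then obtain q where q: "q \<in> \<rat>" "f w < q" "q < f w + e"
        using Rats_dense_in_real[of "f w" "f w + e"] by auto
      have "g (X w) \<le> (if X w \<in> B q then ereal q else \<infinity>)"
        unfolding g_def by (rule INF_lower[OF q(1)])
      also have "\<dots> \<le> ereal (f w) + ereal e" using q iff by auto
      finally show "g (X w) \<le> ereal (f w) + ereal e" .
    qed
  qed
  then show ?thesis
    by (intro bexI[of _ "\<lambda>x. real_of_ereal (g x)"]) auto
qed

lemma cond_mean_version:
  fixes P :: "'p::finite obs measure"
  shows "cond_mean P f \<in> borel_measurable borel \<and>
    (AE ob in P. cond_mean P f (covs ob) = real_cond_exp P (sigma_X P) f ob)"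
proof -
  have "real_cond_exp P (sigma_X P) f \<in> borel_measurable (vimage_algebra (space P) covs borel)"
    using borel_measurable_cond_exp[of P "sigma_X P" f] by (simp add: sigma_X_def)
  from vimage_algebra_factor[OF this] obtain r
    where r: "r \<in> borel_measurable borel"
      "\<And>ob. ob \<in> space P \<Longrightarrow> r (covs ob) = real_cond_exp P (sigma_X P) f ob"
    by blast
  have "\<exists>r. r \<in> borel_measurable borel \<and>
      (AE ob in P. r (covs ob) = real_cond_exp P (sigma_X P) f ob)"
    using r by (intro exI[of _ r] conjI AE_I2) auto
  then show ?thesis
    unfolding cond_mean_def by (rule someI_ex)
qed


section \<open>Stochastic order and the \<open>L\<^sub>2(X)\<close> norm\<close>

text \<open>\<open>Z n = o\<^sub>P(r n)\<close>; the values are extended because an \<open>L\<^sub>2\<close> norm may be infinite.\<close>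

definition small_oP :: "'w measure \<Rightarrow> (nat \<Rightarrow> 'w \<Rightarrow> ennreal) \<Rightarrow> (nat \<Rightarrow> real) \<Rightarrow> bool" where
  "small_oP M Z r \<longleftrightarrow>
     (\<forall>\<eta>>0. (\<lambda>n. measure M {\<omega> \<in> space M. ennreal (\<eta> * r n) < Z n \<omega>}) \<longlonglongrightarrow> 0)"

definition L2_norm :: "'p::finite obs measure \<Rightarrow> (real ^ 'p \<Rightarrow> real) \<Rightarrow> ennreal" where
  "L2_norm P g =
     (let I = (\<integral>\<^sup>+ob. ennreal ((g (covs ob))\<^sup>2) \<partial>P)
      in if I = \<infinity> then \<infinity> else ennreal (sqrt (enn2real I)))"

text \<open>A nuisance estimator: \<open>fh n \<omega>\<close> is the estimated function at sample size \<open>n\<close> and outcome \<open>\<omega>\<close>.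
  In \<open>est_err\<close> only \<open>x\<close> is integrated, the estimated function \<open>fh n \<omega>\<close> being held fixed.\<close>

type_synonym ('w, 'p) estimator = "nat \<Rightarrow> 'w \<Rightarrow> real ^ 'p \<Rightarrow> real"

definition est_err :: "'p::finite obs measure \<Rightarrow> ('w, 'p) estimator \<Rightarrow> (real ^ 'p \<Rightarrow> real)
    \<Rightarrow> nat \<Rightarrow> 'w \<Rightarrow> ennreal" where
  "est_err P fh f n \<omega> = L2_norm P (\<lambda>x. f x - fh n \<omega> x)"

definition consistent :: "'w measure \<Rightarrow> 'p::finite obs measure \<Rightarrow> ('w, 'p) estimator
    \<Rightarrow> (real ^ 'p \<Rightarrow> real) \<Rightarrow> bool" where
  "consistent M P fh f \<longleftrightarrow> small_oP M (est_err P fh f) (\<lambda>_. 1)"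

definition random_function :: "'w measure \<Rightarrow> ('w \<Rightarrow> real ^ 'p::finite \<Rightarrow> real) \<Rightarrow> bool" where
  "random_function M h \<longleftrightarrow> (\<lambda>(\<omega>, x). h \<omega> x) \<in> borel_measurable (M \<Otimes>\<^sub>M borel)"


section \<open>Sample splitting\<close>

text \<open>The \<open>\<sigma>\<close>-algebra \<open>G\<close> is the one generated by the sample used for the nuisance functions, and the
  second argument of \<open>indep_set\<close> is the one generated by the observations \<open>Obs 0, \<dots>, Obs (n - 1)\<close>.\<close>

definition sample_splitting :: "'w measure \<Rightarrow> (nat \<Rightarrow> 'w \<Rightarrow> 'p::finite obs)
    \<Rightarrow> ('w, 'p) estimator set \<Rightarrow> bool" where
  "sample_splitting M Obs H \<longleftrightarrow>
     (\<forall>n. \<exists>G. subalgebra M G \<and>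
        prob_space.indep_set M (sets G)
          (sets (vimage_algebra (space M) (\<lambda>\<omega>. \<lambda>i\<in>{..<n}. Obs i \<omega>) (\<Pi>\<^sub>M i\<in>{..<n}. borel))) \<and>
        (\<forall>h\<in>H. random_function G (h n)))"


section \<open>Donsker classes\<close>

text \<open>\<open>l_infty F\<close> is the space of bounded real functions on \<open>F\<close> with the supremum metric.\<close>

definition l_infty :: "('o \<Rightarrow> real) set \<Rightarrow> (('o \<Rightarrow> real) \<Rightarrow> real) topology" where
  "l_infty F = mtopology_of (funspace F euclidean_metric)"

definition tight_law :: "'z topology \<Rightarrow> 'z measure \<Rightarrow> bool" where
  "tight_law T L \<longleftrightarrow>
     prob_space L \<and> space L = topspace T \<and> sets L = sigma_sets (topspace T) {U. openin T U} \<and>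
     (\<forall>e>0. \<exists>C. compactin T C \<and> C \<in> sets L \<and> measure L C > 1 - e)"

definition outer_expectation :: "'s measure \<Rightarrow> ('s \<Rightarrow> real) \<Rightarrow> real" where
  "outer_expectation N Z =
     Inf {(\<integral>s. U s \<partial>N) | U. integrable N U \<and> (\<forall>s\<in>space N. Z s \<le> U s)}"

definition empirical_process ::
  "'o measure \<Rightarrow> ('o \<Rightarrow> real) set \<Rightarrow> nat \<Rightarrow> (nat \<Rightarrow> 'o) \<Rightarrow> (('o \<Rightarrow> real) \<Rightarrow> real)" where
  "empirical_process P F n s =
     (\<lambda>f\<in>F. sqrt (real n) * ((\<Sum>i<n. f (s i)) / real n - (\<integral>ob. f ob \<partial>P)))"

text \<open>Weak convergence, in the sense of Hoffmann-Jorgensen, of the empirical process in \<open>l_infty F\<close>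
  to a tight Borel limit.  The condition \<open>bdd_above\<close> says that the paths of the process are bounded.\<close>

definition donsker :: "'o measure \<Rightarrow> ('o \<Rightarrow> real) set \<Rightarrow> bool" where
  "donsker P F \<longleftrightarrow>
     (\<forall>f\<in>F. f \<in> borel_measurable P \<and> integrable P (\<lambda>ob. (f ob)\<^sup>2)) \<and>
     (\<forall>ob\<in>space P. bdd_above ((\<lambda>f. \<bar>f ob - (\<integral>ob'. f ob' \<partial>P)\<bar>) ` F)) \<and>
     (\<exists>L. tight_law (l_infty F) L \<and>
        (\<forall>H. continuous_map (l_infty F) euclideanreal H \<and> bounded (H ` topspace (l_infty F)) \<longrightarrow>
           (\<lambda>n. outer_expectation (\<Pi>\<^sub>M i\<in>{..<n}. P) (\<lambda>s. H (empirical_process P F n s)))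
             \<longlonglongrightarrow> (\<integral>z. H z \<partial>L)))"

text \<open>Membership in \<open>F\<close> need not be an event, so it is required on events \<open>E n\<close> of probability
  tending to one.\<close>

definition donsker_condition :: "'w measure \<Rightarrow> 'p::finite obs measure
    \<Rightarrow> ('w, 'p) estimator \<Rightarrow> ('w, 'p) estimator \<Rightarrow> ('w, 'p) estimator \<Rightarrow> ('w, 'p) estimator \<Rightarrow> bool" where
  "donsker_condition M P muh pih lamh beth \<longleftrightarrow>
     (\<exists>F E. donsker P F \<and> (\<forall>n. E n \<in> sets M) \<and> (\<lambda>n. measure M (E n)) \<longlonglongrightarrow> 1 \<and>
        (\<forall>n. \<forall>\<omega>\<in>E n.
           (\<lambda>ob. lamh n \<omega> (covs ob)) \<in> F \<and>
           (\<lambda>ob. (trt ob - pih n \<omega> (covs ob)) * (resp ob - muh n \<omega> (covs ob))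
                   / beth n \<omega> (covs ob)) \<in> F \<and>
           (\<lambda>ob. lamh n \<omega> (covs ob) * (trt ob - pih n \<omega> (covs ob))\<^sup>2
                   / beth n \<omega> (covs ob)) \<in> F))"


section \<open>The estimator, its influence curve, and regular asymptotic linearity\<close>

definition psi_hat :: "(nat \<Rightarrow> 'w \<Rightarrow> 'p::finite obs)
    \<Rightarrow> ('w, 'p) estimator \<Rightarrow> ('w, 'p) estimator \<Rightarrow> ('w, 'p) estimator \<Rightarrow> ('w, 'p) estimator
    \<Rightarrow> nat \<Rightarrow> 'w \<Rightarrow> real" where
  "psi_hat Obs muh pih lamh beth n \<omega> =
     (\<Sum>i<n. let (y, a, x) = Obs i \<omega> in
        (a - pih n \<omega> x) / beth n \<omega> x * (y - muh n \<omega> x - lamh n \<omega> x * (a - pih n \<omega> x))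
          + lamh n \<omega> x) / real n"

definition phi_psi :: "'p::finite obs measure \<Rightarrow> 'p obs \<Rightarrow> real" where
  "phi_psi P = (\<lambda>(y, a, x).
     (a - pi_fun P x) / beta_fun P x * (y - mu_fun P x - lambda_fun P x * (a - pi_fun P x))
       + lambda_fun P x - psi P)"

definition asymptotically_linear :: "'w measure \<Rightarrow> (nat \<Rightarrow> 'w \<Rightarrow> 'o) \<Rightarrow> real
    \<Rightarrow> (nat \<Rightarrow> 'w \<Rightarrow> real) \<Rightarrow> ('o \<Rightarrow> real) \<Rightarrow> bool" where
  "asymptotically_linear M Obs theta T phi \<longleftrightarrow>
     small_oP M (\<lambda>n \<omega>. ennreal \<bar>T n \<omega> - theta - (\<Sum>i<n. phi (Obs i \<omega>)) / real n\<bar>)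
       (\<lambda>n. real n powr (-1/2))"

text \<open>A one-dimensional submodel \<open>t \<mapsto> P\<^sub>t = p\<^sub>t \<cdot> P\<close>, \<open>0 \<le> t \<le> 1\<close>, passing through \<open>P\<close> at \<open>t = 0\<close>
  with bounded score \<open>g\<close>.  The scores of these submodels are all the bounded mean-zero functions,
  which are dense in the nonparametric tangent space.\<close>

definition smooth_submodel :: "'o measure \<Rightarrow> (real \<Rightarrow> 'o \<Rightarrow> real) \<Rightarrow> bool" where
  "smooth_submodel P p \<longleftrightarrow>
     (\<forall>t\<in>{0..1}. p t \<in> borel_measurable P \<and> (\<forall>ob. 0 \<le> p t ob) \<and> (\<integral>\<^sup>+ob. ennreal (p t ob) \<partial>P) = 1) \<and>
     p 0 = (\<lambda>_. 1) \<and>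
     (\<exists>g B. g \<in> borel_measurable P \<and> (\<forall>ob. \<bar>g ob\<bar> \<le> B) \<and>
        (\<forall>e>0. \<exists>d>0. \<forall>t\<in>{0..1}. 0 < t \<and> t < d \<longrightarrow>
           (AE ob in P. \<bar>(p t ob - 1) / t - g ob\<bar> \<le> e)))"

text \<open>Regularity at \<open>P\<close> relative to these submodels: the limit law of \<open>\<surd>n (T n - \<Psi>(P\<^sub>1\<^sub>/\<^sub>\<surd>\<^sub>n))\<close>, when the
  sample of size \<open>n\<close> is drawn from \<open>P\<^sub>1\<^sub>/\<^sub>\<surd>\<^sub>n\<close>, does not depend on the submodel.  Under the tilted
  measure the variables \<open>Obs 0, \<dots>, Obs (n - 1)\<close> are i.i.d. with law \<open>P\<^sub>1\<^sub>/\<^sub>\<surd>\<^sub>n\<close>, while the conditional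
  law of everything else (in particular of an independent auxiliary sample) given them is
  unchanged.\<close>

definition regular_estimator :: "'w measure \<Rightarrow> (nat \<Rightarrow> 'w \<Rightarrow> 'o) \<Rightarrow> 'o measure
    \<Rightarrow> ('o measure \<Rightarrow> real) \<Rightarrow> (nat \<Rightarrow> 'w \<Rightarrow> real) \<Rightarrow> bool" where
  "regular_estimator M Obs P Psi T \<longleftrightarrow>
     (\<exists>L. real_distribution L \<and>
        (\<forall>p. smooth_submodel P p \<longrightarrow>
           weak_conv_m
             (\<lambda>n. let p_n = p (1 / sqrt (real n)) in
                distr (density M (\<lambda>\<omega>. \<Prod>i<n. ennreal (p_n (Obs i \<omega>)))) borel
                  (\<lambda>\<omega>. sqrt (real n) * (T n \<omega> - Psi (density P (\<lambda>ob. ennreal (p_n ob))))))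
             L))"

definition RAL :: "'w measure \<Rightarrow> (nat \<Rightarrow> 'w \<Rightarrow> 'o) \<Rightarrow> 'o measure
    \<Rightarrow> ('o measure \<Rightarrow> real) \<Rightarrow> (nat \<Rightarrow> 'w \<Rightarrow> real) \<Rightarrow> ('o \<Rightarrow> real) \<Rightarrow> bool" where
  "RAL M Obs P Psi T phi \<longleftrightarrow>
     regular_estimator M Obs P Psi T \<and> asymptotically_linear M Obs (Psi P) T phi"

text \<open>\<open>N(0, v)\<close> as the law of \<open>\<surd>v Z\<close>, which includes the degenerate case \<open>v = 0\<close>.\<close>

definition normal_law :: "real \<Rightarrow> real measure" where
  "normal_law v = distr std_normal_distribution borel (\<lambda>z. sqrt v * z)"

end

theory Submission
  imports Defs
begin

text \<open>
  Let \<open>plug\<close> be the summand of the estimator, a function of one observation that contains the four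
  estimated nuisance functions, and let \<open>\<phi>\<close> be the influence curve.  With \<open>emp f\<close> for the empirical process
  \<open>\<surd>n (n\<^sup>-\<^sup>1 \<Sum>\<^sub>i f(o\<^sub>i) - E f)\<close>, the remainder of the linear expansion is
  \<open>emp (plug - \<phi>) + \<surd>n (E plug - \<psi>)\<close> (\<open>error_decomposition\<close>).

  The second term is a bias of second order.  Residuals such as \<open>A - \<pi>(X)\<close> have conditional mean zero, so an
  error in a single nuisance function does not contribute, and \<open>E plug - \<psi>\<close> is the mean of
  \<open>((\<lambda> - \<lambda>')(\<beta> - \<beta>') + (\<pi> - \<pi>')(\<mu> - \<mu>') - \<lambda>'(\<pi> - \<pi>')\<^sup>2) / \<beta>'\<close>, where primes denote the estimates
  (\<open>plug_in_bias\<close>).  By the Cauchy-Schwarz inequality and the rate assumptions this is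
  \<open>o\<^sub>P(n\<^sup>-\<^sup>1\<^sup>/\<^sup>2)\<close>.

  In the first term, \<open>plug - \<phi>\<close> is, up to a constant, a combination of the estimation errors of the three functions
  in the Donsker condition.  Each of them splits into a part \<open>d\<close> in which one error is multiplied by residuals of
  bounded conditional fourth moment, so that it tends to zero in \<open>L\<^sub>2\<close>, and a part \<open>e\<close> containing a product of two
  errors, which is controlled only in \<open>L\<^sub>1\<close>, but at the rate \<open>o\<^sub>P(n\<^sup>-\<^sup>1\<^sup>/\<^sup>2)\<close>.  With sample splitting the
  estimated functions may be regarded as fixed; Chebyshev's inequality deals with \<open>d\<close> and Markov's inequality
  with \<open>e\<close>.  Under the Donsker condition convergence in \<open>L\<^sub>1\<close> is enough (\<open>donsker_emp\<close>): tightness of the limit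
  covers the class by finitely many cells on which the empirical process oscillates little (\<open>donsker_cells\<close>), by
  the central limit theorem differences within a cell then have small variance
  (\<open>donsker_variance_cells\<close>), and Fatou's lemma upgrades \<open>L\<^sub>1\<close> convergence inside the class to convergence in
  standard deviation (\<open>donsker_L1_imp_variance\<close>).  Chebyshev's inequality at one function per cell gives the
  equicontinuity that is needed (\<open>donsker_equicontinuous\<close>).

  Regularity is proved with characteristic functions.  The likelihood ratios of the local alternatives have bounded
  second moments, so the \<open>o\<^sub>P\<close> remainder stays negligible under them (\<open>alt_small\<close>), while \<open>n\<^sup>-\<^sup>1\<^sup>/\<^sup>2 \<Sum>\<^sub>i \<phi>(o\<^sub>i)\<close>
  becomes asymptotically normal with mean \<open>E(g \<phi>)\<close>, where \<open>g\<close> is the score (\<open>char_Sn_limit\<close>).  This shift is exactly that of the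
  parameter, \<open>\<surd>n (\<psi>(P\<^sub>n) - \<psi>(P)) \<longlonglongrightarrow> E(g \<phi>)\<close> (\<open>psi_pathwise_derivative\<close>), again because of
  \<open>plug_in_bias\<close>: now the alternative is the true law, the nuisance functions of \<open>P\<close> are the plug-ins, and each of them
  is wrong by \<open>O(n\<^sup>-\<^sup>1\<^sup>/\<^sup>2)\<close> only (\<open>psi_tilted\<close>).  The constant submodel yields asymptotic normality under
  \<open>P\<close> itself.
\<close>

section \<open>Conditional moments given the covariates\<close>

lemma obs_components_measurable [measurable]:
  "(\<lambda>ob. ob) \<in> measurable (borel :: 'p::finite obs measure) (borel \<Otimes>\<^sub>M (borel \<Otimes>\<^sub>M borel))"
  by (simp add: borel_prod)

locale obs_law = prob_space P for P :: "'p::finite obs measure" +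
  assumes sets_P [measurable_cong, simp]: "sets P = sets borel"
begin

lemma space_P [simp]: "space P = UNIV"
  using sets_eq_imp_space_eq[OF sets_P] by simp

lemma measure_UNIV [simp]: "emeasure P UNIV = 1" "prob UNIV = 1"
  using emeasure_space_1 prob_space by (simp_all only: space_P)

lemma sigma_X_subalgebra: "subalgebra P (sigma_X P)"
proof -
  have "covs -` B \<in> sets borel" if "B \<in> sets borel" for B :: "(real^'p) set"
    using measurable_sets[of covs "borel :: 'p obs measure" borel B] that by simp
  then show ?thesis
    by (auto simp: subalgebra_def sigma_X_def sets_vimage_algebra2)
qed

sublocale sub: finite_measure_subalgebra P "sigma_X P"
  by unfold_locales (rule sigma_X_subalgebra)

lemma covs_sigma_X [measurable]: "covs \<in> measurable (sigma_X P) borel"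
  unfolding sigma_X_def by (rule measurable_vimage_algebra1) auto

lemma cond_mean_measurable [measurable]: "cond_mean P f \<in> borel_measurable borel"
  using cond_mean_version by blast

lemma cond_mean_AE: "AE ob in P. cond_mean P f (covs ob) = real_cond_exp P (sigma_X P) f ob"
  using cond_mean_version by blast

lemma
  assumes [measurable]: "f \<in> borel_measurable borel" "h \<in> borel_measurable borel"
    and int: "integrable P (\<lambda>ob. h (covs ob) * f ob)"
  shows integrable_cond_mean: "integrable P (\<lambda>ob. h (covs ob) * cond_mean P f (covs ob))"
    and integral_cond_mean: "(\<integral>ob. h (covs ob) * cond_mean P f (covs ob) \<partial>P) = (\<integral>ob. h (covs ob) * f ob \<partial>P)"
proof -
  have m: "(\<lambda>ob. h (covs ob)) \<in> borel_measurable (sigma_X P)" "f \<in> borel_measurable P" by measurable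
  note * = sub.real_cond_exp_intg[OF int m]
  have eq: "AE ob in P. h (covs ob) * cond_mean P f (covs ob) = h (covs ob) * real_cond_exp P (sigma_X P) f ob"
    using cond_mean_AE[of f] by eventually_elim simp
  have [measurable]: "real_cond_exp P (sigma_X P) f \<in> borel_measurable P"
    by simp
  have ms: "(\<lambda>ob. h (covs ob) * cond_mean P f (covs ob)) \<in> borel_measurable P"
     "(\<lambda>ob. h (covs ob) * real_cond_exp P (sigma_X P) f ob) \<in> borel_measurable P"
    by (measurable)
  show "integrable P (\<lambda>ob. h (covs ob) * cond_mean P f (covs ob))"
    using integrable_cong_AE[OF ms eq] *(1) by blast
  show "(\<integral>ob. h (covs ob) * cond_mean P f (covs ob) \<partial>P) = (\<integral>ob. h (covs ob) * f ob \<partial>P)"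
    using integral_cong_AE[OF ms eq] *(2) by simp
qed

text \<open>Residuals are orthogonal to functions of the covariates.  This removes every term that is linear in an
  estimation error from the bias of the estimator.\<close>

lemma integral_residual:
  assumes [measurable]: "f \<in> borel_measurable borel" "h \<in> borel_measurable borel"
    and f: "integrable P f"
    and int: "integrable P (\<lambda>ob. h (covs ob) * (f ob - cond_mean P f (covs ob)))"
  shows "(\<integral>ob. h (covs ob) * (f ob - cond_mean P f (covs ob)) \<partial>P) = 0"
proof -
  let ?r = "\<lambda>ob. cond_mean P f (covs ob)"
  let ?d = "\<lambda>ob. f ob - ?r ob"
  have r: "integrable P ?r"
    using integrable_cond_mean[of f "\<lambda>_. 1"] f by simp
  have "AE ob in P. real_cond_exp P (sigma_X P) ?d ob
          = real_cond_exp P (sigma_X P) f ob - real_cond_exp P (sigma_X P) ?r ob"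
    by (rule sub.real_cond_exp_diff[OF f r])
  moreover have "AE ob in P. real_cond_exp P (sigma_X P) ?r ob = ?r ob"
    by (rule sub.real_cond_exp_F_meas[OF r]) measurable
  ultimately have "AE ob in P. cond_mean P ?d (covs ob) = 0"
    using cond_mean_AE[of f] cond_mean_AE[of ?d] by eventually_elim simp
  then have "(\<integral>ob. h (covs ob) * cond_mean P ?d (covs ob) \<partial>P) = (\<integral>ob. 0 \<partial>P)"
    by (intro integral_cong_AE) auto
  then show ?thesis
    using integral_cond_mean[of ?d h] int by simp
qed

text \<open>The assertion \<open>E(w | X) \<le> \<kappa>\<close>, tested against functions of the covariates.  In this form it needs no
  integrability and no choice of a version, and it can be added and compared like an inequality.\<close>

definition mean_dominated :: "('p obs \<Rightarrow> real) \<Rightarrow> real \<Rightarrow> bool" where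
  "mean_dominated w \<kappa> \<longleftrightarrow> (\<forall>v :: real ^ 'p \<Rightarrow> ennreal. v \<in> borel_measurable borel \<longrightarrow>
     (\<integral>\<^sup>+ob. v (covs ob) * ennreal (w ob) \<partial>P) \<le> ennreal \<kappa> * (\<integral>\<^sup>+ob. v (covs ob) \<partial>P))"

lemma mean_dominatedD:
  "mean_dominated w \<kappa> \<Longrightarrow> v \<in> borel_measurable borel \<Longrightarrow>
     (\<integral>\<^sup>+ob. v (covs ob) * ennreal (w ob) \<partial>P) \<le> ennreal \<kappa> * (\<integral>\<^sup>+ob. v (covs ob) \<partial>P)"
  by (auto simp: mean_dominated_def)

lemma cond_mean_below_imp_mean_dominated:
  assumes [measurable]: "w \<in> borel_measurable borel" and below: "cond_mean_below P w \<kappa>"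
  shows "mean_dominated w \<kappa>"
  unfolding mean_dominated_def
proof (intro allI impI)
  fix v :: "real ^ 'p \<Rightarrow> ennreal" assume [measurable]: "v \<in> borel_measurable borel"
  have "(\<integral>\<^sup>+ob. v (covs ob) * ennreal (w ob) \<partial>P)
      = (\<integral>\<^sup>+ob. v (covs ob) * nn_cond_exp P (sigma_X P) (\<lambda>ob. ennreal (w ob)) ob \<partial>P)"
    by (rule sub.nn_cond_exp_intg[symmetric]) measurable
  also have "\<dots> \<le> (\<integral>\<^sup>+ob. v (covs ob) * ennreal \<kappa> \<partial>P)"
    using below unfolding cond_mean_below_def
    by (intro nn_integral_mono_AE) (auto elim!: eventually_mono intro!: mult_left_mono)
  also have "\<dots> = ennreal \<kappa> * (\<integral>\<^sup>+ob. v (covs ob) \<partial>P)"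
    by (subst nn_integral_multc) (auto simp: mult.commute)
  finally show "(\<integral>\<^sup>+ob. v (covs ob) * ennreal (w ob) \<partial>P) \<le> ennreal \<kappa> * (\<integral>\<^sup>+ob. v (covs ob) \<partial>P)" .
qed

lemma mean_dominated_mono:
  assumes "mean_dominated w' \<kappa>" "AE ob in P. w ob \<le> w' ob"
  shows "mean_dominated w \<kappa>"
  unfolding mean_dominated_def
proof (intro allI impI)
  fix v :: "real ^ 'p \<Rightarrow> ennreal" assume v: "v \<in> borel_measurable borel"
  have "(\<integral>\<^sup>+ob. v (covs ob) * ennreal (w ob) \<partial>P) \<le> (\<integral>\<^sup>+ob. v (covs ob) * ennreal (w' ob) \<partial>P)"
    using assms(2) by (intro nn_integral_mono_AE) (auto elim!: eventually_mono intro!: mult_left_mono ennreal_leI)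
  then show "(\<integral>\<^sup>+ob. v (covs ob) * ennreal (w ob) \<partial>P) \<le> ennreal \<kappa> * (\<integral>\<^sup>+ob. v (covs ob) \<partial>P)"
    using mean_dominatedD[OF assms(1) v] by (rule order_trans)
qed

lemma mean_dominated_const: "mean_dominated (\<lambda>_. c) c"
  unfolding mean_dominated_def by (intro allI impI) (subst nn_integral_multc; simp add: mult.commute)

lemma mean_dominated_add:
  assumes [measurable]: "w \<in> borel_measurable borel" "w' \<in> borel_measurable borel"
    and dom: "mean_dominated w c" "mean_dominated w' c'"
    and nonneg: "\<And>ob. 0 \<le> w ob" "\<And>ob. 0 \<le> w' ob" "0 \<le> c" "0 \<le> c'"
  shows "mean_dominated (\<lambda>ob. w ob + w' ob) (c + c')"
  unfolding mean_dominated_def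
proof (intro allI impI)
  fix v :: "real ^ 'p \<Rightarrow> ennreal" assume v [measurable]: "v \<in> borel_measurable borel"
  have "(\<integral>\<^sup>+ob. v (covs ob) * ennreal (w ob + w' ob) \<partial>P)
      = (\<integral>\<^sup>+ob. v (covs ob) * ennreal (w ob) \<partial>P) + (\<integral>\<^sup>+ob. v (covs ob) * ennreal (w' ob) \<partial>P)"
    by (subst nn_integral_add[symmetric]) (auto simp: nonneg distrib_left)
  also have "\<dots> \<le> ennreal (c + c') * (\<integral>\<^sup>+ob. v (covs ob) \<partial>P)"
    using add_mono[OF mean_dominatedD[OF dom(1) v] mean_dominatedD[OF dom(2) v]]
    by (simp add: nonneg distrib_right)
  finally show "(\<integral>\<^sup>+ob. v (covs ob) * ennreal (w ob + w' ob) \<partial>P) \<le> ennreal (c + c') * (\<integral>\<^sup>+ob. v (covs ob) \<partial>P)" .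
qed

lemma mean_dominated_cmult:
  assumes [measurable]: "w \<in> borel_measurable borel"
    and dom: "mean_dominated w c" and nonneg: "0 \<le> k" "0 \<le> c"
  shows "mean_dominated (\<lambda>ob. k * w ob) (k * c)"
  unfolding mean_dominated_def
proof (intro allI impI)
  fix v :: "real ^ 'p \<Rightarrow> ennreal" assume v [measurable]: "v \<in> borel_measurable borel"
  have "(\<integral>\<^sup>+ob. v (covs ob) * ennreal (k * w ob) \<partial>P) = ennreal k * (\<integral>\<^sup>+ob. v (covs ob) * ennreal (w ob) \<partial>P)"
    by (subst nn_integral_cmult[symmetric]) (auto simp: nonneg ennreal_mult' mult_ac)
  also have "\<dots> \<le> ennreal (k * c) * (\<integral>\<^sup>+ob. v (covs ob) \<partial>P)"
    using mult_left_mono[OF mean_dominatedD[OF dom(1) v], of "ennreal k"]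
    by (simp add: nonneg ennreal_mult mult.assoc)
  finally show "(\<integral>\<^sup>+ob. v (covs ob) * ennreal (k * w ob) \<partial>P) \<le> ennreal (k * c) * (\<integral>\<^sup>+ob. v (covs ob) \<partial>P)" .
qed

lemma mean_dominated_integrable:
  assumes [measurable]: "f \<in> borel_measurable borel" and "mean_dominated (\<lambda>ob. \<bar>f ob\<bar>) \<kappa>"
  shows "integrable P f"
proof (rule integrableI_bounded)
  have "(\<integral>\<^sup>+ob. ennreal (norm (f ob)) \<partial>P) \<le> ennreal \<kappa>"
    using mean_dominatedD[OF assms(2), of "\<lambda>_. 1"] by simp
  then show "(\<integral>\<^sup>+ob. ennreal (norm (f ob)) \<partial>P) < \<infinity>"
    using le_less_trans by fastforce
qed simp

lemma mean_dominated_set_integral: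
  assumes [measurable]: "f \<in> borel_measurable borel" "B \<in> sets borel"
    and dom: "mean_dominated (\<lambda>ob. \<bar>f ob\<bar>) \<kappa>" and "0 \<le> \<kappa>"
  shows "(\<integral>ob. indicator B (covs ob) * \<bar>f ob\<bar> \<partial>P) \<le> \<kappa> * measure P (covs -` B)"
proof -
  have B: "covs -` B \<in> sets P"
    using measurable_sets[of covs P borel B] by simp
  have int: "integrable P f" by (rule mean_dominated_integrable[OF _ dom]) simp
  have "ennreal (\<integral>ob. indicator B (covs ob) * \<bar>f ob\<bar> \<partial>P) = (\<integral>\<^sup>+ob. ennreal (indicator B (covs ob) * \<bar>f ob\<bar>) \<partial>P)"
    using int by (intro nn_integral_eq_integral[symmetric] integrable_real_mult_indicator AE_I2)
      (auto intro: Bochner_Integration.integrable_bound[OF int] simp: indicator_def)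
  also have "\<dots> = (\<integral>\<^sup>+ob. indicator B (covs ob) * ennreal \<bar>f ob\<bar> \<partial>P)"
    by (intro nn_integral_cong) (auto simp: indicator_def)
  also have "\<dots> \<le> ennreal \<kappa> * (\<integral>\<^sup>+ob. indicator B (covs ob) \<partial>P)"
    by (rule mean_dominatedD[OF dom]) simp
  also have "(\<integral>\<^sup>+ob. indicator B (covs ob) \<partial>P) = ennreal (measure P (covs -` B))"
  proof -
    have "(\<integral>\<^sup>+ob. indicator B (covs ob) \<partial>P) = (\<integral>\<^sup>+ob. indicator (covs -` B) ob \<partial>P)"
      by (intro nn_integral_cong) (auto simp: indicator_def)
    then show ?thesis
      using B by (simp add: emeasure_eq_measure)
  qed
  finally show ?thesis
    using \<open>0 \<le> \<kappa>\<close> by (simp add: ennreal_mult[symmetric])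
qed

text \<open>On the set where \<open>r\<close> exceeds \<open>c\<close> the function \<open>r - c\<close> is positive, but its integral over that set is at most zero.\<close>

lemma AE_le_of_set_integrals:
  assumes [measurable]: "r \<in> borel_measurable borel" and int: "integrable P (\<lambda>ob. r (covs ob))"
    and le: "\<And>B. B \<in> sets borel \<Longrightarrow> (\<integral>ob. indicator B (covs ob) * r (covs ob) \<partial>P) \<le> c * measure P (covs -` B)"
  shows "AE ob in P. r (covs ob) \<le> c"
proof -
  define B where "B = {x. c < r x}"
  have [measurable]: "B \<in> sets borel" unfolding B_def by measurable
  have B: "covs -` B \<in> sets P"
    using measurable_sets[of covs P borel B] by simp
  let ?f = "\<lambda>ob. indicator B (covs ob) * (r (covs ob) - c)"
  have i1: "integrable P (\<lambda>ob. indicator B (covs ob) * r (covs ob))"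
    by (rule Bochner_Integration.integrable_bound[OF int]) (auto simp: indicator_def)
  have i2: "integrable P (\<lambda>ob. c * indicator (covs -` B) ob)"
    using B by (intro integrable_mult_right) (simp add: integrable_indicator_iff emeasure_eq_measure)
  have eq: "?f = (\<lambda>ob. indicator B (covs ob) * r (covs ob) - c * indicator (covs -` B) ob)"
    by (auto simp: indicator_def)
  have intf: "integrable P ?f" unfolding eq by (intro Bochner_Integration.integrable_diff i1 i2)
  have nn: "AE ob in P. 0 \<le> ?f ob" by (auto simp: B_def indicator_def)
  have "(\<integral>ob. ?f ob \<partial>P) = (\<integral>ob. indicator B (covs ob) * r (covs ob) \<partial>P) - c * measure P (covs -` B)"
    unfolding eq using i1 i2 B by (subst Bochner_Integration.integral_diff) simp_all
  also have "\<dots> \<le> 0" using le[of B] by simp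
  finally have "(\<integral>ob. ?f ob \<partial>P) = 0"
    using integral_nonneg_AE[OF nn] by simp
  then have "AE ob in P. ?f ob = 0"
    using integral_nonneg_eq_0_iff_AE[OF intf nn] by simp
  then show ?thesis by eventually_elim (auto simp: B_def indicator_def split: if_splits)
qed

end

section \<open>The second-order bias\<close>

text \<open>The summand of the estimator, as a function of an observation, with arbitrary functions in the
  places of the four nuisance functions.\<close>

definition plug_in :: "(real ^ 'p::finite \<Rightarrow> real) \<Rightarrow> (real ^ 'p \<Rightarrow> real) \<Rightarrow> (real ^ 'p \<Rightarrow> real) \<Rightarrow>
    (real ^ 'p \<Rightarrow> real) \<Rightarrow> 'p obs \<Rightarrow> real" where
  "plug_in m p l b ob = (trt ob - p (covs ob)) / b (covs ob)
     * (resp ob - m (covs ob) - l (covs ob) * (trt ob - p (covs ob))) + l (covs ob)"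

lemma integrable_mult_square_integrable:
  fixes f g c :: "'a \<Rightarrow> real"
  assumes f: "f \<in> borel_measurable M" "integrable M (\<lambda>x. (f x)\<^sup>2)"
    and g: "g \<in> borel_measurable M" "integrable M (\<lambda>x. (g x)\<^sup>2)"
    and c: "c \<in> borel_measurable M" "AE x in M. \<bar>c x\<bar> \<le> C"
  shows "integrable M (\<lambda>x. c x * (f x * g x))"
proof (rule Bochner_Integration.integrable_bound)
  show "integrable M (\<lambda>x. C * ((f x)\<^sup>2 + (g x)\<^sup>2))"
    using f g by (intro integrable_mult_right Bochner_Integration.integrable_add)
  show "AE x in M. norm (c x * (f x * g x)) \<le> norm (C * ((f x)\<^sup>2 + (g x)\<^sup>2))"
    using c(2)
  proof eventually_elim
    case (elim x)
    have "\<bar>f x * g x\<bar> \<le> (f x)\<^sup>2 + (g x)\<^sup>2"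
      using sum_squares_bound[of "\<bar>f x\<bar>" "\<bar>g x\<bar>"] mult_nonneg_nonneg[OF abs_ge_zero abs_ge_zero, of "f x" "g x"]
      unfolding abs_mult power2_abs by linarith
    then have "\<bar>c x\<bar> * \<bar>f x * g x\<bar> \<le> C * ((f x)\<^sup>2 + (g x)\<^sup>2)"
      using elim by (intro mult_mono) auto
    moreover have "0 \<le> C" using elim abs_ge_zero[of "c x"] by linarith
    ultimately show ?case by (simp add: abs_mult)
  qed
qed (use f g c in measurable)

lemma integrable_square_diff:
  fixes f g :: "'a \<Rightarrow> real"
  assumes [measurable]: "f \<in> borel_measurable M" and f: "integrable M (\<lambda>x. (f x)\<^sup>2)"
    and [measurable]: "g \<in> borel_measurable M" and g: "integrable M (\<lambda>x. (g x)\<^sup>2)"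
  shows "integrable M (\<lambda>x. (f x - g x)\<^sup>2)"
proof (rule Bochner_Integration.integrable_bound)
  show "integrable M (\<lambda>x. 2 * (f x)\<^sup>2 + 2 * (g x)\<^sup>2)" using f g by simp
  have "(f x - g x)\<^sup>2 \<le> 2 * (f x)\<^sup>2 + 2 * (g x)\<^sup>2" for x
    using zero_le_power2[of "f x + g x"] by (simp add: power2_eq_square algebra_simps)
  then show "AE x in M. norm ((f x - g x)\<^sup>2) \<le> norm (2 * (f x)\<^sup>2 + 2 * (g x)\<^sup>2)" by simp
qed measurable

context obs_law
begin

lemma functionals_measurable [measurable]:
  "mu_fun P \<in> borel_measurable borel" "pi_fun P \<in> borel_measurable borel"
  "beta_fun P \<in> borel_measurable borel" "cov_fun P \<in> borel_measurable borel"
  "lambda_fun P \<in> borel_measurable borel"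
proof -
  show [measurable]: "mu_fun P \<in> borel_measurable borel" "pi_fun P \<in> borel_measurable borel"
    "beta_fun P \<in> borel_measurable borel" "cov_fun P \<in> borel_measurable borel"
    unfolding mu_fun_def pi_fun_def beta_fun_def cov_fun_def by measurable
  show "lambda_fun P \<in> borel_measurable borel"
    unfolding lambda_fun_def[abs_def] by measurable
qed

text \<open>Write both factors of the summand as a residual plus an estimation error and expand.  Terms that are linear in a
  residual have mean zero, and the products \<open>(A - \<pi>)(Y - \<mu>)\<close> and \<open>(A - \<pi>)\<^sup>2\<close> may be replaced by their conditional means
  \<open>\<lambda> \<beta>\<close> and \<open>\<beta>\<close>.  What is left factors into products of two errors.\<close>

theorem plug_in_bias:
  assumes [measurable]: "m \<in> borel_measurable borel" "p \<in> borel_measurable borel"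
      "l \<in> borel_measurable borel" "b \<in> borel_measurable borel"
    and int: "integrable P resp" "integrable P trt"
    and sq: "integrable P (\<lambda>ob. (trt ob - pi_fun P (covs ob))\<^sup>2)"
      "integrable P (\<lambda>ob. (resp ob - mu_fun P (covs ob))\<^sup>2)"
      "integrable P (\<lambda>ob. (pi_fun P (covs ob) - p (covs ob))\<^sup>2)"
      "integrable P (\<lambda>ob. (mu_fun P (covs ob) - m (covs ob))\<^sup>2)"
    and lam: "integrable P (\<lambda>ob. lambda_fun P (covs ob))"
    and beta: "AE ob in P. beta_fun P (covs ob) \<noteq> 0"
    and eps: "0 < eps" "AE ob in P. eps < b (covs ob)"
    and l: "AE ob in P. \<bar>l (covs ob)\<bar> \<le> K"
  defines "bias \<equiv> \<lambda>ob. (lambda_fun P (covs ob) - l (covs ob)) * (beta_fun P (covs ob) - b (covs ob)) / b (covs ob)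
      + (pi_fun P (covs ob) - p (covs ob)) * (mu_fun P (covs ob) - m (covs ob)) / b (covs ob)
      - l (covs ob) * (pi_fun P (covs ob) - p (covs ob))\<^sup>2 / b (covs ob)"
  shows "integrable P (plug_in m p l b)" "integrable P bias"
    and "(\<integral>ob. plug_in m p l b ob \<partial>P) - psi P = (\<integral>ob. bias ob \<partial>P)"
proof -
  let ?a = "\<lambda>ob. trt ob - pi_fun P (covs ob)" and ?y = "\<lambda>ob. resp ob - mu_fun P (covs ob)"
  let ?u = "\<lambda>x. pi_fun P x - p x" and ?v = "\<lambda>x. mu_fun P x - m x"
  have K: "0 \<le> K"
  proof -
    have "AE ob in P. 0 \<le> K" using l by eventually_elim auto
    then show ?thesis by simp
  qed
  have ib: "AE ob in P. \<bar>1 / b (covs ob)\<bar> \<le> 1 / eps"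
    using eps(2) by eventually_elim (use eps(1) in \<open>auto simp: field_simps\<close>)
  have lb: "AE ob in P. \<bar>l (covs ob) / b (covs ob)\<bar> \<le> K / eps"
    using eps(2) l by eventually_elim (use eps(1) K in \<open>auto intro!: frac_le\<close>)
  note prod = integrable_mult_square_integrable[OF _ _ _ _ _ ib] integrable_mult_square_integrable[OF _ _ _ _ _ lb]
  \<comment> \<open>the terms of the expansion: \<open>a\<close>, \<open>y\<close> stand for residuals and \<open>u\<close>, \<open>v\<close> for errors of the conditional means\<close>
  define ay where "ay = (\<lambda>ob. (1 / b (covs ob)) * (?a ob * ?y ob))"
  define av where "av = (\<lambda>ob. (1 / b (covs ob)) * (?a ob * ?v (covs ob)))"
  define uy where "uy = (\<lambda>ob. (1 / b (covs ob)) * (?u (covs ob) * ?y ob))"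
  define uv where "uv = (\<lambda>ob. (1 / b (covs ob)) * (?u (covs ob) * ?v (covs ob)))"
  define aa where "aa = (\<lambda>ob. (l (covs ob) / b (covs ob)) * (?a ob * ?a ob))"
  define ua where "ua = (\<lambda>ob. (l (covs ob) / b (covs ob)) * (?u (covs ob) * ?a ob))"
  define uu where "uu = (\<lambda>ob. (l (covs ob) / b (covs ob)) * (?u (covs ob) * ?u (covs ob)))"
  define cb where "cb = (\<lambda>ob. (1 / b (covs ob)) * cov_fun P (covs ob))"
  define lb' where "lb' = (\<lambda>ob. (l (covs ob) / b (covs ob)) * beta_fun P (covs ob))"
  note defs = ay_def av_def uy_def uv_def aa_def ua_def uu_def cb_def lb'_def
  have ints: "integrable P ay" "integrable P av" "integrable P uy" "integrable P uv"
      "integrable P aa" "integrable P ua" "integrable P uu"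
    unfolding defs by (rule prod; use sq in \<open>simp; measurable?\<close>)+
  have il: "integrable P (\<lambda>ob. l (covs ob))"
    using l by (intro integrable_const_bound[where B=K]) (auto elim!: eventually_mono)
  have split: "plug_in m p l b ob = ay ob + av ob + uy ob + uv ob - aa ob - 2 * ua ob - uu ob + l (covs ob)" for ob
    unfolding plug_in_def defs by (simp add: divide_inverse) algebra
  show "integrable P (plug_in m p l b)"
    unfolding split[abs_def] using ints il by simp
  have i_av: "(\<integral>ob. av ob \<partial>P) = 0"
    using integral_residual[of trt "\<lambda>x. ?v x / b x"] int ints(2) by (simp add: pi_fun_def mult_ac av_def)
  have i_ua: "(\<integral>ob. ua ob \<partial>P) = 0"
    using integral_residual[of trt "\<lambda>x. l x * ?u x / b x"] int ints(6) by (simp add: pi_fun_def mult_ac ua_def)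
  have i_uy: "(\<integral>ob. uy ob \<partial>P) = 0"
    using integral_residual[of resp "\<lambda>x. ?u x / b x"] int ints(3) by (simp add: mu_fun_def mult_ac uy_def)
  have i_ay: "integrable P cb" "(\<integral>ob. ay ob \<partial>P) = (\<integral>ob. cb ob \<partial>P)"
    using integrable_cond_mean[of "\<lambda>ob. ?a ob * ?y ob" "\<lambda>x. 1 / b x"]
      integral_cond_mean[of "\<lambda>ob. ?a ob * ?y ob" "\<lambda>x. 1 / b x"] ints(1)
    by (simp_all add: cov_fun_def ay_def cb_def)
  have i_aa: "integrable P lb'" "(\<integral>ob. aa ob \<partial>P) = (\<integral>ob. lb' ob \<partial>P)"
    using integrable_cond_mean[of "\<lambda>ob. ?a ob * ?a ob" "\<lambda>x. l x / b x"]
      integral_cond_mean[of "\<lambda>ob. ?a ob * ?a ob" "\<lambda>x. l x / b x"] ints(5)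
    by (simp_all add: beta_fun_def power2_eq_square aa_def lb'_def)
  let ?g = "\<lambda>ob. cb ob + uv ob - lb' ob - uu ob + l (covs ob) - lambda_fun P (covs ob)"
  have g: "integrable P ?g"
    using i_ay(1) i_aa(1) ints il lam by simp
  have "(\<integral>ob. plug_in m p l b ob \<partial>P) - psi P = (\<integral>ob. ?g ob \<partial>P)"
    unfolding split[abs_def] psi_def
    using ints il lam i_av i_ua i_uy i_ay i_aa by simp
  moreover have eq: "AE ob in P. ?g ob = bias ob"
    using eps(2) beta
  proof eventually_elim
    case (elim ob)
    then have "b (covs ob) * inverse (b (covs ob)) = 1"
      and "cov_fun P (covs ob) = lambda_fun P (covs ob) * beta_fun P (covs ob)"
      using eps(1) by (auto simp: lambda_fun_def)
    then show ?case
      unfolding bias_def defs divide_inverse by algebra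
  qed
  moreover have [measurable]: "bias \<in> borel_measurable P"
    unfolding bias_def by measurable
  ultimately show "integrable P bias" "(\<integral>ob. plug_in m p l b ob \<partial>P) - psi P = (\<integral>ob. bias ob \<partial>P)"
    using g integrable_cong_AE[OF _ _ eq] integral_cong_AE[OF _ _ eq] by simp_all
qed

end

section \<open>Conditional moments under a tilted law\<close>

lemma abs_integral_le_AE:
  fixes f g :: "'a \<Rightarrow> real"
  assumes "integrable M f" "integrable M g" "AE x in M. \<bar>f x\<bar> \<le> g x"
  shows "\<bar>\<integral>x. f x \<partial>M\<bar> \<le> (\<integral>x. g x \<partial>M)"
  using assms by (intro order_trans[OF integral_abs_bound] integral_mono_AE) auto

context obs_law
begin

lemma integrable_indicator_covs:
  fixes f :: "'p obs \<Rightarrow> real"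
  assumes [measurable]: "B \<in> sets borel" and int: "integrable P f"
  shows "integrable P (\<lambda>ob. indicator B (covs ob) * f ob)"
proof (rule Bochner_Integration.integrable_bound[OF int])
  have [measurable]: "f \<in> borel_measurable P" using int by simp
  show "(\<lambda>ob. indicator B (covs ob) * f ob) \<in> borel_measurable P" by measurable
qed (auto simp: indicator_def)

lemma AE_abs_cond_mean_le:
  assumes [measurable]: "f \<in> borel_measurable borel" and dom: "mean_dominated (\<lambda>ob. \<bar>f ob\<bar>) \<kappa>" and \<kappa>: "0 \<le> \<kappa>"
  shows "AE ob in P. \<bar>cond_mean P f (covs ob)\<bar> \<le> \<kappa>"
proof -
  have int: "integrable P f" by (rule mean_dominated_integrable[OF _ dom]) simp
  have r: "integrable P (\<lambda>ob. cond_mean P f (covs ob))"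
    using integrable_cond_mean[of f "\<lambda>_. 1"] int by simp
  have bnd: "\<bar>\<integral>ob. indicator B (covs ob) * cond_mean P f (covs ob) \<partial>P\<bar> \<le> \<kappa> * prob (covs -` B)"
    if [measurable]: "B \<in> sets borel" for B :: "(real^'p) set"
  proof -
    have "(\<integral>ob. indicator B (covs ob) * cond_mean P f (covs ob) \<partial>P) = (\<integral>ob. indicator B (covs ob) * f ob \<partial>P)"
      by (rule integral_cond_mean) (use int in \<open>auto intro: integrable_indicator_covs\<close>)
    moreover have "\<bar>\<integral>ob. indicator B (covs ob) * f ob \<partial>P\<bar> \<le> (\<integral>ob. \<bar>indicator B (covs ob) * f ob\<bar> \<partial>P)"
      by (rule integral_abs_bound)
    moreover have "(\<integral>ob. \<bar>indicator B (covs ob) * f ob\<bar> \<partial>P) = (\<integral>ob. indicator B (covs ob) * \<bar>f ob\<bar> \<partial>P)"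
      by (simp add: abs_mult)
    moreover have "\<dots> \<le> \<kappa> * prob (covs -` B)"
      by (rule mean_dominated_set_integral[OF _ _ dom \<kappa>]) auto
    ultimately show ?thesis by simp
  qed
  have "AE ob in P. cond_mean P f (covs ob) \<le> \<kappa>"
    by (rule AE_le_of_set_integrals[OF _ r]) (use bnd in \<open>auto simp: abs_le_iff\<close>)
  moreover have "AE ob in P. - cond_mean P f (covs ob) \<le> \<kappa>"
    using AE_le_of_set_integrals[of "\<lambda>x. - cond_mean P f x" \<kappa>] r bnd by (auto simp: abs_le_iff)
  ultimately show ?thesis by eventually_elim auto
qed

end

text \<open>The bound \<open>1/2\<close> keeps the density away from zero, so that the tilted law \<open>Q\<close> has the same null sets as \<open>P\<close> and
  \<open>P\<close>-probabilities are at most twice \<open>Q\<close>-probabilities.\<close>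

locale tilted_law = obs_law P for P :: "'p::finite obs measure" +
  fixes q :: "'p obs \<Rightarrow> real" and s :: real
  assumes q_measurable [measurable]: "q \<in> borel_measurable borel"
    and q_nonneg: "\<And>ob. 0 \<le> q ob"
    and q_total: "(\<integral>\<^sup>+ob. ennreal (q ob) \<partial>P) = 1"
    and q_close: "AE ob in P. \<bar>q ob - 1\<bar> \<le> s"
    and s_half: "s \<le> 1/2"
begin

abbreviation Q :: "'p obs measure" where "Q \<equiv> density P (\<lambda>ob. ennreal (q ob))"

lemma s_nonneg: "0 \<le> s"
proof -
  have "AE ob in P. 0 \<le> s" using q_close by eventually_elim auto
  then show ?thesis by simp
qed

sublocale Q: obs_law Q
proof (intro obs_law.intro obs_law_axioms.intro prob_spaceI)
  show "emeasure Q (space Q) = 1"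
    using q_total by (subst emeasure_density) simp_all
qed simp

lemma q_bounds: "AE ob in P. 1/2 \<le> q ob \<and> q ob \<le> 3/2"
  using q_close by eventually_elim (use s_half in auto)

lemma AE_tilted: "(AE ob in Q. R ob) \<longleftrightarrow> (AE ob in P. R ob)"
proof
  assume "AE ob in Q. R ob"
  then have "AE ob in P. 0 < ennreal (q ob) \<longrightarrow> R ob" by (simp add: AE_density)
  then show "AE ob in P. R ob" using q_bounds by eventually_elim auto
next
  assume "AE ob in P. R ob"
  then show "AE ob in Q. R ob" by (subst AE_density) (auto elim: eventually_mono)
qed

lemma integrable_mult_tilt:
  fixes f :: "'p obs \<Rightarrow> real"
  assumes "integrable P f" shows "integrable P (\<lambda>ob. q ob * f ob)"
proof (rule Bochner_Integration.integrable_bound)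
  show "integrable P (\<lambda>ob. 3/2 * f ob)" using assms by simp
  have [measurable]: "f \<in> borel_measurable P" using assms by simp
  show "(\<lambda>ob. q ob * f ob) \<in> borel_measurable P" by measurable
  show "AE ob in P. norm (q ob * f ob) \<le> norm (3 / 2 * f ob)"
    using q_bounds
  proof eventually_elim
    case (elim ob)
    then have "q ob * \<bar>f ob\<bar> \<le> 3/2 * \<bar>f ob\<bar>" by (intro mult_right_mono) auto
    then show ?case using q_nonneg[of ob] by (simp add: abs_mult)
  qed
qed

lemma integrable_tilted:
  fixes f :: "'p obs \<Rightarrow> real"
  assumes "integrable P f" shows "integrable Q f"
  using integrable_mult_tilt[OF assms] assms
  by (subst integrable_real_density) (auto simp: q_nonneg)

lemma integral_tilted:
  fixes f :: "'p obs \<Rightarrow> real"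
  assumes [measurable]: "f \<in> borel_measurable borel"
  shows "(\<integral>ob. f ob \<partial>Q) = (\<integral>ob. q ob * f ob \<partial>P)"
  by (subst integral_real_density) (auto simp: q_nonneg)

lemma measure_le_tilted:
  assumes A: "A \<in> sets borel" shows "prob A \<le> 2 * measure Q A"
proof -
  have A' [measurable]: "A \<in> sets P" using A by simp
  have iA: "integrable P (indicator A :: _ \<Rightarrow> real)"
    by (simp add: A integrable_indicator_iff emeasure_eq_measure)
  have "measure Q A = (\<integral>ob. indicator A ob \<partial>Q)" by (simp add: A)
  also have "\<dots> = (\<integral>ob. q ob * indicator A ob \<partial>P)"
    using A by (intro integral_tilted) simp
  also have "\<dots> \<ge> (\<integral>ob. 1/2 * indicator A ob \<partial>P)"
    using q_bounds by (intro integral_mono_AE integrable_mult_tilt iA integrable_mult_right)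
      (auto elim!: eventually_mono simp: indicator_def)
  finally show ?thesis by simp
qed

text \<open>If \<open>f = f\<^sub>0 + h\<close> where \<open>r(X)\<close> is the conditional mean of \<open>f\<^sub>0\<close> under \<open>P\<close>, then over an event
  \<open>X \<in> B\<close> the integral of \<open>f - r(X)\<close> with respect to \<open>Q\<close> only sees the perturbations \<open>q - 1\<close> and \<open>h\<close>.  The constants
  come from \<open>q \<le> 3/2\<close> and from the factor \<open>2\<close> in the passage from \<open>P\<close> to \<open>Q\<close>.\<close>

theorem cond_mean_tilted_close:
  fixes f0 h f :: "'p obs \<Rightarrow> real" and r :: "real ^ 'p \<Rightarrow> real"
  assumes [measurable]: "f0 \<in> borel_measurable borel" "h \<in> borel_measurable borel" "r \<in> borel_measurable borel"
    and f: "\<And>ob. f ob = f0 ob + h ob"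
    and int: "integrable P f0" "integrable P (\<lambda>ob. r (covs ob))"
    and centered: "\<And>B :: (real ^ 'p) set. B \<in> sets borel \<Longrightarrow> (\<integral>ob. indicator B (covs ob) * (f0 ob - r (covs ob)) \<partial>P) = 0"
    and dom: "mean_dominated (\<lambda>ob. \<bar>f0 ob - r (covs ob)\<bar>) \<kappa>" "mean_dominated (\<lambda>ob. \<bar>h ob\<bar>) \<kappa>'"
    and nonneg: "0 \<le> \<kappa>" "0 \<le> \<kappa>'"
  shows "AE ob in P. \<bar>cond_mean Q f (covs ob) - r (covs ob)\<bar> \<le> 2 * \<kappa> * s + 3 * \<kappa>'"
proof -
  have fm [measurable]: "f \<in> borel_measurable borel" unfolding f[abs_def] by measurable
  have ih: "integrable P h" by (rule mean_dominated_integrable[OF _ dom(2)]) simp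
  have "integrable P f" unfolding f[abs_def] using int ih by simp
  then have iQ: "integrable Q f" "integrable Q (\<lambda>ob. r (covs ob))"
    using int by (auto intro: integrable_tilted)
  let ?d = "\<lambda>x. cond_mean Q f x - r x"
  have icm: "integrable Q (\<lambda>ob. cond_mean Q f (covs ob))"
    using Q.integrable_cond_mean[of f "\<lambda>_. 1"] iQ by simp
  have id: "integrable Q (\<lambda>ob. ?d (covs ob))"
    using icm iQ by simp
  have bnd: "\<bar>\<integral>ob. indicator B (covs ob) * ?d (covs ob) \<partial>Q\<bar> \<le> (2 * \<kappa> * s + 3 * \<kappa>') * measure Q (covs -` B)"
    if B [measurable]: "B \<in> sets borel" for B :: "(real^'p) set"
  proof -
    let ?I = "\<lambda>ob. indicator B (covs ob) :: real"
    let ?e = "\<lambda>ob. f0 ob - r (covs ob)"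
    have cB: "covs -` B \<in> sets borel"
      using measurable_sets[of covs borel borel B] by simp
    have ie: "integrable P ?e" using int by simp
    note iI = integrable_indicator_covs[OF B ie] integrable_indicator_covs[OF B ih]
    have "(\<integral>ob. ?I ob * ?d (covs ob) \<partial>Q) = (\<integral>ob. ?I ob * cond_mean Q f (covs ob) \<partial>Q) - (\<integral>ob. ?I ob * r (covs ob) \<partial>Q)"
      using Q.integrable_indicator_covs[OF B icm] Q.integrable_indicator_covs[OF B iQ(2)]
      by (simp add: right_diff_distrib)
    also have "(\<integral>ob. ?I ob * cond_mean Q f (covs ob) \<partial>Q) = (\<integral>ob. ?I ob * f ob \<partial>Q)"
      using Q.integrable_indicator_covs[OF B iQ(1)] by (intro Q.integral_cond_mean) auto
    also have "\<dots> - (\<integral>ob. ?I ob * r (covs ob) \<partial>Q) = (\<integral>ob. ?I ob * (f ob - r (covs ob)) \<partial>Q)"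
      using Q.integrable_indicator_covs[OF B iQ(1)] Q.integrable_indicator_covs[OF B iQ(2)]
      by (simp add: right_diff_distrib)
    also have "\<dots> = (\<integral>ob. q ob * (?I ob * (f ob - r (covs ob))) \<partial>P)"
      by (rule integral_tilted) measurable
    also have "\<dots> = (\<integral>ob. q ob * (?I ob * ?e ob) + q ob * (?I ob * h ob) \<partial>P)"
      by (intro Bochner_Integration.integral_cong) (auto simp: f algebra_simps)
    also have "\<dots> = (\<integral>ob. q ob * (?I ob * ?e ob) \<partial>P) + (\<integral>ob. q ob * (?I ob * h ob) \<partial>P)"
      by (intro Bochner_Integration.integral_add integrable_mult_tilt iI)
    also have "(\<integral>ob. q ob * (?I ob * ?e ob) \<partial>P) = (\<integral>ob. q ob * (?I ob * ?e ob) \<partial>P) - (\<integral>ob. ?I ob * ?e ob \<partial>P)"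
      using centered[OF B] by simp
    also have "\<dots> = (\<integral>ob. (q ob - 1) * (?I ob * ?e ob) \<partial>P)"
      using integrable_mult_tilt[OF iI(1)] iI(1)
      by (subst Bochner_Integration.integral_diff[symmetric]) (auto simp: algebra_simps)
    finally have eq: "(\<integral>ob. ?I ob * ?d (covs ob) \<partial>Q)
        = (\<integral>ob. (q ob - 1) * (?I ob * ?e ob) \<partial>P) + (\<integral>ob. q ob * (?I ob * h ob) \<partial>P)" .
    have "\<bar>\<integral>ob. (q ob - 1) * (?I ob * ?e ob) \<partial>P\<bar> \<le> (\<integral>ob. s * (?I ob * \<bar>?e ob\<bar>) \<partial>P)"
    proof (rule abs_integral_le_AE)
      show "integrable P (\<lambda>ob. (q ob - 1) * (?I ob * ?e ob))"
        using integrable_mult_tilt[OF iI(1)] iI(1) by (simp add: left_diff_distrib)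
      show "integrable P (\<lambda>ob. s * (?I ob * \<bar>?e ob\<bar>))"
        using integrable_indicator_covs[OF B integrable_abs[OF ie]] by simp
      show "AE ob in P. \<bar>(q ob - 1) * (?I ob * ?e ob)\<bar> \<le> s * (?I ob * \<bar>?e ob\<bar>)"
        using q_close by eventually_elim (auto simp: abs_mult intro!: mult_right_mono)
    qed
    also have "\<dots> \<le> s * (\<kappa> * prob (covs -` B))"
      using mean_dominated_set_integral[OF _ B dom(1)] nonneg s_nonneg
      by (simp add: mult_left_mono)
    finally have 1: "\<bar>\<integral>ob. (q ob - 1) * (?I ob * ?e ob) \<partial>P\<bar> \<le> s * (\<kappa> * prob (covs -` B))" .
    have "\<bar>\<integral>ob. q ob * (?I ob * h ob) \<partial>P\<bar> \<le> (\<integral>ob. 3/2 * (?I ob * \<bar>h ob\<bar>) \<partial>P)"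
    proof (rule abs_integral_le_AE)
      show "integrable P (\<lambda>ob. q ob * (?I ob * h ob))"
        by (rule integrable_mult_tilt[OF iI(2)])
      show "integrable P (\<lambda>ob. 3/2 * (?I ob * \<bar>h ob\<bar>))"
        using integrable_indicator_covs[OF B integrable_abs[OF ih]] by simp
      show "AE ob in P. \<bar>q ob * (?I ob * h ob)\<bar> \<le> 3/2 * (?I ob * \<bar>h ob\<bar>)"
        using q_bounds
      proof eventually_elim
        case (elim ob)
        then have "q ob * \<bar>?I ob * h ob\<bar> \<le> 3/2 * \<bar>?I ob * h ob\<bar>" by (intro mult_right_mono) auto
        then show ?case using q_nonneg[of ob] by (simp add: abs_mult)
      qed
    qed
    also have "\<dots> \<le> 3/2 * (\<kappa>' * prob (covs -` B))"
      using mean_dominated_set_integral[OF _ B dom(2)] nonneg by simp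
    finally have 2: "\<bar>\<integral>ob. q ob * (?I ob * h ob) \<partial>P\<bar> \<le> 3/2 * (\<kappa>' * prob (covs -` B))" .
    have "\<bar>\<integral>ob. ?I ob * ?d (covs ob) \<partial>Q\<bar> \<le> (\<kappa> * s + 3/2 * \<kappa>') * prob (covs -` B)"
      unfolding eq using 1 2 by (simp add: algebra_simps)
    also have "\<dots> \<le> (\<kappa> * s + 3/2 * \<kappa>') * (2 * measure Q (covs -` B))"
      using measure_le_tilted[OF cB] nonneg s_nonneg by (intro mult_left_mono) auto
    finally show ?thesis by (simp add: algebra_simps)
  qed
  have "AE ob in Q. ?d (covs ob) \<le> 2 * \<kappa> * s + 3 * \<kappa>'"
    by (rule Q.AE_le_of_set_integrals[OF _ id]) (use bnd in \<open>auto simp: abs_le_iff\<close>)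
  moreover have "AE ob in Q. - ?d (covs ob) \<le> 2 * \<kappa> * s + 3 * \<kappa>'"
    using Q.AE_le_of_set_integrals[of "\<lambda>x. - ?d x" "2 * \<kappa> * s + 3 * \<kappa>'"] id bnd
    by (simp add: abs_le_iff del: minus_diff_eq)
  ultimately have "AE ob in Q. \<bar>?d (covs ob)\<bar> \<le> 2 * \<kappa> * s + 3 * \<kappa>'"
    by eventually_elim auto
  then show ?thesis by (simp only: AE_tilted)
qed

corollary cond_mean_tilted_close_dominated:
  fixes f0 h f :: "'p obs \<Rightarrow> real"
  assumes [measurable]: "f0 \<in> borel_measurable borel" "h \<in> borel_measurable borel"
    and f: "\<And>ob. f ob = f0 ob + h ob"
    and dom: "mean_dominated (\<lambda>ob. \<bar>f0 ob\<bar>) \<kappa>" "mean_dominated (\<lambda>ob. \<bar>h ob\<bar>) \<kappa>'"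
    and nonneg: "0 \<le> \<kappa>" "0 \<le> \<kappa>'"
  shows "AE ob in P. \<bar>cond_mean Q f (covs ob) - cond_mean P f0 (covs ob)\<bar> \<le> 4 * \<kappa> * s + 3 * \<kappa>'"
proof -
  have int: "integrable P f0" by (rule mean_dominated_integrable[OF _ dom(1)]) simp
  have r: "integrable P (\<lambda>ob. cond_mean P f0 (covs ob))"
    using integrable_cond_mean[of f0 "\<lambda>_. 1"] int by simp
  have "mean_dominated (\<lambda>ob. \<bar>f0 ob\<bar> + \<kappa>) (\<kappa> + \<kappa>)"
    by (rule mean_dominated_add[OF _ _ dom(1) mean_dominated_const]) (use nonneg in auto)
  then have "mean_dominated (\<lambda>ob. \<bar>f0 ob - cond_mean P f0 (covs ob)\<bar>) (\<kappa> + \<kappa>)"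
    by (rule mean_dominated_mono)
      (use AE_abs_cond_mean_le[OF assms(1) dom(1) nonneg(1)] in \<open>auto elim!: eventually_mono\<close>)
  then have "AE ob in P. \<bar>cond_mean Q f (covs ob) - cond_mean P f0 (covs ob)\<bar> \<le> 2 * (\<kappa> + \<kappa>) * s + 3 * \<kappa>'"
    using int r dom nonneg
    by (intro cond_mean_tilted_close[OF assms(1,2) _ f] integral_residual) (auto intro: integrable_indicator_covs)
  then show ?thesis by (simp add: algebra_simps)
qed

end

section \<open>Moment bounds\<close>

lemma le_square: fixes t :: real shows "t \<le> t\<^sup>2 + 1/4"
proof -
  have "t\<^sup>2 + 1/4 - t = (t - 1/2)\<^sup>2" by (simp add: power2_eq_square algebra_simps)
  also have "\<dots> \<ge> 0" by simp
  finally show ?thesis by simp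
qed

lemma square_le_fourth: fixes x :: real shows "x\<^sup>2 \<le> 1 + x ^ 4"
  using le_square[of "x\<^sup>2"] by simp

lemma abs_le_fourth: fixes x :: real shows "\<bar>x\<bar> \<le> 1 + x ^ 4"
  using le_square[of "\<bar>x\<bar>"] le_square[of "x\<^sup>2"] by simp

lemma mult_le_squares: fixes x y :: real shows "\<bar>x * y\<bar> \<le> (x\<^sup>2 + y\<^sup>2) / 2"
  using sum_squares_bound[of "\<bar>x\<bar>" "\<bar>y\<bar>"] by (simp add: abs_mult)

locale moment_law = obs_law P for P :: "'p::finite obs measure" +
  fixes eps K :: real
  assumes integrable_resp: "integrable P resp" and integrable_trt: "integrable P trt"
    and eps_pos: "0 < eps" and K_pos: "0 < K"
    and beta_bounds: "AE ob in P. beta_fun P (covs ob) \<in> {eps<..<K}"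
    and resp_moment: "cond_mean_below P (\<lambda>ob. (resp ob - mu_fun P (covs ob)) ^ 4) K"
    and trt_moment: "cond_mean_below P (\<lambda>ob. (trt ob - pi_fun P (covs ob)) ^ 4) K"
begin

text \<open>The residuals of treatment and response.\<close>

definition A0 :: "'p obs \<Rightarrow> real" where "A0 ob = trt ob - pi_fun P (covs ob)"
definition Y0 :: "'p obs \<Rightarrow> real" where "Y0 ob = resp ob - mu_fun P (covs ob)"

lemma A0_Y0_measurable [measurable]: "A0 \<in> borel_measurable borel" "Y0 \<in> borel_measurable borel"
  unfolding A0_def[abs_def] Y0_def[abs_def] by measurable

text \<open>A common bound for the conditional means of all powers and products that occur, because each of them is at most
  \<open>1 + (A - \<pi>)\<^sup>4 + (Y - \<mu>)\<^sup>4\<close>.\<close>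

definition \<kappa> :: real where "\<kappa> = 1 + 2 * K"

lemma \<kappa>_ge_1: "1 \<le> \<kappa>" and \<kappa>_nonneg: "0 \<le> \<kappa>"
  using K_pos by (simp_all add: \<kappa>_def)

lemma mean_dominated_moment:
  assumes "\<And>ob. w ob \<le> 1 + A0 ob ^ 4 + Y0 ob ^ 4"
  shows "mean_dominated w \<kappa>"
proof -
  have A: "mean_dominated (\<lambda>ob. A0 ob ^ 4) K"
    unfolding A0_def by (rule cond_mean_below_imp_mean_dominated[OF _ trt_moment]) measurable
  have Y: "mean_dominated (\<lambda>ob. Y0 ob ^ 4) K"
    unfolding Y0_def by (rule cond_mean_below_imp_mean_dominated[OF _ resp_moment]) measurable
  have A': "mean_dominated (\<lambda>ob. 1 + A0 ob ^ 4) (1 + K)"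
    using K_pos by (intro mean_dominated_add[OF _ _ mean_dominated_const A]) simp_all
  have "mean_dominated (\<lambda>ob. 1 + A0 ob ^ 4 + Y0 ob ^ 4) (1 + K + K)"
    using K_pos by (intro mean_dominated_add[OF _ _ A' Y]) simp_all
  moreover have "1 + K + K = \<kappa>" by (simp add: \<kappa>_def)
  ultimately show ?thesis
    using assms mean_dominated_mono[of "\<lambda>ob. 1 + A0 ob ^ 4 + Y0 ob ^ 4" \<kappa> w] by simp
qed

lemma moments:
  "mean_dominated (\<lambda>ob. \<bar>A0 ob\<bar>) \<kappa>" "mean_dominated (\<lambda>ob. \<bar>Y0 ob\<bar>) \<kappa>"
  "mean_dominated (\<lambda>ob. (A0 ob)\<^sup>2) \<kappa>" "mean_dominated (\<lambda>ob. (Y0 ob)\<^sup>2) \<kappa>"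
  "mean_dominated (\<lambda>ob. ((A0 ob)\<^sup>2)\<^sup>2) \<kappa>" "mean_dominated (\<lambda>ob. (A0 ob * Y0 ob)\<^sup>2) \<kappa>"
  "mean_dominated (\<lambda>ob. \<bar>A0 ob * Y0 ob\<bar>) \<kappa>"
proof -
  have p4: "0 \<le> x ^ 4" for x :: real by simp
  show "mean_dominated (\<lambda>ob. \<bar>A0 ob\<bar>) \<kappa>"
  proof (rule mean_dominated_moment)
    fix ob show "\<bar>A0 ob\<bar> \<le> 1 + A0 ob ^ 4 + Y0 ob ^ 4"
      using abs_le_fourth[of "A0 ob"] p4[of "A0 ob"] p4[of "Y0 ob"] by linarith
  qed
  show "mean_dominated (\<lambda>ob. \<bar>Y0 ob\<bar>) \<kappa>"
  proof (rule mean_dominated_moment)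
    fix ob show "\<bar>Y0 ob\<bar> \<le> 1 + A0 ob ^ 4 + Y0 ob ^ 4"
      using abs_le_fourth[of "Y0 ob"] p4[of "A0 ob"] p4[of "Y0 ob"] by linarith
  qed
  show "mean_dominated (\<lambda>ob. (A0 ob)\<^sup>2) \<kappa>"
  proof (rule mean_dominated_moment)
    fix ob show "(A0 ob)\<^sup>2 \<le> 1 + A0 ob ^ 4 + Y0 ob ^ 4"
      using square_le_fourth[of "A0 ob"] p4[of "A0 ob"] p4[of "Y0 ob"] by linarith
  qed
  show "mean_dominated (\<lambda>ob. (Y0 ob)\<^sup>2) \<kappa>"
  proof (rule mean_dominated_moment)
    fix ob show "(Y0 ob)\<^sup>2 \<le> 1 + A0 ob ^ 4 + Y0 ob ^ 4"
      using square_le_fourth[of "Y0 ob"] p4[of "A0 ob"] p4[of "Y0 ob"] by linarith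
  qed
  show "mean_dominated (\<lambda>ob. ((A0 ob)\<^sup>2)\<^sup>2) \<kappa>"
    by (rule mean_dominated_moment) simp
  show "mean_dominated (\<lambda>ob. (A0 ob * Y0 ob)\<^sup>2) \<kappa>"
  proof (rule mean_dominated_moment)
    fix ob
    show "(A0 ob * Y0 ob)\<^sup>2 \<le> 1 + A0 ob ^ 4 + Y0 ob ^ 4"
      using mult_le_squares[of "(A0 ob)\<^sup>2" "(Y0 ob)\<^sup>2"] p4[of "A0 ob"] p4[of "Y0 ob"]
      by (simp add: power_mult_distrib) (use p4[of "A0 ob"] p4[of "Y0 ob"] in linarith)
  qed
  show "mean_dominated (\<lambda>ob. \<bar>A0 ob * Y0 ob\<bar>) \<kappa>"
  proof (rule mean_dominated_moment)
    fix ob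
    have "(a + c) / 2 \<le> 1 + b + d" if "a \<le> 1 + b" "c \<le> 1 + d" "0 \<le> b" "0 \<le> d" for a b c d :: real
      using that by simp
    note mean = this[OF square_le_fourth square_le_fourth p4 p4]
    show "\<bar>A0 ob * Y0 ob\<bar> \<le> 1 + A0 ob ^ 4 + Y0 ob ^ 4"
      by (rule order_trans[OF mult_le_squares mean])
  qed
qed

lemma integrable_residual_squares: "integrable P (\<lambda>ob. (A0 ob)\<^sup>2)" "integrable P (\<lambda>ob. (Y0 ob)\<^sup>2)"
  using mean_dominated_integrable[of "\<lambda>ob. (A0 ob)\<^sup>2" \<kappa>] mean_dominated_integrable[of "\<lambda>ob. (Y0 ob)\<^sup>2" \<kappa>]
  by (simp_all add: moments)

lemma beta_fun_eq: "beta_fun P = cond_mean P (\<lambda>ob. (A0 ob)\<^sup>2)"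
  and cov_fun_eq: "cov_fun P = cond_mean P (\<lambda>ob. A0 ob * Y0 ob)"
  by (simp_all add: beta_fun_def cov_fun_def A0_def Y0_def)

lemma AE_abs_lambda_le: "AE ob in P. \<bar>lambda_fun P (covs ob)\<bar> \<le> \<kappa> / eps"
proof -
  have "AE ob in P. \<bar>cov_fun P (covs ob)\<bar> \<le> \<kappa>"
    unfolding cov_fun_eq by (rule AE_abs_cond_mean_le) (use moments \<kappa>_nonneg in auto)
  then show ?thesis using beta_bounds
  proof eventually_elim
    case (elim ob)
    then have "\<bar>cov_fun P (covs ob)\<bar> / beta_fun P (covs ob) \<le> \<kappa> / eps"
      using eps_pos \<kappa>_nonneg by (intro frac_le) auto
    then show ?case
      using elim eps_pos by (simp add: lambda_fun_def)
  qed
qed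

lemma integrable_bounded_covs:
  fixes r :: "real ^ 'p \<Rightarrow> real"
  assumes "r \<in> borel_measurable borel" "AE ob in P. \<bar>r (covs ob)\<bar> \<le> c"
  shows "integrable P (\<lambda>ob. r (covs ob))"
  using assms by (intro integrable_const_bound[where B=c]) auto

lemma integrable_lambda: "integrable P (\<lambda>ob. lambda_fun P (covs ob))"
  by (rule integrable_bounded_covs[OF _ AE_abs_lambda_le]) simp

lemma phi_psi_eq: "phi_psi P ob = plug_in (mu_fun P) (pi_fun P) (lambda_fun P) (beta_fun P) ob - psi P"
  by (cases ob) (auto simp: phi_psi_def plug_in_def)

lemma phi_psi_measurable [measurable]: "phi_psi P \<in> borel_measurable borel"
  unfolding phi_psi_eq[abs_def] plug_in_def by measurable

lemma AE_beta_ne_0: "AE ob in P. beta_fun P (covs ob) \<noteq> 0"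
  using beta_bounds by eventually_elim (use eps_pos in auto)

lemma AE_beta_gt: "AE ob in P. eps < beta_fun P (covs ob)"
  using beta_bounds by eventually_elim auto

text \<open>The influence curve has mean zero since \<open>plug_in_bias\<close> vanishes at the true nuisance functions.\<close>

lemma integrable_phi_psi: "integrable P (phi_psi P)" and integral_phi_psi: "(\<integral>ob. phi_psi P ob \<partial>P) = 0"
proof -
  note * = plug_in_bias[of "mu_fun P" "pi_fun P" "lambda_fun P" "beta_fun P", OF _ _ _ _ integrable_resp integrable_trt
      integrable_residual_squares[unfolded A0_def Y0_def] _ _ integrable_lambda AE_beta_ne_0 eps_pos AE_beta_gt AE_abs_lambda_le]
  have "integrable P (plug_in (mu_fun P) (pi_fun P) (lambda_fun P) (beta_fun P))"
    using * by simp
  then show "integrable P (phi_psi P)" "(\<integral>ob. phi_psi P ob \<partial>P) = 0"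
    unfolding phi_psi_eq[abs_def] using * by simp_all
qed

text \<open>The limits of the three random functions in the Donsker condition; up to a constant, the influence curve is a
  linear combination of them.\<close>

lemma limit_functions_measurable:
  "(\<lambda>ob. lambda_fun P (covs ob)) \<in> borel_measurable borel"
  "(\<lambda>ob. A0 ob * Y0 ob / beta_fun P (covs ob)) \<in> borel_measurable borel"
  "(\<lambda>ob. lambda_fun P (covs ob) * (A0 ob)\<^sup>2 / beta_fun P (covs ob)) \<in> borel_measurable borel"
  by measurable

lemma limit_functions_square_integrable:
  "integrable P (\<lambda>ob. (lambda_fun P (covs ob))\<^sup>2)"
  "integrable P (\<lambda>ob. (A0 ob * Y0 ob / beta_fun P (covs ob))\<^sup>2)"
  "integrable P (\<lambda>ob. (lambda_fun P (covs ob) * (A0 ob)\<^sup>2 / beta_fun P (covs ob))\<^sup>2)"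
proof -
  have l2: "AE ob in P. (lambda_fun P (covs ob))\<^sup>2 \<le> (\<kappa> / eps)\<^sup>2"
    using AE_abs_lambda_le
  proof eventually_elim
    case (elim ob)
    from power_mono[OF this, of 2] show ?case by simp
  qed
  show "integrable P (\<lambda>ob. (lambda_fun P (covs ob))\<^sup>2)"
    by (rule integrable_const_bound[where B="(\<kappa> / eps)\<^sup>2"]) (use l2 in auto)
  have b2: "AE ob in P. (1 / beta_fun P (covs ob))\<^sup>2 \<le> 1 / eps\<^sup>2"
    using AE_beta_gt by eventually_elim (use eps_pos in \<open>auto simp: power_divide intro!: divide_left_mono power_mono\<close>)
  have i: "integrable P (\<lambda>ob. (A0 ob * Y0 ob)\<^sup>2)" "integrable P (\<lambda>ob. ((A0 ob)\<^sup>2)\<^sup>2)"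
    using mean_dominated_integrable[of "\<lambda>ob. (A0 ob * Y0 ob)\<^sup>2" \<kappa>]
      mean_dominated_integrable[of "\<lambda>ob. ((A0 ob)\<^sup>2)\<^sup>2" \<kappa>] moments(5,6) by simp_all
  show "integrable P (\<lambda>ob. (A0 ob * Y0 ob / beta_fun P (covs ob))\<^sup>2)"
  proof (rule Bochner_Integration.integrable_bound)
    show "integrable P (\<lambda>ob. (A0 ob * Y0 ob)\<^sup>2 * (1 / eps\<^sup>2))" using i by simp
    show "AE ob in P. norm ((A0 ob * Y0 ob / beta_fun P (covs ob))\<^sup>2) \<le> norm ((A0 ob * Y0 ob)\<^sup>2 * (1 / eps\<^sup>2))"
      using b2
    proof eventually_elim
      case (elim ob)
      from mult_left_mono[OF this, of "(A0 ob * Y0 ob)\<^sup>2"] show ?case by (simp add: power_divide)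
    qed
  qed measurable
  show "integrable P (\<lambda>ob. (lambda_fun P (covs ob) * (A0 ob)\<^sup>2 / beta_fun P (covs ob))\<^sup>2)"
  proof (rule Bochner_Integration.integrable_bound)
    show "integrable P (\<lambda>ob. ((A0 ob)\<^sup>2)\<^sup>2 * ((\<kappa> / eps)\<^sup>2 * (1 / eps\<^sup>2)))" using i by simp
    show "AE ob in P. norm ((lambda_fun P (covs ob) * (A0 ob)\<^sup>2 / beta_fun P (covs ob))\<^sup>2) \<le> norm (((A0 ob)\<^sup>2)\<^sup>2 * ((\<kappa> / eps)\<^sup>2 * (1 / eps\<^sup>2)))"
      using b2 l2
    proof eventually_elim
      case (elim ob)
      have "((A0 ob)\<^sup>2)\<^sup>2 * ((lambda_fun P (covs ob))\<^sup>2 * (1 / beta_fun P (covs ob))\<^sup>2) \<le> ((A0 ob)\<^sup>2)\<^sup>2 * ((\<kappa> / eps)\<^sup>2 * (1 / eps\<^sup>2))"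
        using elim by (intro mult_left_mono mult_mono) auto
      moreover have "(lambda_fun P (covs ob) * (A0 ob)\<^sup>2 / beta_fun P (covs ob))\<^sup>2 = ((A0 ob)\<^sup>2)\<^sup>2 * ((lambda_fun P (covs ob))\<^sup>2 * (1 / beta_fun P (covs ob))\<^sup>2)"
        by (simp add: power_divide power_mult_distrib)
      ultimately show ?case by (simp only: real_norm_def abs_power2) (simp add: abs_mult)
    qed
  qed measurable
qed

lemma integrable_phi_psi_square: "integrable P (\<lambda>ob. (phi_psi P ob)\<^sup>2)"
proof -
  note [measurable] = limit_functions_measurable
  let ?f = "\<lambda>ob. A0 ob * Y0 ob / beta_fun P (covs ob)"
    and ?g = "\<lambda>ob. lambda_fun P (covs ob) * (A0 ob)\<^sup>2 / beta_fun P (covs ob)"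
  have phi: "phi_psi P ob = (?f ob - ?g ob) - (psi P - lambda_fun P (covs ob))" for ob
    by (simp add: phi_psi_eq plug_in_def A0_def Y0_def divide_inverse algebra_simps power2_eq_square)
  have fg: "integrable P (\<lambda>ob. (?f ob - ?g ob)\<^sup>2)"
    by (rule integrable_square_diff[OF _ limit_functions_square_integrable(2) _ limit_functions_square_integrable(3)]) measurable
  have c: "integrable P (\<lambda>ob. (psi P)\<^sup>2)" by simp
  have l: "integrable P (\<lambda>ob. (psi P - lambda_fun P (covs ob))\<^sup>2)"
    by (rule integrable_square_diff[OF _ c _ limit_functions_square_integrable(1)]) measurable
  show ?thesis
    unfolding phi by (rule integrable_square_diff[OF _ fg _ l]) measurable
qed

end

section \<open>Quadratic expansion of the parameter\<close>

text \<open>The Lipschitz constant of \<open>\<lambda>\<close> with respect to \<open>s\<close>: covariance and variance move by at most \<open>22 \<kappa>\<^sup>2 s\<close>, \<open>\<bar>\<lambda>\<bar>\<close> is at most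
  \<open>\<kappa> / eps\<close>, and the tilted variance in the denominator is at least \<open>eps / 2\<close>.\<close>

definition (in moment_law) lambda_const :: real where
  "lambda_const = 2 * (22 * \<kappa>\<^sup>2) * (1 + \<kappa> / eps) / eps"

text \<open>Half of \<open>eps\<close> is given up so that the conditional variance stays bounded away from zero under the tilted law.\<close>

locale tilted_moment_law = moment_law P eps K + tilted_law P q s
  for P :: "'p::finite obs measure" and eps K q s +
  assumes small: "44 * \<kappa>\<^sup>2 * s \<le> eps"
begin

abbreviation "\<delta> \<equiv> 2 * \<kappa> * s"

lemma \<delta>_nonneg: "0 \<le> \<delta>" and \<delta>_le: "\<delta> \<le> \<kappa>"
  using \<kappa>_nonneg s_nonneg s_half mult_left_mono[OF s_half, of "2 * \<kappa>"] by simp_all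

lemma conditional_mean_close:
  assumes [measurable]: "f \<in> borel_measurable borel" and f: "integrable P f"
    and dom: "mean_dominated (\<lambda>ob. \<bar>f ob - cond_mean P f (covs ob)\<bar>) \<kappa>"
  shows "AE ob in P. \<bar>cond_mean Q f (covs ob) - cond_mean P f (covs ob)\<bar> \<le> \<delta>"
proof -
  have r: "integrable P (\<lambda>ob. cond_mean P f (covs ob))"
    using integrable_cond_mean[of f "\<lambda>_. 1"] f by simp
  have z: "mean_dominated (\<lambda>ob. \<bar>0\<bar>) 0" using mean_dominated_const[of 0] by simp
  have "AE ob in P. \<bar>cond_mean Q f (covs ob) - cond_mean P f (covs ob)\<bar> \<le> 2 * \<kappa> * s + 3 * 0"
    by (rule cond_mean_tilted_close[of f "\<lambda>_. 0" "cond_mean P f" f, OF _ _ _ _ f r _ dom z])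
      (use f r \<kappa>_nonneg in \<open>auto intro!: integral_residual integrable_indicator_covs\<close>)
  then show ?thesis by simp
qed

lemma pi_close: "AE ob in P. \<bar>pi_fun Q (covs ob) - pi_fun P (covs ob)\<bar> \<le> \<delta>"
  using conditional_mean_close[of trt] integrable_trt moments(1) by (simp add: pi_fun_def A0_def)

lemma mu_close: "AE ob in P. \<bar>mu_fun Q (covs ob) - mu_fun P (covs ob)\<bar> \<le> \<delta>"
  using conditional_mean_close[of resp] integrable_resp moments(2) by (simp add: mu_fun_def Y0_def)

text \<open>Replacing the conditional means under \<open>P\<close> by those under \<open>Q\<close> in a product of residuals changes it
  by a term of conditional size \<open>O(\<delta>)\<close>.\<close>

lemma second_moment_close:
  assumes [measurable]: "f \<in> borel_measurable borel" "g \<in> borel_measurable borel"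
      "u \<in> borel_measurable borel" "v \<in> borel_measurable borel"
    and dom: "mean_dominated (\<lambda>ob. \<bar>f ob * g ob\<bar>) \<kappa>" "mean_dominated (\<lambda>ob. \<bar>f ob\<bar>) \<kappa>" "mean_dominated (\<lambda>ob. \<bar>g ob\<bar>) \<kappa>"
    and uv: "AE ob in P. \<bar>u (covs ob)\<bar> \<le> \<delta>" "AE ob in P. \<bar>v (covs ob)\<bar> \<le> \<delta>"
  shows "AE ob in P. \<bar>cond_mean Q (\<lambda>ob. (f ob - u (covs ob)) * (g ob - v (covs ob))) (covs ob)
      - cond_mean P (\<lambda>ob. f ob * g ob) (covs ob)\<bar> \<le> 22 * \<kappa>\<^sup>2 * s"
proof -
  let ?h = "\<lambda>ob. - f ob * v (covs ob) - u (covs ob) * g ob + u (covs ob) * v (covs ob)"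
  let ?w = "\<lambda>ob. \<delta> * \<bar>f ob\<bar> + \<delta> * \<bar>g ob\<bar> + \<delta> * \<kappa>"
  have 1: "mean_dominated (\<lambda>ob. \<delta> * \<bar>f ob\<bar> + \<delta> * \<bar>g ob\<bar>) (\<delta> * \<kappa> + \<delta> * \<kappa>)"
    by (rule mean_dominated_add[OF _ _ mean_dominated_cmult[OF _ dom(2)] mean_dominated_cmult[OF _ dom(3)]])
      (use \<kappa>_nonneg \<delta>_nonneg in simp_all)
  have 2: "mean_dominated ?w (\<delta> * \<kappa> + \<delta> * \<kappa> + \<delta> * \<kappa>)"
    by (rule mean_dominated_add[OF _ _ 1 mean_dominated_const])
      (use \<kappa>_nonneg s_nonneg in \<open>auto intro!: mult_nonneg_nonneg add_nonneg_nonneg\<close>)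
  have h: "mean_dominated (\<lambda>ob. \<bar>?h ob\<bar>) (\<delta> * \<kappa> + \<delta> * \<kappa> + \<delta> * \<kappa>)"
  proof (rule mean_dominated_mono[OF 2])
    show "AE ob in P. \<bar>?h ob\<bar> \<le> ?w ob"
      using uv
    proof eventually_elim
      case (elim ob)
      have "\<bar>f ob * v (covs ob)\<bar> \<le> \<delta> * \<bar>f ob\<bar>"
        using mult_left_mono[OF elim(2), of "\<bar>f ob\<bar>"] by (simp add: abs_mult mult.commute)
      moreover have "\<bar>u (covs ob) * g ob\<bar> \<le> \<delta> * \<bar>g ob\<bar>"
        using mult_right_mono[OF elim(1), of "\<bar>g ob\<bar>"] by (simp add: abs_mult)
      moreover have "\<bar>u (covs ob) * v (covs ob)\<bar> \<le> \<delta> * \<kappa>"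
        unfolding abs_mult using elim \<delta>_le \<delta>_nonneg by (intro mult_mono) auto
      moreover have "\<bar>?h ob\<bar> \<le> \<bar>f ob * v (covs ob)\<bar> + \<bar>u (covs ob) * g ob\<bar> + \<bar>u (covs ob) * v (covs ob)\<bar>"
        by simp
      ultimately show ?case by linarith
    qed
  qed
  have eq: "(f ob - u (covs ob)) * (g ob - v (covs ob)) = f ob * g ob + ?h ob" for ob
    by (simp add: algebra_simps)
  have "AE ob in P. \<bar>cond_mean Q (\<lambda>ob. (f ob - u (covs ob)) * (g ob - v (covs ob))) (covs ob)
      - cond_mean P (\<lambda>ob. f ob * g ob) (covs ob)\<bar> \<le> 4 * \<kappa> * s + 3 * (\<delta> * \<kappa> + \<delta> * \<kappa> + \<delta> * \<kappa>)"
    by (rule cond_mean_tilted_close_dominated[OF _ _ eq dom(1) h])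
      (use \<kappa>_nonneg s_nonneg in \<open>auto intro!: mult_nonneg_nonneg add_nonneg_nonneg\<close>)
  \<comment> \<open>\<open>22 = 4 + 3 * 6\<close>: the perturbation by \<open>u\<close> and \<open>v\<close> has conditional size \<open>3 \<delta> \<kappa> = 6 \<kappa>\<^sup>2 s\<close>\<close>
  moreover have "4 * \<kappa> * s \<le> 4 * \<kappa>\<^sup>2 * s"
    using mult_right_mono[OF \<kappa>_ge_1, of "\<kappa> * s"] \<kappa>_nonneg s_nonneg by (simp add: power2_eq_square mult.assoc)
  then have "4 * \<kappa> * s + 3 * (\<delta> * \<kappa> + \<delta> * \<kappa> + \<delta> * \<kappa>) \<le> 22 * \<kappa>\<^sup>2 * s"
    by (simp add: power2_eq_square mult_ac)
  ultimately show ?thesis by (auto elim!: eventually_mono)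
qed

lemma beta_close: "AE ob in P. \<bar>beta_fun Q (covs ob) - beta_fun P (covs ob)\<bar> \<le> 22 * \<kappa>\<^sup>2 * s"
  using second_moment_close[of A0 A0 "\<lambda>x. pi_fun Q x - pi_fun P x" "\<lambda>x. pi_fun Q x - pi_fun P x"]
    moments(1) moments(3) pi_close
  by (simp add: beta_fun_def A0_def power2_eq_square)

lemma cov_close: "AE ob in P. \<bar>cov_fun Q (covs ob) - cov_fun P (covs ob)\<bar> \<le> 22 * \<kappa>\<^sup>2 * s"
  using second_moment_close[of A0 Y0 "\<lambda>x. pi_fun Q x - pi_fun P x" "\<lambda>x. mu_fun Q x - mu_fun P x"]
    moments(1,2,7) pi_close mu_close
  by (simp add: cov_fun_def A0_def Y0_def)

lemma beta_tilted_ge: "AE ob in P. eps / 2 \<le> beta_fun Q (covs ob)"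
  using beta_close AE_beta_gt by eventually_elim (use small in auto)

lemma lambda_close: "AE ob in P. \<bar>lambda_fun Q (covs ob) - lambda_fun P (covs ob)\<bar> \<le> lambda_const * s"
  using beta_close cov_close beta_tilted_ge AE_beta_gt AE_abs_lambda_le
proof eventually_elim
  case (elim ob)
  let ?\<beta> = "beta_fun P (covs ob)" and ?\<beta>' = "beta_fun Q (covs ob)"
  let ?c = "cov_fun P (covs ob)" and ?c' = "cov_fun Q (covs ob)" and ?l = "lambda_fun P (covs ob)"
  have pos: "0 < ?\<beta>" "0 < ?\<beta>'" using elim eps_pos by auto
  have "?c = ?l * ?\<beta>" using pos by (simp add: lambda_fun_def)
  then have eq: "lambda_fun Q (covs ob) - ?l = ((?c' - ?c) - ?l * (?\<beta>' - ?\<beta>)) / ?\<beta>'"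
    using pos by (simp add: lambda_fun_def field_simps)
  have "\<bar>(?c' - ?c) - ?l * (?\<beta>' - ?\<beta>)\<bar> \<le> \<bar>?c' - ?c\<bar> + \<bar>?l\<bar> * \<bar>?\<beta>' - ?\<beta>\<bar>"
    unfolding abs_mult[symmetric] by (rule abs_triangle_ineq4)
  also have "\<dots> \<le> 22 * \<kappa>\<^sup>2 * s + (\<kappa> / eps) * (22 * \<kappa>\<^sup>2 * s)"
    using elim eps_pos \<kappa>_nonneg by (intro add_mono mult_mono) auto
  finally have "\<bar>lambda_fun Q (covs ob) - ?l\<bar> \<le> (22 * \<kappa>\<^sup>2 * s + (\<kappa> / eps) * (22 * \<kappa>\<^sup>2 * s)) / (eps / 2)"
    unfolding eq abs_divide using elim eps_pos pos s_nonneg \<kappa>_nonneg by (intro frac_le) auto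
  also have "\<dots> = lambda_const * s"
    using eps_pos by (simp add: lambda_const_def field_simps)
  finally show ?case .
qed

text \<open>Pathwise differentiability with a quadratic remainder: this is \<open>plug_in_bias\<close> at \<open>Q\<close> with the nuisance
  functions of \<open>P\<close> as plug-ins, all of which are within \<open>O(s)\<close> of those of \<open>Q\<close>.\<close>

theorem psi_tilted:
  "\<bar>psi Q - psi P - (\<integral>ob. q ob * phi_psi P ob \<partial>P)\<bar>
     \<le> (lambda_const * (22 * \<kappa>\<^sup>2) + 4 * \<kappa>\<^sup>2 + \<kappa> / eps * (4 * \<kappa>\<^sup>2)) / eps * s\<^sup>2"
proof -
  let ?plug = "plug_in (mu_fun P) (pi_fun P) (lambda_fun P) (beta_fun P)"
  let ?bias = "\<lambda>ob. (lambda_fun Q (covs ob) - lambda_fun P (covs ob)) * (beta_fun Q (covs ob) - beta_fun P (covs ob)) / beta_fun P (covs ob)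
      + (pi_fun Q (covs ob) - pi_fun P (covs ob)) * (mu_fun Q (covs ob) - mu_fun P (covs ob)) / beta_fun P (covs ob)
      - lambda_fun P (covs ob) * (pi_fun Q (covs ob) - pi_fun P (covs ob))\<^sup>2 / beta_fun P (covs ob)"
  let ?C = "(lambda_const * (22 * \<kappa>\<^sup>2) + 4 * \<kappa>\<^sup>2 + \<kappa> / eps * (4 * \<kappa>\<^sup>2)) / eps"
  have sq: "integrable Q (\<lambda>ob. (f ob - v (covs ob))\<^sup>2)"
    if [measurable]: "f \<in> borel_measurable borel" "v \<in> borel_measurable borel" "u \<in> borel_measurable borel"
      and f: "integrable P (\<lambda>ob. (f ob - u (covs ob))\<^sup>2)" and uv: "AE ob in P. \<bar>v (covs ob) - u (covs ob)\<bar> \<le> \<delta>" for f :: "'p obs \<Rightarrow> real" and u v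
  proof (rule integrable_tilted, rule Bochner_Integration.integrable_bound)
    show "integrable P (\<lambda>ob. 2 * (f ob - u (covs ob))\<^sup>2 + 2 * \<delta>\<^sup>2)" using f by simp
    show "AE ob in P. norm ((f ob - v (covs ob))\<^sup>2) \<le> norm (2 * (f ob - u (covs ob))\<^sup>2 + 2 * \<delta>\<^sup>2)"
      using uv
    proof eventually_elim
      case (elim ob)
      have "(v (covs ob) - u (covs ob))\<^sup>2 \<le> \<delta>\<^sup>2" using power_mono[OF elim, of 2] by simp
      moreover have "(f ob - v (covs ob))\<^sup>2 \<le> 2 * (f ob - u (covs ob))\<^sup>2 + 2 * (v (covs ob) - u (covs ob))\<^sup>2"
        using zero_le_power2[of "(f ob - u (covs ob)) + (v (covs ob) - u (covs ob))"]
        by (simp add: power2_eq_square algebra_simps)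
      ultimately show ?case by simp
    qed
  qed measurable
  have bounded: "integrable Q (\<lambda>ob. r (covs ob))"
    if "r \<in> borel_measurable borel" "AE ob in P. \<bar>r (covs ob)\<bar> \<le> c" for r :: "real ^ 'p \<Rightarrow> real" and c
    using that by (intro integrable_tilted integrable_bounded_covs)
  have lQ: "integrable Q (\<lambda>ob. lambda_fun Q (covs ob))"
  proof (rule bounded)
    show "AE ob in P. \<bar>lambda_fun Q (covs ob)\<bar> \<le> \<kappa> / eps + lambda_const * s"
      using lambda_close AE_abs_lambda_le by eventually_elim auto
  qed simp
  have sqb: "integrable Q (\<lambda>ob. (v (covs ob) - u (covs ob))\<^sup>2)"
    if [measurable]: "v \<in> borel_measurable borel" "u \<in> borel_measurable borel"
      and uv: "AE ob in P. \<bar>v (covs ob) - u (covs ob)\<bar> \<le> \<delta>" for u v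
    by (rule bounded[of "\<lambda>x. (v x - u x)\<^sup>2" "\<delta>\<^sup>2"])
      (use uv in \<open>auto elim!: eventually_mono simp: abs_le_square_iff[symmetric] \<delta>_nonneg\<close>)
  have b0: "AE ob in Q. beta_fun Q (covs ob) \<noteq> 0"
    unfolding AE_tilted using beta_tilted_ge by eventually_elim (use eps_pos in auto)
  have bg: "AE ob in Q. eps < beta_fun P (covs ob)" and ll: "AE ob in Q. \<bar>lambda_fun P (covs ob)\<bar> \<le> \<kappa> / eps"
    unfolding AE_tilted by (rule AE_beta_gt AE_abs_lambda_le)+
  have bias: "integrable Q ?plug" "integrable Q ?bias" "(\<integral>ob. ?plug ob \<partial>Q) - psi Q = (\<integral>ob. ?bias ob \<partial>Q)"
    using Q.plug_in_bias[of "mu_fun P" "pi_fun P" "lambda_fun P" "beta_fun P", OF _ _ _ _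
        integrable_tilted[OF integrable_resp] integrable_tilted[OF integrable_trt]
        sq[of trt, OF _ _ _ integrable_residual_squares(1)[unfolded A0_def] pi_close]
        sq[of resp, OF _ _ _ integrable_residual_squares(2)[unfolded Y0_def] mu_close]
        sqb[OF _ _ pi_close] sqb[OF _ _ mu_close] lQ b0 eps_pos bg ll]
    by simp_all
  have "AE ob in Q. \<bar>?bias ob\<bar> \<le> ?C * s\<^sup>2"
    unfolding AE_tilted using pi_close mu_close beta_close lambda_close AE_beta_gt AE_abs_lambda_le
  proof eventually_elim
    case (elim ob)
    let ?b = "beta_fun P (covs ob)"
    let ?x = "(lambda_fun Q (covs ob) - lambda_fun P (covs ob)) * (beta_fun Q (covs ob) - beta_fun P (covs ob))"
    let ?y = "(pi_fun Q (covs ob) - pi_fun P (covs ob)) * (mu_fun Q (covs ob) - mu_fun P (covs ob))"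
    let ?z = "lambda_fun P (covs ob) * (pi_fun Q (covs ob) - pi_fun P (covs ob))\<^sup>2"
    have x: "\<bar>?x\<bar> \<le> (lambda_const * s) * (22 * \<kappa>\<^sup>2 * s)"
      unfolding abs_mult by (rule mult_mono[OF elim(4) elim(3)]) (use elim(4) abs_ge_zero order_trans in blast)+
    have y: "\<bar>?y\<bar> \<le> \<delta> * \<delta>"
      unfolding abs_mult by (rule mult_mono[OF elim(1) elim(2)]) (use \<delta>_nonneg in auto)
    have "(pi_fun Q (covs ob) - pi_fun P (covs ob))\<^sup>2 \<le> \<delta>\<^sup>2"
      using power_mono[OF elim(1), of 2] by simp
    then have z: "\<bar>?z\<bar> \<le> (\<kappa> / eps) * \<delta>\<^sup>2"
      unfolding abs_mult using elim eps_pos \<kappa>_nonneg by (intro mult_mono) auto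
    have "\<bar>?x + ?y - ?z\<bar> \<le> \<bar>?x\<bar> + \<bar>?y\<bar> + \<bar>?z\<bar>"
      by linarith
    also have "\<dots> \<le> (lambda_const * s) * (22 * \<kappa>\<^sup>2 * s) + \<delta> * \<delta> + (\<kappa> / eps) * \<delta>\<^sup>2"
      by (intro add_mono x y z)
    finally have "\<bar>?x + ?y - ?z\<bar> / \<bar>?b\<bar> \<le> ((lambda_const * s) * (22 * \<kappa>\<^sup>2 * s) + \<delta> * \<delta> + (\<kappa> / eps) * \<delta>\<^sup>2) / eps"
      using elim eps_pos by (intro frac_le) auto
    also have "\<dots> = ?C * s\<^sup>2"
      by (simp add: power2_eq_square algebra_simps)
    finally show ?case
      unfolding abs_divide[symmetric] by (simp add: add_divide_distrib diff_divide_distrib)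
  qed
  then have "\<bar>\<integral>ob. ?bias ob \<partial>Q\<bar> \<le> (\<integral>ob. ?C * s\<^sup>2 \<partial>Q)"
    by (intro abs_integral_le_AE bias) auto
  moreover have "(\<integral>ob. ?plug ob \<partial>Q) = (\<integral>ob. q ob * phi_psi P ob \<partial>P) + psi P"
  proof -
    have "(\<integral>ob. ?plug ob \<partial>Q) = (\<integral>ob. phi_psi P ob + psi P \<partial>Q)"
      by (simp add: phi_psi_eq)
    also have "\<dots> = (\<integral>ob. phi_psi P ob \<partial>Q) + psi P"
      using integrable_tilted[OF integrable_phi_psi] Q.prob_space by (subst Bochner_Integration.integral_add) auto
    finally show ?thesis by (simp add: integral_tilted)
  qed
  ultimately show ?thesis
    using bias(3) Q.prob_space by simp
qed

end

section \<open>Stochastic order calculus\<close>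

lemma ennreal_mult_less_cancel_left:
  "0 < c \<Longrightarrow> c < top \<Longrightarrow> c * a < c * b \<longleftrightarrow> a < (b::ennreal)"
  by (metis ennreal_mult_strict_left_mono not_less_iff_gr_or_eq)

context prob_space
begin

lemma small_oPD: "small_oP M Z r \<Longrightarrow> 0 < \<eta> \<Longrightarrow> (\<lambda>n. prob {\<omega>\<in>space M. ennreal (\<eta> * r n) < Z n \<omega>}) \<longlonglongrightarrow> 0"
  by (auto simp: small_oP_def)

text \<open>Since only limits of probabilities matter, the comparison may fail for \<open>n = 0\<close>, on null sets, and on events whose
  probability tends to zero.\<close>

lemma small_oP_dominated:
  assumes Z: "\<And>n. Z n \<in> borel_measurable M" "small_oP M Z r" and r: "\<And>n. 0 \<le> r n" and c: "0 < c"
    and bad: "\<And>n. Bad n \<in> sets M" "(\<lambda>n. prob (Bad n)) \<longlonglongrightarrow> 0"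
    and le: "\<And>n. 0 < n \<Longrightarrow> AE \<omega> in M. \<omega> \<notin> Bad n \<longrightarrow> Z' n \<omega> \<le> ennreal c * Z n \<omega>"
  shows "small_oP M Z' r"
  unfolding small_oP_def
proof (intro allI impI)
  fix \<eta> :: real assume \<eta>: "0 < \<eta>"
  define A where "A n = {\<omega>\<in>space M. ennreal (\<eta> / c * r n) < Z n \<omega>}" for n
  have A [measurable]: "A n \<in> sets M" for n
    using Z(1)[of n] unfolding A_def by measurable
  have "(\<lambda>n. prob (A n)) \<longlonglongrightarrow> 0"
    unfolding A_def by (rule small_oPD[OF Z(2)]) (use \<eta> c in simp)
  from tendsto_add[OF this bad(2)] have lim: "(\<lambda>n. prob (A n) + prob (Bad n)) \<longlonglongrightarrow> 0" by simp
  show "(\<lambda>n. prob {\<omega>\<in>space M. ennreal (\<eta> * r n) < Z' n \<omega>}) \<longlonglongrightarrow> 0"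
  proof (rule tendsto_sandwich[OF _ _ tendsto_const lim])
    show "\<forall>\<^sub>F n in sequentially. prob {\<omega>\<in>space M. ennreal (\<eta> * r n) < Z' n \<omega>} \<le> prob (A n) + prob (Bad n)"
      using eventually_gt_at_top[of 0]
    proof eventually_elim
      case (elim n)
      have "prob {\<omega>\<in>space M. ennreal (\<eta> * r n) < Z' n \<omega>} \<le> prob (A n \<union> Bad n)"
      proof (rule finite_measure_mono_AE)
        show "AE \<omega> in M. \<omega> \<in> {\<omega>\<in>space M. ennreal (\<eta> * r n) < Z' n \<omega>} \<longrightarrow> \<omega> \<in> A n \<union> Bad n"
          using le[OF elim]
        proof eventually_elim
          case (elim \<omega>)
          have "Z' n \<omega> \<le> ennreal (\<eta> * r n)" if "Z n \<omega> \<le> ennreal (\<eta> / c * r n)" "\<omega> \<notin> Bad n"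
          proof -
            have "Z' n \<omega> \<le> ennreal c * ennreal (\<eta> / c * r n)"
              using elim that by (blast intro: order_trans mult_left_mono zero_le)
            also have "\<dots> = ennreal (\<eta> * r n)"
              using c \<eta> r[of n] by (simp add: ennreal_mult[symmetric])
            finally show ?thesis .
          qed
          then show ?case by (auto simp: A_def intro: not_le_imp_less dest: leD)
        qed
      qed (use bad in simp)
      also have "\<dots> \<le> prob (A n) + prob (Bad n)"
        by (rule measure_Un_le) (use bad in auto)
      finally show ?case .
    qed
  qed simp
qed

lemma small_oP_mono:
  assumes Z: "\<And>n. Z n \<in> borel_measurable M" "small_oP M Z r" and r: "\<And>n. 0 \<le> r n" and c: "0 < c"
    and le: "\<And>n. 0 < n \<Longrightarrow> AE \<omega> in M. Z' n \<omega> \<le> ennreal c * Z n \<omega>"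
  shows "small_oP M Z' r"
  by (rule small_oP_dominated[OF Z r c, of "\<lambda>_. {}"]) (use le in auto)

lemma small_oP_add:
  assumes Z: "\<And>n. Z n \<in> borel_measurable M" "small_oP M Z r"
    and W: "\<And>n. W n \<in> borel_measurable M" "small_oP M W r" and r: "\<And>n. 0 \<le> r n"
  shows "small_oP M (\<lambda>n \<omega>. Z n \<omega> + W n \<omega>) r"
  unfolding small_oP_def
proof (intro allI impI)
  fix \<eta> :: real assume \<eta>: "0 < \<eta>"
  define A B where "A n = {\<omega>\<in>space M. ennreal (\<eta> / 2 * r n) < Z n \<omega>}"
    and "B n = {\<omega>\<in>space M. ennreal (\<eta> / 2 * r n) < W n \<omega>}" for n
  have [measurable]: "A n \<in> sets M" "B n \<in> sets M" for n
    using Z(1)[of n] W(1)[of n] unfolding A_def B_def by measurable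
  have "(\<lambda>n. prob (A n)) \<longlonglongrightarrow> 0" "(\<lambda>n. prob (B n)) \<longlonglongrightarrow> 0"
    unfolding A_def B_def by (rule small_oPD[OF Z(2)] small_oPD[OF W(2)]; use \<eta> in simp)+
  from tendsto_add[OF this] have lim: "(\<lambda>n. prob (A n) + prob (B n)) \<longlonglongrightarrow> 0" by simp
  show "(\<lambda>n. prob {\<omega>\<in>space M. ennreal (\<eta> * r n) < Z n \<omega> + W n \<omega>}) \<longlonglongrightarrow> 0"
  proof (rule tendsto_sandwich[OF _ _ tendsto_const lim])
    show "\<forall>\<^sub>F n in sequentially. prob {\<omega>\<in>space M. ennreal (\<eta> * r n) < Z n \<omega> + W n \<omega>} \<le> prob (A n) + prob (B n)"
    proof (intro always_eventually allI)
      fix n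
      have "{\<omega>\<in>space M. ennreal (\<eta> * r n) < Z n \<omega> + W n \<omega>} \<subseteq> A n \<union> B n"
      proof safe
        fix \<omega> assume "\<omega> \<in> space M" "ennreal (\<eta> * r n) < Z n \<omega> + W n \<omega>" "\<omega> \<notin> B n"
        moreover have "ennreal (\<eta> * r n) = ennreal (\<eta> / 2 * r n) + ennreal (\<eta> / 2 * r n)"
          using \<eta> r[of n] by (subst ennreal_plus[symmetric]) auto
        ultimately show "\<omega> \<in> A n"
          unfolding A_def B_def using add_mono[of "Z n \<omega>" "ennreal (\<eta> / 2 * r n)" "W n \<omega>" "ennreal (\<eta> / 2 * r n)"]
          by (auto simp: not_less[symmetric])
      qed
      then have "prob {\<omega>\<in>space M. ennreal (\<eta> * r n) < Z n \<omega> + W n \<omega>} \<le> prob (A n \<union> B n)"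
        by (intro finite_measure_mono) auto
      also have "\<dots> \<le> prob (A n) + prob (B n)"
        by (rule measure_Un_le) auto
      finally show "prob {\<omega>\<in>space M. ennreal (\<eta> * r n) < Z n \<omega> + W n \<omega>} \<le> prob (A n) + prob (B n)" .
    qed
  qed simp
qed

lemma small_oP_mult:
  assumes Z: "\<And>n. Z n \<in> borel_measurable M" "small_oP M Z r"
    and W: "\<And>n. W n \<in> borel_measurable M" "small_oP M W s"
    and r: "\<And>n. 0 \<le> r n" and s: "\<And>n. 0 \<le> s n"
  shows "small_oP M (\<lambda>n \<omega>. Z n \<omega> * W n \<omega>) (\<lambda>n. r n * s n)"
  unfolding small_oP_def
proof (intro allI impI)
  fix \<eta> :: real assume \<eta>: "0 < \<eta>"
  define A B where "A n = {\<omega>\<in>space M. ennreal (sqrt \<eta> * r n) < Z n \<omega>}"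
    and "B n = {\<omega>\<in>space M. ennreal (sqrt \<eta> * s n) < W n \<omega>}" for n
  have [measurable]: "A n \<in> sets M" "B n \<in> sets M" for n
    using Z(1)[of n] W(1)[of n] unfolding A_def B_def by measurable
  have "(\<lambda>n. prob (A n)) \<longlonglongrightarrow> 0" "(\<lambda>n. prob (B n)) \<longlonglongrightarrow> 0"
    unfolding A_def B_def by (rule small_oPD[OF Z(2)] small_oPD[OF W(2)]; use \<eta> in simp)+
  from tendsto_add[OF this] have lim: "(\<lambda>n. prob (A n) + prob (B n)) \<longlonglongrightarrow> 0" by simp
  show "(\<lambda>n. prob {\<omega>\<in>space M. ennreal (\<eta> * (r n * s n)) < Z n \<omega> * W n \<omega>}) \<longlonglongrightarrow> 0"
  proof (rule tendsto_sandwich[OF _ _ tendsto_const lim])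
    show "\<forall>\<^sub>F n in sequentially. prob {\<omega>\<in>space M. ennreal (\<eta> * (r n * s n)) < Z n \<omega> * W n \<omega>} \<le> prob (A n) + prob (B n)"
    proof (intro always_eventually allI)
      fix n
      have "{\<omega>\<in>space M. ennreal (\<eta> * (r n * s n)) < Z n \<omega> * W n \<omega>} \<subseteq> A n \<union> B n"
      proof safe
        fix \<omega> assume "\<omega> \<in> space M" "ennreal (\<eta> * (r n * s n)) < Z n \<omega> * W n \<omega>" "\<omega> \<notin> B n"
        moreover have "ennreal (\<eta> * (r n * s n)) = ennreal (sqrt \<eta> * r n) * ennreal (sqrt \<eta> * s n)"
        proof -
          have "\<eta> * (r n * s n) = (sqrt \<eta> * sqrt \<eta>) * (r n * s n)" using \<eta> by simp
          also have "\<dots> = (sqrt \<eta> * r n) * (sqrt \<eta> * s n)" by (simp only: mult_ac)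
          finally show ?thesis using \<eta> r[of n] s[of n] by (subst ennreal_mult[symmetric]) auto
        qed
        ultimately show "\<omega> \<in> A n"
          unfolding A_def B_def using mult_mono[of "Z n \<omega>" "ennreal (sqrt \<eta> * r n)" "W n \<omega>" "ennreal (sqrt \<eta> * s n)"]
          by (auto simp: not_less[symmetric])
      qed
      then have "prob {\<omega>\<in>space M. ennreal (\<eta> * (r n * s n)) < Z n \<omega> * W n \<omega>} \<le> prob (A n \<union> B n)"
        by (intro finite_measure_mono) auto
      also have "\<dots> \<le> prob (A n) + prob (B n)"
        by (rule measure_Un_le) auto
      finally show "prob {\<omega>\<in>space M. ennreal (\<eta> * (r n * s n)) < Z n \<omega> * W n \<omega>} \<le> prob (A n) + prob (B n)" .
    qed
  qed simp
qed

lemma small_oP_rate_mono: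
  assumes Z: "\<And>n. Z n \<in> borel_measurable M" "small_oP M Z r"
    and le: "\<And>n. 0 < n \<Longrightarrow> r n \<le> r' n"
  shows "small_oP M Z r'"
  unfolding small_oP_def
proof (intro allI impI)
  fix \<eta> :: real assume \<eta>: "0 < \<eta>"
  have lim: "(\<lambda>n. prob {\<omega>\<in>space M. ennreal (\<eta> * r n) < Z n \<omega>}) \<longlonglongrightarrow> 0"
    using Z(2) \<eta> unfolding small_oP_def by simp
  have [measurable]: "Z n \<in> borel_measurable M" for n by (rule Z)
  show "(\<lambda>n. prob {\<omega>\<in>space M. ennreal (\<eta> * r' n) < Z n \<omega>}) \<longlonglongrightarrow> 0"
  proof (rule tendsto_sandwich[OF _ _ tendsto_const lim])
    show "\<forall>\<^sub>F n in sequentially. prob {\<omega>\<in>space M. ennreal (\<eta> * r' n) < Z n \<omega>} \<le> prob {\<omega>\<in>space M. ennreal (\<eta> * r n) < Z n \<omega>}"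
      using eventually_gt_at_top[of 0]
    proof eventually_elim
      case (elim n)
      have "ennreal (\<eta> * r n) \<le> ennreal (\<eta> * r' n)"
        using le[OF elim] \<eta> by (intro ennreal_leI mult_left_mono) auto
      then show ?case by (intro finite_measure_mono) auto
    qed
  qed simp
qed

lemma small_oP_1_iff: "small_oP M Z (\<lambda>_. 1) \<longleftrightarrow>
    (\<forall>\<eta>>0. (\<lambda>n. prob {\<omega>\<in>space M. ennreal \<eta> < Z n \<omega>}) \<longlonglongrightarrow> 0)"
  by (simp add: small_oP_def)

lemma small_oP_root_n:
  "small_oP M Z (\<lambda>n. real n powr (-1/2)) \<longleftrightarrow> small_oP M (\<lambda>n \<omega>. ennreal (sqrt (real n)) * Z n \<omega>) (\<lambda>_. 1)"
proof -
  have "(\<lambda>n. prob {\<omega>\<in>space M. ennreal (\<eta> * real n powr (-1/2)) < Z n \<omega>}) \<longlonglongrightarrow> 0 \<longleftrightarrow>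
     (\<lambda>n. prob {\<omega>\<in>space M. ennreal (\<eta> * 1) < ennreal (sqrt (real n)) * Z n \<omega>}) \<longlonglongrightarrow> 0" if \<eta>: "0 < \<eta>" for \<eta>
  proof (rule tendsto_cong)
    show "\<forall>\<^sub>F n in sequentially. prob {\<omega>\<in>space M. ennreal (\<eta> * real n powr (-1/2)) < Z n \<omega>}
        = prob {\<omega>\<in>space M. ennreal (\<eta> * 1) < ennreal (sqrt (real n)) * Z n \<omega>}"
      using eventually_gt_at_top[of 0]
    proof eventually_elim
      case (elim n)
      have "ennreal (\<eta> * real n powr (-1/2)) < z \<longleftrightarrow> ennreal (\<eta> * 1) < ennreal (sqrt (real n)) * z" for z
      proof -
        have "real n powr (-1/2) = 1 / sqrt (real n)"
          using elim by (simp add: powr_minus_divide powr_half_sqrt)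
        moreover have "ennreal (sqrt (real n)) * ennreal (\<eta> * (1 / sqrt (real n))) = ennreal \<eta>"
          using elim \<eta> by (subst ennreal_mult[symmetric]) auto
        ultimately have eq: "ennreal (\<eta> * 1) = ennreal (sqrt (real n)) * ennreal (\<eta> * real n powr (-1/2))"
          by simp
        show ?thesis
          unfolding eq using elim by (subst ennreal_mult_less_cancel_left) auto
      qed
      then show ?case by simp
    qed
  qed
  then show ?thesis unfolding small_oP_def by auto
qed

end

section \<open>The empirical process at a fixed function\<close>

text \<open>The value of \<open>empirical_process\<close> at one function, which need not belong to a given class.\<close>

definition emp :: "'o measure \<Rightarrow> nat \<Rightarrow> ('o \<Rightarrow> real) \<Rightarrow> (nat \<Rightarrow> 'o) \<Rightarrow> real" where
  "emp P n f s = sqrt (real n) * ((\<Sum>i<n. f (s i)) / real n - (\<integral>ob. f ob \<partial>P))"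

lemma emp_restrict [simp]: "emp P n f (\<lambda>i\<in>{..<n}. s i) = emp P n f s"
  by (simp add: emp_def)

lemma emp_add:
  "integrable P f \<Longrightarrow> integrable P g \<Longrightarrow> emp P n (\<lambda>ob. f ob + g ob) s = emp P n f s + emp P n g s"
  by (simp add: emp_def sum.distrib add_divide_distrib algebra_simps)

lemma emp_diff:
  "integrable P f \<Longrightarrow> integrable P g \<Longrightarrow> emp P n (\<lambda>ob. f ob - g ob) s = emp P n f s - emp P n g s"
  by (simp add: emp_def sum_subtractf diff_divide_distrib algebra_simps)

lemma emp_eq_sum:
  assumes n: "0 < n"
  shows "emp P n f s = (\<Sum>i<n. f (s i) - (\<integral>ob. f ob \<partial>P)) / sqrt (real n)"
proof -
  have "r * (x / N - m) = (x - N * m) / r" if "N = r * r" "0 < r" for r N m x :: real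
    using that by (simp add: field_simps)
  from this[of "real n" "sqrt (real n)"] show ?thesis
    using n by (simp add: emp_def sum_subtractf)
qed

lemma (in prob_space) sum_independent_squares:
  fixes X :: "nat \<Rightarrow> 'a \<Rightarrow> real"
  assumes indep: "indep_vars (\<lambda>_. borel) X UNIV"
    and mean: "\<And>i. expectation (X i) = 0" and sq: "\<And>i. integrable M (\<lambda>x. (X i x)\<^sup>2)"
  shows "integrable M (\<lambda>x. (\<Sum>i<n. X i x)\<^sup>2) \<and> expectation (\<lambda>x. (\<Sum>i<n. X i x)\<^sup>2) = (\<Sum>i<n. expectation (\<lambda>x. (X i x)\<^sup>2))"
proof (induction n)
  case (Suc n)
  have rv [measurable]: "X i \<in> borel_measurable M" for i
    using indep by (auto simp: indep_vars_def)
  have int: "integrable M (X i)" for i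
    by (rule square_integrable_imp_integrable[OF rv sq])
  have intS: "integrable M (\<lambda>x. \<Sum>i<n. X i x)" using int by simp
  have "indep_var borel (X n) borel (\<lambda>x. \<Sum>i<n. X i x)"
    by (rule indep_vars_sum) (auto intro: indep_vars_subset[OF indep])
  from indep_var_lebesgue_integral[OF this int intS] indep_var_integrable[OF this int intS]
  have cross: "integrable M (\<lambda>x. X n x * (\<Sum>i<n. X i x))" "expectation (\<lambda>x. X n x * (\<Sum>i<n. X i x)) = 0"
    using mean by (auto simp: ac_simps)
  have "(\<Sum>i<Suc n. X i x)\<^sup>2 = (\<Sum>i<n. X i x)\<^sup>2 + 2 * (X n x * (\<Sum>i<n. X i x)) + (X n x)\<^sup>2" for x
    by (simp add: power2_eq_square algebra_simps)
  then show ?case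
    using Suc cross sq by simp
qed simp

locale iid_sample = prob_space M for M :: "'w measure" +
  fixes Obs :: "nat \<Rightarrow> 'w \<Rightarrow> 'o::topological_space" and P :: "'o measure"
  assumes indep: "indep_vars (\<lambda>_. borel) Obs UNIV"
    and law: "\<And>i. distr M borel (Obs i) = P"
begin

lemma Obs_measurable [measurable]: "Obs i \<in> measurable M borel"
  using indep by (auto simp: indep_vars_def)

lemma sets_law [measurable_cong, simp]: "sets P = sets borel"
  using law[of 0] by (metis sets_distr)

lemma space_law [simp]: "space P = UNIV"
  using sets_eq_imp_space_eq[OF sets_law] by simp

sublocale P: prob_space P
  using prob_space_distr[of "Obs 0" borel] law[of 0] by simp

abbreviation product_law :: "nat \<Rightarrow> (nat \<Rightarrow> 'o) measure" where
  "product_law n \<equiv> \<Pi>\<^sub>M i\<in>{..<n}. P"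

lemma tuple_measurable [measurable]: "(\<lambda>\<omega>. \<lambda>i\<in>{..<n}. Obs i \<omega>) \<in> measurable M (\<Pi>\<^sub>M i\<in>{..<n}. borel)"
  by measurable

lemma sets_product_law: "sets (product_law n) = sets (\<Pi>\<^sub>M i\<in>{..<n}. borel)"
  by (intro sets_PiM_cong) auto

lemma distr_tuple:
  assumes "0 < n"
  shows "distr M (\<Pi>\<^sub>M i\<in>{..<n}. borel) (\<lambda>\<omega>. \<lambda>i\<in>{..<n}. Obs i \<omega>) = product_law n"
  using indep_vars_iff_distr_eq_PiM[where I="{..<n}" and M'="\<lambda>_. borel" and X=Obs] assms indep_vars_subset[OF indep]
  by (auto simp: law)

lemma integrable_Obs [simp]:
  fixes f :: "'o \<Rightarrow> real"
  shows "integrable P f \<Longrightarrow> integrable M (\<lambda>\<omega>. f (Obs i \<omega>))"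
  using integrable_distr[of "Obs i" M borel f] by (simp add: law)

lemma integral_Obs [simp]:
  fixes f :: "'o \<Rightarrow> real"
  assumes "f \<in> borel_measurable borel" shows "(\<integral>\<omega>. f (Obs i \<omega>) \<partial>M) = (\<integral>ob. f ob \<partial>P)"
  using integral_distr[of "Obs i" M borel f] assms by (simp add: law)

lemma indep_Obs:
  "f \<in> measurable borel N \<Longrightarrow> indep_vars (\<lambda>_. N) (\<lambda>i \<omega>. f (Obs i \<omega>)) UNIV"
  by (rule indep_vars_compose2[OF indep]) auto

lemma product_law_measure:
  assumes n: "0 < n" and A [measurable]: "{s\<in>space (product_law n). R s} \<in> sets (product_law n)"
  shows "measure (product_law n) {s\<in>space (product_law n). R s} = prob {\<omega>\<in>space M. R (\<lambda>i\<in>{..<n}. Obs i \<omega>)}"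
proof -
  have sp: "(\<lambda>i\<in>{..<n}. Obs i \<omega>) \<in> space (product_law n)" for \<omega>
    by (simp add: space_PiM)
  have "measure (product_law n) {s\<in>space (product_law n). R s}
      = measure (distr M (\<Pi>\<^sub>M i\<in>{..<n}. borel) (\<lambda>\<omega>. \<lambda>i\<in>{..<n}. Obs i \<omega>)) {s\<in>space (product_law n). R s}"
    by (simp only: distr_tuple[OF n])
  also have "\<dots> = prob ((\<lambda>\<omega>. \<lambda>i\<in>{..<n}. Obs i \<omega>) -` {s\<in>space (product_law n). R s} \<inter> space M)"
    by (rule measure_distr) (use A in \<open>auto simp only: sets_product_law tuple_measurable\<close>)
  also have "(\<lambda>\<omega>. \<lambda>i\<in>{..<n}. Obs i \<omega>) -` {s\<in>space (product_law n). R s} \<inter> space M = {\<omega>\<in>space M. R (\<lambda>i\<in>{..<n}. Obs i \<omega>)}"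
    using sp by auto
  finally show ?thesis .
qed

lemma emp_measurable [measurable]:
  assumes [measurable]: "f \<in> borel_measurable borel"
  shows "emp P n f \<in> borel_measurable (product_law n)"
  unfolding emp_def[abs_def] by measurable

lemma product_law_emp:
  assumes n: "0 < n" and [measurable]: "f \<in> borel_measurable borel"
  shows "measure (product_law n) {s\<in>space (product_law n). \<eta> \<le> \<bar>emp P n f s\<bar>}
     = prob {\<omega>\<in>space M. \<eta> \<le> \<bar>emp P n f (\<lambda>i. Obs i \<omega>)\<bar>}"
  by (subst product_law_measure[OF n]) simp_all

lemma emp_chebyshev:
  fixes f :: "'o \<Rightarrow> real"
  assumes f [measurable]: "f \<in> borel_measurable borel" and sq: "integrable P (\<lambda>ob. (f ob)\<^sup>2)" and \<eta>: "0 < \<eta>" and n: "0 < n"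
  shows "measure (product_law n) {s\<in>space (product_law n). \<eta> \<le> \<bar>emp P n f s\<bar>}
     \<le> (\<integral>ob. (f ob - (\<integral>ob'. f ob' \<partial>P))\<^sup>2 \<partial>P) / \<eta>\<^sup>2"
proof -
  let ?m = "\<integral>ob. f ob \<partial>P"
  let ?g = "\<lambda>ob. f ob - ?m"
  have f1: "integrable P f"
    by (rule P.square_integrable_imp_integrable[OF _ sq]) simp
  have g2: "integrable P (\<lambda>ob. (?g ob)\<^sup>2)"
    using f1 sq by (simp add: power2_diff)
  have g1: "(\<integral>ob. ?g ob \<partial>P) = 0"
    using f1 P.prob_space by (subst Bochner_Integration.integral_diff) auto
  define S where "S \<omega> = (\<Sum>i<n. ?g (Obs i \<omega>))" for \<omega>
  have S: "integrable M (\<lambda>\<omega>. (S \<omega>)\<^sup>2) \<and> expectation (\<lambda>\<omega>. (S \<omega>)\<^sup>2) = real n * (\<integral>ob. (?g ob)\<^sup>2 \<partial>P)"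
    using sum_independent_squares[OF indep_Obs[of ?g borel], of n] g2 g1
      integral_Obs[of ?g] integral_Obs[of "\<lambda>ob. (?g ob)\<^sup>2"] integrable_Obs[OF g2]
    unfolding S_def by simp
  have eq: "emp P n f (\<lambda>i. Obs i \<omega>) = S \<omega> / sqrt (real n)" for \<omega>
    unfolding S_def by (rule emp_eq_sum[OF n])
  have int: "integrable M (\<lambda>\<omega>. (emp P n f (\<lambda>i. Obs i \<omega>))\<^sup>2)"
    and ex: "expectation (\<lambda>\<omega>. (emp P n f (\<lambda>i. Obs i \<omega>))\<^sup>2) = (\<integral>ob. (?g ob)\<^sup>2 \<partial>P)"
    using S n by (simp_all add: eq power_divide)
  have "{\<omega>\<in>space M. \<eta> \<le> \<bar>emp P n f (\<lambda>i. Obs i \<omega>)\<bar>} = {\<omega>\<in>space M. \<eta>\<^sup>2 \<le> (emp P n f (\<lambda>i. Obs i \<omega>))\<^sup>2}"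
    using \<eta> by (auto simp: abs_le_square_iff[symmetric])
  also have "prob \<dots> \<le> expectation (\<lambda>\<omega>. (emp P n f (\<lambda>i. Obs i \<omega>))\<^sup>2) / \<eta>\<^sup>2"
    by (rule integral_Markov_inequality_measure[OF int, of "space M"]) (use \<eta> in auto)
  finally show ?thesis
    unfolding product_law_emp[OF n f] ex .
qed

text \<open>Without a bound for the variance there is no gain from centering, and the factor \<open>\<surd>n\<close> has to be compensated by
  the \<open>L\<^sub>1\<close> norm.\<close>

lemma emp_markov:
  fixes f :: "'o \<Rightarrow> real"
  assumes f [measurable]: "f \<in> borel_measurable borel" and int: "integrable P f" and \<eta>: "0 < \<eta>" and n: "0 < n"
  shows "measure (product_law n) {s\<in>space (product_law n). \<eta> \<le> \<bar>emp P n f s\<bar>}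
     \<le> 2 * (sqrt (real n) * (\<integral>ob. \<bar>f ob\<bar> \<partial>P)) / \<eta>"
proof -
  let ?m = "\<integral>ob. \<bar>f ob\<bar> \<partial>P"
  define S where "S \<omega> = sqrt (real n) * ((\<Sum>i<n. \<bar>f (Obs i \<omega>)\<bar>) / real n + ?m)" for \<omega>
  have S: "integrable M S" unfolding S_def using int by simp
  have ES: "expectation S = 2 * (sqrt (real n) * ?m)"
    unfolding S_def using int n prob_space integral_Obs[of "\<lambda>ob. \<bar>f ob\<bar>"] by simp
  have le: "\<bar>emp P n f (\<lambda>i. Obs i \<omega>)\<bar> \<le> S \<omega>" for \<omega>
  proof -
    have "\<bar>(\<Sum>i<n. f (Obs i \<omega>)) / real n - (\<integral>ob. f ob \<partial>P)\<bar> \<le> \<bar>\<Sum>i<n. f (Obs i \<omega>)\<bar> / real n + \<bar>\<integral>ob. f ob \<partial>P\<bar>"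
      using abs_triangle_ineq4[of "(\<Sum>i<n. f (Obs i \<omega>)) / real n" "\<integral>ob. f ob \<partial>P"] by simp
    also have "\<dots> \<le> (\<Sum>i<n. \<bar>f (Obs i \<omega>)\<bar>) / real n + ?m"
      by (intro add_mono divide_right_mono sum_abs integral_abs_bound) simp
    finally show ?thesis
      unfolding emp_def S_def abs_mult by (intro mult_mono) auto
  qed
  have "prob {\<omega>\<in>space M. \<eta> \<le> \<bar>emp P n f (\<lambda>i. Obs i \<omega>)\<bar>} \<le> prob {\<omega>\<in>space M. \<eta> \<le> S \<omega>}"
    using S le by (intro finite_measure_mono) (auto intro: order_trans)
  also have "\<dots> \<le> expectation S / \<eta>"
    by (rule integral_Markov_inequality_measure[OF S, of "space M"])
      (use \<eta> order_trans[OF abs_ge_zero le] in auto)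
  finally show ?thesis
    unfolding product_law_emp[OF n f] ES .
qed

end

section \<open>Sample splitting\<close>

context iid_sample
begin

abbreviation tuple_algebra :: "nat \<Rightarrow> 'w measure" where
  "tuple_algebra n \<equiv> vimage_algebra (space M) (\<lambda>\<omega>. \<lambda>i\<in>{..<n}. Obs i \<omega>) (\<Pi>\<^sub>M i\<in>{..<n}. borel)"

lemma distr_independent_tuple:
  assumes G: "subalgebra M G" and ind: "indep_set (sets G) (sets (tuple_algebra n))" and n: "0 < n"
  shows "distr M (G \<Otimes>\<^sub>M (\<Pi>\<^sub>M i\<in>{..<n}. borel)) (\<lambda>\<omega>. (\<omega>, \<lambda>i\<in>{..<n}. Obs i \<omega>)) = distr M G (\<lambda>\<omega>. \<omega>) \<Otimes>\<^sub>M product_law n"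
proof -
  have sG: "space G = space M" "sets G \<subseteq> sets M" using G by (auto simp: subalgebra_def)
  have id: "(\<lambda>\<omega>. \<omega>) \<in> measurable M G"
    using sG sets.sets_into_space by (fastforce intro!: measurableI simp: vimage_def Int_absorb2)
  let ?Pi = "\<Pi>\<^sub>M i\<in>{..<n}. (borel :: 'o measure)"
  let ?t = "\<lambda>\<omega>. \<lambda>i\<in>{..<n}. Obs i \<omega>"
  have T: "(\<lambda>\<omega>. (\<omega>, ?t \<omega>)) \<in> measurable M (G \<Otimes>\<^sub>M ?Pi)"
    by (rule measurable_Pair[OF id tuple_measurable])
  have "distr M G (\<lambda>\<omega>. \<omega>) \<Otimes>\<^sub>M product_law n = distr M (G \<Otimes>\<^sub>M ?Pi) (\<lambda>\<omega>. (\<omega>, ?t \<omega>))"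
  proof (rule pair_measure_eqI)
    show "sigma_finite_measure (distr M G (\<lambda>\<omega>. \<omega>))"
      using prob_space_distr[OF id] prob_space_imp_sigma_finite by blast
    show "sigma_finite_measure (product_law n)"
      by (intro prob_space_imp_sigma_finite prob_space_PiM P.prob_space_axioms)
    show "sets (distr M G (\<lambda>\<omega>. \<omega>) \<Otimes>\<^sub>M product_law n) = sets (distr M (G \<Otimes>\<^sub>M ?Pi) (\<lambda>\<omega>. (\<omega>, ?t \<omega>)))"
      by (simp only: sets_distr) (intro sets_pair_measure_cong sets_distr sets_product_law)
    fix A B assume "A \<in> sets (distr M G (\<lambda>\<omega>. \<omega>))" and "B \<in> sets (product_law n)"
    then have A: "A \<in> sets G" and B: "B \<in> sets ?Pi" by (simp_all only: sets_distr sets_product_law)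
    have AM: "A \<in> sets M" "A \<subseteq> space M" using A sG sets.sets_into_space[OF A] by auto
    have tB: "?t -` B \<inter> space M \<in> sets (tuple_algebra n)"
      using B by (auto simp: sets_vimage_algebra)
    have "emeasure (distr M G (\<lambda>\<omega>. \<omega>)) A = ennreal (prob A)"
      using emeasure_distr[OF id A] AM by (simp add: vimage_def Int_absorb2 emeasure_eq_measure)
    moreover have "emeasure (product_law n) B = ennreal (prob (?t -` B \<inter> space M))"
      unfolding distr_tuple[OF n, symmetric] using B by (subst emeasure_distr[OF tuple_measurable]) (auto simp: emeasure_eq_measure)
    moreover have "emeasure (distr M (G \<Otimes>\<^sub>M ?Pi) (\<lambda>\<omega>. (\<omega>, ?t \<omega>))) (A \<times> B) = ennreal (prob (A \<inter> (?t -` B \<inter> space M)))"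
    proof -
      have "(\<lambda>\<omega>. (\<omega>, ?t \<omega>)) -` (A \<times> B) \<inter> space M = A \<inter> (?t -` B \<inter> space M)" by auto
      then show ?thesis
        using A B by (subst emeasure_distr[OF T]) (auto simp: emeasure_eq_measure)
    qed
    moreover have "prob (A \<inter> (?t -` B \<inter> space M)) = prob A * prob (?t -` B \<inter> space M)"
      by (rule indep_setD[OF ind A tB])
    ultimately show "emeasure (distr M G (\<lambda>\<omega>. \<omega>)) A * emeasure (product_law n) B
        = emeasure (distr M (G \<Otimes>\<^sub>M ?Pi) (\<lambda>\<omega>. (\<omega>, ?t \<omega>))) (A \<times> B)"
      by (simp add: ennreal_mult)
  qed
  then show ?thesis by simp
qed

lemma emp_random_measurable:
  assumes [measurable]: "(\<lambda>(\<omega>, ob). d \<omega> ob) \<in> borel_measurable (G \<Otimes>\<^sub>M borel)"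
  shows "(\<lambda>(\<omega>, s). emp P n (d \<omega>) s) \<in> borel_measurable (G \<Otimes>\<^sub>M (\<Pi>\<^sub>M i\<in>{..<n}. borel))"
proof -
  have d: "(\<lambda>(\<omega>, ob). d \<omega> ob) \<in> borel_measurable (G \<Otimes>\<^sub>M P)" by measurable
  have 1: "(\<lambda>z. \<integral>ob. d (fst z) ob \<partial>P) \<in> borel_measurable (G \<Otimes>\<^sub>M (\<Pi>\<^sub>M i\<in>{..<n}. borel))"
    by (rule measurable_compose[OF measurable_fst P.borel_measurable_lebesgue_integral[OF d]])
  have 2: "(\<lambda>z. d (fst z) (snd z i)) \<in> borel_measurable (G \<Otimes>\<^sub>M (\<Pi>\<^sub>M i\<in>{..<n}. borel))" if "i < n" for i
  proof -
    have "(\<lambda>z. (fst z, snd z i)) \<in> measurable (G \<Otimes>\<^sub>M (\<Pi>\<^sub>M i\<in>{..<n}. borel)) (G \<Otimes>\<^sub>M borel)"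
      using that by (intro measurable_Pair measurable_fst measurable_compose[OF measurable_snd] measurable_component_singleton) auto
    from measurable_compose[OF this assms] show ?thesis by simp
  qed
  have 3: "(\<lambda>z. \<Sum>i<n. d (fst z) (snd z i)) \<in> borel_measurable (G \<Otimes>\<^sub>M (\<Pi>\<^sub>M i\<in>{..<n}. borel))"
    by (rule borel_measurable_sum) (use 2 in auto)
  show ?thesis
    unfolding emp_def split_beta using 1 3 by measurable
qed

text \<open>Given the \<open>\<sigma>\<close>-algebra of the auxiliary sample the random function is fixed, so that a bound for
  fixed functions integrates to a bound for the random one.\<close>

lemma splitting_prob_le:
  fixes d :: "'w \<Rightarrow> 'o \<Rightarrow> real"
  assumes G: "subalgebra M G" and ind: "indep_set (sets G) (sets (tuple_algebra n))" and n: "0 < n"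
    and d [measurable]: "(\<lambda>(\<omega>, ob). d \<omega> ob) \<in> borel_measurable (G \<Otimes>\<^sub>M borel)"
    and B [measurable]: "B \<in> sets G"
    and le: "\<And>\<omega>. \<omega> \<in> B \<Longrightarrow> measure (product_law n) {s\<in>space (product_law n). \<eta> \<le> \<bar>emp P n (d \<omega>) s\<bar>} \<le> c" and c: "0 \<le> c"
  shows "prob {\<omega>\<in>space M. \<omega> \<in> B \<and> \<eta> \<le> \<bar>emp P n (d \<omega>) (\<lambda>i. Obs i \<omega>)\<bar>} \<le> c"
proof -
  let ?Pi = "\<Pi>\<^sub>M i\<in>{..<n}. (borel :: 'o measure)"
  let ?T = "\<lambda>\<omega>. (\<omega>, \<lambda>i\<in>{..<n}. Obs i \<omega>)"
  let ?J = "distr M G (\<lambda>\<omega>. \<omega>) \<Otimes>\<^sub>M product_law n"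
  have sG: "space G = space M" "sets G \<subseteq> sets M" using G by (auto simp: subalgebra_def)
  have id: "(\<lambda>\<omega>. \<omega>) \<in> measurable M G"
    using sG sets.sets_into_space by (fastforce intro!: measurableI simp: vimage_def Int_absorb2)
  interpret N: prob_space "product_law n" by (intro prob_space_PiM P.prob_space_axioms)
  define A where "A = {z \<in> space (G \<Otimes>\<^sub>M ?Pi). fst z \<in> B \<and> \<eta> \<le> \<bar>emp P n (d (fst z)) (snd z)\<bar>}"
  have e: "(\<lambda>z. emp P n (d (fst z)) (snd z)) \<in> borel_measurable (G \<Otimes>\<^sub>M ?Pi)"
    using emp_random_measurable[OF d, of n] by (simp add: split_beta)
  have A: "A \<in> sets (G \<Otimes>\<^sub>M ?Pi)"
    unfolding A_def using e by measurable
  have T: "?T \<in> measurable M (G \<Otimes>\<^sub>M ?Pi)"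
    using id by measurable
  have J: "distr M (G \<Otimes>\<^sub>M ?Pi) ?T = ?J"
    by (rule distr_independent_tuple[OF G ind n])
  have "{\<omega>\<in>space M. \<omega> \<in> B \<and> \<eta> \<le> \<bar>emp P n (d \<omega>) (\<lambda>i. Obs i \<omega>)\<bar>} = ?T -` A \<inter> space M"
    using measurable_space[OF T] by (auto simp: A_def)
  then have "emeasure M {\<omega>\<in>space M. \<omega> \<in> B \<and> \<eta> \<le> \<bar>emp P n (d \<omega>) (\<lambda>i. Obs i \<omega>)\<bar>} = emeasure ?J A"
    using emeasure_distr[OF T A] by (simp add: J)
  also have "\<dots> = (\<integral>\<^sup>+\<omega>. emeasure (product_law n) (Pair \<omega> -` A) \<partial>distr M G (\<lambda>\<omega>. \<omega>))"
    by (rule N.emeasure_pair_measure_alt) (use A arg_cong[OF J, of sets] in simp)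
  also have "\<dots> \<le> (\<integral>\<^sup>+\<omega>. ennreal c \<partial>distr M G (\<lambda>\<omega>. \<omega>))"
  proof (rule nn_integral_mono)
    fix \<omega> assume "\<omega> \<in> space (distr M G (\<lambda>\<omega>. \<omega>))"
    show "emeasure (product_law n) (Pair \<omega> -` A) \<le> ennreal c"
    proof (cases "\<omega> \<in> B")
      case True
      have "Pair \<omega> -` A \<subseteq> {s\<in>space (product_law n). \<eta> \<le> \<bar>emp P n (d \<omega>) s\<bar>}"
        by (auto simp: A_def space_pair_measure sets_eq_imp_space_eq[OF sets_product_law])
      moreover have "{s\<in>space (product_law n). \<eta> \<le> \<bar>emp P n (d \<omega>) s\<bar>} \<in> sets (product_law n)"
      proof -
        have "d \<omega> \<in> borel_measurable borel"
          using measurable_compose_Pair1[OF _ d] True sets.sets_into_space[OF B] by auto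
        then show ?thesis by measurable
      qed
      ultimately have "emeasure (product_law n) (Pair \<omega> -` A) \<le> emeasure (product_law n) {s\<in>space (product_law n). \<eta> \<le> \<bar>emp P n (d \<omega>) s\<bar>}"
        by (rule emeasure_mono)
      also have "\<dots> \<le> ennreal c"
        using le[OF True] by (simp add: N.emeasure_eq_measure ennreal_leI)
      finally show ?thesis .
    next
      case False
      then have "Pair \<omega> -` A = {}" by (auto simp: A_def)
      then show ?thesis by simp
    qed
  qed
  also have "\<dots> = ennreal c"
    using prob_space.emeasure_space_1[OF prob_space_distr[OF id]] by simp
  finally show ?thesis
    using c by (simp add: emeasure_eq_measure)
qed

text \<open>\<open>V n\<close> measures the size of the random function.  A tail bound for fixed functions that is linear in the size suffices,
  since the size may be assumed to be at most an arbitrarily small \<open>\<delta>\<close>.\<close>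

lemma splitting_emp:
  fixes D :: "nat \<Rightarrow> 'w \<Rightarrow> 'o \<Rightarrow> real" and V :: "nat \<Rightarrow> 'w \<Rightarrow> ennreal" and c :: "real \<Rightarrow> real"
  assumes G: "\<And>n. subalgebra M (G n)" and ind: "\<And>n. indep_set (sets (G n)) (sets (tuple_algebra n))"
    and D: "\<And>n. (\<lambda>(\<omega>, ob). D n \<omega> ob) \<in> borel_measurable (G n \<Otimes>\<^sub>M borel)"
    and V: "\<And>n. V n \<in> borel_measurable (G n)" "small_oP M V (\<lambda>_. 1)"
    and le: "\<And>n \<omega> \<delta> \<eta>. 0 < n \<Longrightarrow> \<omega> \<in> space M \<Longrightarrow> V n \<omega> \<le> ennreal \<delta> \<Longrightarrow> 0 < \<delta> \<Longrightarrow> 0 < \<eta> \<Longrightarrow>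
      measure (product_law n) {s\<in>space (product_law n). \<eta> \<le> \<bar>emp P n (D n \<omega>) s\<bar>} \<le> c \<eta> * \<delta>"
    and c: "\<And>\<eta>. 0 < \<eta> \<Longrightarrow> 0 < c \<eta>"
  shows "small_oP M (\<lambda>n \<omega>. ennreal \<bar>emp P n (D n \<omega>) (\<lambda>i. Obs i \<omega>)\<bar>) (\<lambda>_. 1)"
  unfolding small_oP_1_iff
proof (intro allI impI)
  fix \<eta> :: real assume \<eta>: "0 < \<eta>"
  let ?p = "\<lambda>n. prob {\<omega>\<in>space M. ennreal \<eta> < ennreal \<bar>emp P n (D n \<omega>) (\<lambda>i. Obs i \<omega>)\<bar>}"
  have bound: "?p n \<le> prob {\<omega>\<in>space M. ennreal \<delta> < V n \<omega>} + c \<eta> * \<delta>" if n: "0 < n" and \<delta>: "0 < \<delta>" for n \<delta>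
  proof -
    have sG: "space (G n) = space M" "sets (G n) \<subseteq> sets M" using G by (auto simp: subalgebra_def)
    have VM [measurable]: "V n \<in> borel_measurable M"
      by (rule measurable_from_subalg[OF G V(1)])
    define B where "B = {\<omega>\<in>space (G n). V n \<omega> \<le> ennreal \<delta>}"
    have B: "B \<in> sets (G n)" unfolding B_def using V(1)[of n] by measurable
    have BM [measurable]: "B \<in> sets M" using B sG by auto
    have "(\<lambda>\<omega>. \<omega>) \<in> measurable M (G n)"
      using sG sets.sets_into_space by (fastforce intro!: measurableI simp: vimage_def Int_absorb2)
    then have "(\<lambda>\<omega>. (\<omega>, \<lambda>i\<in>{..<n}. Obs i \<omega>)) \<in> measurable M (G n \<Otimes>\<^sub>M (\<Pi>\<^sub>M i\<in>{..<n}. borel))"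
      by measurable
    from measurable_compose[OF this emp_random_measurable[OF D, of n]]
    have [measurable]: "(\<lambda>\<omega>. emp P n (D n \<omega>) (\<lambda>i. Obs i \<omega>)) \<in> borel_measurable M" by simp
    have "prob {\<omega>\<in>space M. \<omega> \<in> B \<and> \<eta> \<le> \<bar>emp P n (D n \<omega>) (\<lambda>i. Obs i \<omega>)\<bar>} \<le> c \<eta> * \<delta>"
      by (rule splitting_prob_le[OF G ind n D B])
        (use le[OF n _ _ \<delta> \<eta>] c[OF \<eta>] \<delta> sG in \<open>auto simp: B_def\<close>)
    moreover have "?p n \<le> prob ({\<omega>\<in>space M. ennreal \<delta> < V n \<omega>} \<union> {\<omega>\<in>space M. \<omega> \<in> B \<and> \<eta> \<le> \<bar>emp P n (D n \<omega>) (\<lambda>i. Obs i \<omega>)\<bar>})"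
    proof (rule finite_measure_mono)
      show "{\<omega>\<in>space M. ennreal \<eta> < ennreal \<bar>emp P n (D n \<omega>) (\<lambda>i. Obs i \<omega>)\<bar>}
        \<subseteq> {\<omega>\<in>space M. ennreal \<delta> < V n \<omega>} \<union> {\<omega>\<in>space M. \<omega> \<in> B \<and> \<eta> \<le> \<bar>emp P n (D n \<omega>) (\<lambda>i. Obs i \<omega>)\<bar>}"
        using \<eta> sG by (auto simp: B_def not_less ennreal_less_iff)
      show "{\<omega>\<in>space M. ennreal \<delta> < V n \<omega>} \<union> {\<omega>\<in>space M. \<omega> \<in> B \<and> \<eta> \<le> \<bar>emp P n (D n \<omega>) (\<lambda>i. Obs i \<omega>)\<bar>} \<in> events"
        by measurable
    qed
    moreover have "\<dots> \<le> prob {\<omega>\<in>space M. ennreal \<delta> < V n \<omega>} + prob {\<omega>\<in>space M. \<omega> \<in> B \<and> \<eta> \<le> \<bar>emp P n (D n \<omega>) (\<lambda>i. Obs i \<omega>)\<bar>}"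
      by (rule measure_Un_le) measurable
    ultimately show ?thesis by linarith
  qed
  show "?p \<longlonglongrightarrow> 0"
  proof (rule LIMSEQ_I)
    fix e :: real assume e: "0 < e"
    define \<delta> where "\<delta> = e / (2 * c \<eta>)"
    have \<delta>: "0 < \<delta>" "c \<eta> * \<delta> = e / 2" using e c[OF \<eta>] by (auto simp: \<delta>_def)
    have "(\<lambda>n. prob {\<omega>\<in>space M. ennreal \<delta> < V n \<omega>}) \<longlonglongrightarrow> 0"
      using V(2) \<delta>(1) unfolding small_oP_1_iff by blast
    then have "\<forall>\<^sub>F n in sequentially. prob {\<omega>\<in>space M. ennreal \<delta> < V n \<omega>} < e / 2"
      using e by (intro order_tendstoD(2)) auto
    then have "\<forall>\<^sub>F n in sequentially. norm (?p n - 0) < e"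
      using eventually_gt_at_top[of 0]
    proof eventually_elim
      case (elim n)
      then show ?case using bound[OF elim(2) \<delta>(1)] \<delta>(2) by simp
    qed
    then show "\<exists>no. \<forall>n\<ge>no. norm (?p n - 0) < e"
      by (simp add: eventually_sequentially)
  qed
qed

theorem splitting_emp_L2:
  fixes D :: "nat \<Rightarrow> 'w \<Rightarrow> 'o \<Rightarrow> real"
  assumes G: "\<And>n. subalgebra M (G n)" and ind: "\<And>n. indep_set (sets (G n)) (sets (tuple_algebra n))"
    and D: "\<And>n. (\<lambda>(\<omega>, ob). D n \<omega> ob) \<in> borel_measurable (G n \<Otimes>\<^sub>M borel)"
    and small: "small_oP M (\<lambda>n \<omega>. \<integral>\<^sup>+ob. ennreal ((D n \<omega> ob)\<^sup>2) \<partial>P) (\<lambda>_. 1)"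
  shows "small_oP M (\<lambda>n \<omega>. ennreal \<bar>emp P n (D n \<omega>) (\<lambda>i. Obs i \<omega>)\<bar>) (\<lambda>_. 1)"
proof (rule splitting_emp[OF G ind D _ small, where c = "\<lambda>\<eta>. 1 / \<eta>\<^sup>2"])
  fix n
  show "(\<lambda>\<omega>. \<integral>\<^sup>+ob. ennreal ((D n \<omega> ob)\<^sup>2) \<partial>P) \<in> borel_measurable (G n)"
    using D[of n] by measurable
  fix \<omega> and \<delta> \<eta> :: real
  assume n: "0 < n" and \<omega>: "\<omega> \<in> space M" and le: "(\<integral>\<^sup>+ob. ennreal ((D n \<omega> ob)\<^sup>2) \<partial>P) \<le> ennreal \<delta>" and \<delta>: "0 < \<delta>" and \<eta>: "0 < \<eta>"
  let ?f = "D n \<omega>"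
  have f [measurable]: "?f \<in> borel_measurable borel"
    using measurable_compose_Pair1[OF _ D] \<omega> G[of n] by (simp add: subalgebra_def)
  have sq: "integrable P (\<lambda>ob. (?f ob)\<^sup>2)"
    using le by (intro integrableI_bounded) (auto intro: le_less_trans)
  have "measure (product_law n) {s\<in>space (product_law n). \<eta> \<le> \<bar>emp P n ?f s\<bar>}
     \<le> P.variance ?f / \<eta>\<^sup>2"
    by (rule emp_chebyshev[OF f sq \<eta> n])
  also have "P.variance ?f \<le> P.expectation (\<lambda>ob. (?f ob)\<^sup>2)"
    using sq by (subst P.variance_eq) (auto intro: P.square_integrable_imp_integrable)
  also have "P.expectation (\<lambda>ob. (?f ob)\<^sup>2) \<le> \<delta>"
    using le \<delta> by (subst (asm) nn_integral_eq_integral[OF sq]) auto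
  finally show "measure (product_law n) {s\<in>space (product_law n). \<eta> \<le> \<bar>emp P n ?f s\<bar>} \<le> 1 / \<eta>\<^sup>2 * \<delta>"
    by (simp add: divide_right_mono)
qed auto

theorem splitting_emp_L1:
  fixes D :: "nat \<Rightarrow> 'w \<Rightarrow> 'o \<Rightarrow> real"
  assumes G: "\<And>n. subalgebra M (G n)" and ind: "\<And>n. indep_set (sets (G n)) (sets (tuple_algebra n))"
    and D: "\<And>n. (\<lambda>(\<omega>, ob). D n \<omega> ob) \<in> borel_measurable (G n \<Otimes>\<^sub>M borel)"
    and small: "small_oP M (\<lambda>n \<omega>. \<integral>\<^sup>+ob. ennreal \<bar>D n \<omega> ob\<bar> \<partial>P) (\<lambda>n. real n powr (-1/2))"
  shows "small_oP M (\<lambda>n \<omega>. ennreal \<bar>emp P n (D n \<omega>) (\<lambda>i. Obs i \<omega>)\<bar>) (\<lambda>_. 1)"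
proof (rule splitting_emp[OF G ind D _ small[unfolded small_oP_root_n], where c = "\<lambda>\<eta>. 2 / \<eta>"])
  fix n
  show "(\<lambda>\<omega>. ennreal (sqrt (real n)) * (\<integral>\<^sup>+ob. ennreal \<bar>D n \<omega> ob\<bar> \<partial>P)) \<in> borel_measurable (G n)"
    using D[of n] by measurable
  fix \<omega> and \<delta> \<eta> :: real
  assume n: "0 < n" and \<omega>: "\<omega> \<in> space M" and le: "ennreal (sqrt (real n)) * (\<integral>\<^sup>+ob. ennreal \<bar>D n \<omega> ob\<bar> \<partial>P) \<le> ennreal \<delta>" and \<delta>: "0 < \<delta>" and \<eta>: "0 < \<eta>"
  let ?f = "D n \<omega>"
  have f [measurable]: "?f \<in> borel_measurable borel"
    using measurable_compose_Pair1[OF _ D] \<omega> G[of n] by (simp add: subalgebra_def)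
  have "(\<integral>\<^sup>+ob. ennreal \<bar>?f ob\<bar> \<partial>P) < \<infinity>"
  proof (rule ccontr)
    assume "\<not> (\<integral>\<^sup>+ob. ennreal \<bar>?f ob\<bar> \<partial>P) < \<infinity>"
    then have "(\<integral>\<^sup>+ob. ennreal \<bar>?f ob\<bar> \<partial>P) = top" by (simp add: not_less top_unique)
    then show False using le n by (auto simp: ennreal_mult_top top_unique)
  qed
  then have int: "integrable P ?f"
    by (intro integrableI_bounded) auto
  have "ennreal (sqrt (real n) * P.expectation (\<lambda>ob. \<bar>?f ob\<bar>)) \<le> ennreal \<delta>"
    using le int by (simp add: nn_integral_eq_integral ennreal_mult)
  then have *: "sqrt (real n) * P.expectation (\<lambda>ob. \<bar>?f ob\<bar>) \<le> \<delta>" using \<delta> by simp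
  have "measure (product_law n) {s\<in>space (product_law n). \<eta> \<le> \<bar>emp P n ?f s\<bar>}
     \<le> 2 * (sqrt (real n) * P.expectation (\<lambda>ob. \<bar>?f ob\<bar>)) / \<eta>"
    by (rule emp_markov[OF f int \<eta> n])
  also have "\<dots> \<le> 2 * \<delta> / \<eta>"
    using * \<eta> by (intro divide_right_mono mult_left_mono) auto
  finally show "measure (product_law n) {s\<in>space (product_law n). \<eta> \<le> \<bar>emp P n ?f s\<bar>} \<le> 2 / \<eta> * \<delta>"
    by simp
qed auto

end

section \<open>Donsker classes\<close>

lemma tight_law_integrable:
  assumes L: "tight_law T L" and H: "continuous_map T euclideanreal H" and bnd: "\<And>z. \<bar>H z\<bar> \<le> B"
  shows "integrable L H"
proof -
  have sp: "space L = topspace T" and sets: "sets L = sigma_sets (topspace T) {U. openin T U}" and "prob_space L"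
    using L by (auto simp: tight_law_def)
  interpret prob_space L by fact
  have "H \<in> borel_measurable L"
  proof (rule borel_measurableI)
    fix S :: "real set" assume "open S"
    then have "openin T {x \<in> topspace T. H x \<in> S}"
      using H by (simp add: continuous_map_def)
    moreover have "H -` S \<inter> space L = {x \<in> topspace T. H x \<in> S}" using sp by auto
    ultimately show "H -` S \<inter> space L \<in> sets L" unfolding sets by simp
  qed
  then show ?thesis
    by (rule integrable_const_bound[where B=B, rotated]) (use bnd in auto)
qed

text \<open>\<open>Z\<close> need not be measurable, but Markov's inequality applies to a measurable majorant; this is what makes the
  exceptional set measurable.\<close>

lemma outer_expectation_less_imp:
  assumes N: "prob_space N" and Z: "\<And>s. s \<in> space N \<Longrightarrow> 0 \<le> Z s" "\<And>s. s \<in> space N \<Longrightarrow> Z s \<le> 1"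
    and less: "outer_expectation N Z < e"
  shows "\<exists>A\<in>sets N. measure N A \<le> e \<and> (\<forall>s\<in>space N - A. Z s < 1)"
proof -
  interpret N: prob_space N by fact
  let ?S = "{(\<integral>s. U s \<partial>N) | U. integrable N U \<and> (\<forall>s\<in>space N. Z s \<le> U s)}"
  have "(\<integral>s. 1 \<partial>N) \<in> ?S" using Z(2) by (intro CollectI exI[of _ "\<lambda>_. 1"]) auto
  then have "?S \<noteq> {}" by blast
  from cInf_lessD[OF this less[unfolded outer_expectation_def]]
  obtain U where U: "integrable N U" "\<And>s. s \<in> space N \<Longrightarrow> Z s \<le> U s" "(\<integral>s. U s \<partial>N) < e" by blast
  have "measure N {s\<in>space N. U s \<ge> 1} \<le> (\<integral>s. U s \<partial>N) / 1"
    by (rule integral_Markov_inequality_measure[OF U(1), of "space N"]) (use order_trans[OF Z(1) U(2)] in auto)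
  moreover have "Z s < 1" if "s \<in> space N - {s\<in>space N. U s \<ge> 1}" for s
    using that U(2)[of s] by auto
  moreover have "{s\<in>space N. U s \<ge> 1} \<in> sets N" using U(1) by measurable
  ultimately show ?thesis
    using U(3) by (intro bexI[of _ "{s\<in>space N. U s \<ge> 1}"]) auto
qed

context iid_sample
begin

lemma empirical_process_in_l_infty:
  assumes F: "donsker P F"
  shows "empirical_process P F n s \<in> mspace (funspace F euclidean_metric)"
proof -
  have "\<exists>B. \<forall>f\<in>F. \<bar>f ob - (\<integral>ob'. f ob' \<partial>P)\<bar> \<le> B" for ob
    using F unfolding donsker_def bdd_above_def by auto
  then obtain B where B: "\<And>ob f. f \<in> F \<Longrightarrow> \<bar>f ob - (\<integral>ob'. f ob' \<partial>P)\<bar> \<le> B ob" by metis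
  have "\<bar>empirical_process P F n s f\<bar> \<le> sqrt (real n) * ((\<Sum>i<n. B (s i)) / real n)" if f: "f \<in> F" for f
  proof (cases "n = 0")
    case False
    then have "(\<Sum>i<n. f (s i)) / real n - (\<integral>ob. f ob \<partial>P) = (\<Sum>i<n. f (s i) - (\<integral>ob. f ob \<partial>P)) / real n"
      by (simp add: sum_subtractf diff_divide_distrib)
    moreover have "\<bar>(\<Sum>i<n. f (s i) - (\<integral>ob. f ob \<partial>P))\<bar> \<le> (\<Sum>i<n. B (s i))"
      by (rule order_trans[OF sum_abs]) (intro sum_mono B f)
    ultimately show ?thesis
      using f by (simp add: empirical_process_def abs_mult mult_left_mono divide_right_mono)
  qed (simp add: empirical_process_def f)
  then have "bounded (empirical_process P F n s ` F)"
    unfolding bounded_iff by (auto simp: empirical_process_def)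
  then show ?thesis
    by (simp add: Met_TC.fspace_def empirical_process_def)
qed

text \<open>Outside a sample set of small probability the path lies close to a finite net of the compact set that
  carries most of the limit law; the cells are the sets on which all members of the net are nearly
  constant.\<close>

lemma donsker_cells:
  assumes F: "donsker P F" and \<eta>: "0 < \<eta>" and e: "0 < e"
  shows "\<exists>c :: ('o \<Rightarrow> real) \<Rightarrow> ((('o \<Rightarrow> real) \<Rightarrow> real) \<Rightarrow> int). finite (c ` F) \<and>
    (\<forall>\<^sub>F n in sequentially. \<exists>A\<in>sets (product_law n). measure (product_law n) A \<le> e \<and>
       (\<forall>s\<in>space (product_law n) - A. \<forall>f\<in>F. \<forall>g\<in>F. c f = c g \<longrightarrow> \<bar>emp P n f s - emp P n g s\<bar> \<le> \<eta>))"
proof (cases "F = {}")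
  case True
  then show ?thesis
    using e by (intro exI[of _ "\<lambda>_ _. 0"] conjI always_eventually allI bexI[of _ "{}"]) auto
next
  case False
  define X where "X = funspace F (euclidean_metric :: real metric)"
  define T where "T = l_infty F"
  \<comment> \<open>two approximations by a member of the net, each within \<open>2 \<delta>\<close>, and the width \<open>\<delta>\<close> of a cell\<close>
  define \<delta> where "\<delta> = \<eta> / 5"
  have \<delta>: "0 < \<delta>" using \<eta> by (simp add: \<delta>_def)
  have T: "T = mtopology_of X" by (simp add: T_def X_def l_infty_def)
  interpret X: Metric_space "mspace X" "mdist X" by (rule Metric_space_mspace_mdist)
  obtain L where L: "tight_law T L"
    and lim: "\<forall>H. continuous_map T euclideanreal H \<and> bounded (H ` topspace T) \<longrightarrow>
           (\<lambda>n. outer_expectation (product_law n) (\<lambda>s. H (empirical_process P F n s))) \<longlonglongrightarrow> (\<integral>z. H z \<partial>L)"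
    using F unfolding donsker_def T_def by (elim conjE exE)
  interpret L: prob_space L using L by (simp add: tight_law_def)
  obtain C where C: "compactin T C" "C \<in> sets L" "1 - e < measure L C"
    using L e unfolding tight_law_def by (elim conjE allE[of _ e]) blast
  have "compactin X.mtopology C" using C(1) by (simp add: T mtopology_of_def)
  then have "X.mtotally_bounded C" by (rule X.compactin_imp_mtotally_bounded)
  then have "\<exists>N. finite N \<and> N \<subseteq> C \<and> C \<subseteq> (\<Union>k\<in>N. X.mball k \<delta>)"
    using \<delta> by (simp add: X.mtotally_bounded_def)
  then obtain N where N: "finite N" "N \<subseteq> C" "C \<subseteq> (\<Union>k\<in>N. X.mball k \<delta>)"
    by (elim exE conjE)
  have NX: "k \<in> mspace X" if "k \<in> N" for k
    using that N(2) C(1) compactin_subset_topspace[of T C] by (auto simp: T)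
  \<comment> \<open>\<open>h k\<close> vanishes on the ball of radius \<open>\<delta>\<close> around \<open>k\<close> and is \<open>1\<close> outside the ball of radius \<open>2 \<delta>\<close>; hence \<open>H\<close> is
    zero on the compact set, and \<open>H z < 1\<close> forces \<open>z\<close> to be within \<open>2 \<delta>\<close> of the net\<close>
  define h where "h k z = max 0 (min 1 (mdist X k z / \<delta> - 1))" for k z
  define H where "H z = (\<Prod>k\<in>N. h k z)" for z
  have h01: "0 \<le> h k z" "h k z \<le> 1" for k z by (auto simp: h_def)
  have H01: "0 \<le> H z" "H z \<le> 1" for z
    using h01 by (auto simp: H_def intro!: prod_nonneg prod_le_1)
  have cont: "continuous_map T euclideanreal H"
  proof -
    have "continuous_map T euclideanreal (\<lambda>z. h k z)" if k: "k \<in> N" for k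
    proof -
      have *: "continuous_map T euclideanreal (\<lambda>z. mdist X k z)"
        unfolding T using continuous_on_mdist[OF NX[OF k]] by simp
      have "continuous_map euclideanreal euclideanreal (\<lambda>x :: real. max 0 (min 1 (x / \<delta> - 1)))"
        by (simp, intro continuous_intros) (use \<delta> in auto)
      from continuous_map_compose[OF * this] show ?thesis by (simp add: h_def comp_def)
    qed
    then show ?thesis unfolding H_def using N(1) by (intro continuous_map_prod) auto
  qed
  have iH: "integrable L H"
    by (rule tight_law_integrable[OF L cont, of 1]) (simp add: H01)
  have "(\<integral>z. H z \<partial>L) \<le> (\<integral>z. indicator (space L - C) z \<partial>L)"
  proof (rule integral_mono[OF iH])
    show "integrable L (indicator (space L - C) :: _ \<Rightarrow> real)"
      using C(2) by (simp add: integrable_indicator_iff L.emeasure_eq_measure)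
    fix z assume z: "z \<in> space L"
    show "H z \<le> indicator (space L - C) z"
    proof (cases "z \<in> C")
      case True
      then obtain k where k: "k \<in> N" "mdist X k z < \<delta>" using N(3) by auto
      then have "mdist X k z / \<delta> \<le> 1" using \<delta> by (simp add: pos_divide_le_eq)
      then have "h k z = 0" by (simp add: h_def)
      then have "H z = 0" using k N(1) by (auto simp: H_def)
      then show ?thesis by simp
    qed (use z H01 in simp)
  qed
  also have "\<dots> = 1 - measure L C"
    using C(2) by (simp add: L.prob_compl)
  also have "\<dots> < e" using C(3) by simp
  finally have intH: "(\<integral>z. H z \<partial>L) < e" .
  have "bounded (H ` topspace T)"
    unfolding bounded_iff using H01 by (intro exI[of _ 1]) auto
  from order_tendstoD(2)[OF lim[rule_format, OF conjI[OF cont this]] intH]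
  have ev: "\<forall>\<^sub>F n in sequentially. outer_expectation (product_law n) (\<lambda>s. H (empirical_process P F n s)) < e" .
  define c where "c f = (\<lambda>k\<in>N. \<lfloor>k f / \<delta>\<rfloor>)" for f :: "'o \<Rightarrow> real"
  have "finite (c ` F)"
  proof -
    have "\<exists>b. \<forall>f\<in>F. \<bar>k f\<bar> \<le> b" if "k \<in> N" for k
      using NX[OF that] by (auto simp: X_def Met_TC.fspace_def bounded_iff)
    then obtain b where b: "\<And>k f. k \<in> N \<Longrightarrow> f \<in> F \<Longrightarrow> \<bar>k f\<bar> \<le> b k" by metis
    have "c ` F \<subseteq> (\<Pi>\<^sub>E k\<in>N. {\<lfloor>- b k / \<delta>\<rfloor>..\<lfloor>b k / \<delta>\<rfloor>})"
    proof (rule image_subsetI)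
      fix f assume f: "f \<in> F"
      show "c f \<in> (\<Pi>\<^sub>E k\<in>N. {\<lfloor>- b k / \<delta>\<rfloor>..\<lfloor>b k / \<delta>\<rfloor>})"
      proof (rule PiE_I)
        fix k assume k: "k \<in> N"
        have "- b k \<le> k f" "k f \<le> b k" using b[OF k f] by (auto simp: abs_le_iff)
        then have "- b k / \<delta> \<le> k f / \<delta>" "k f / \<delta> \<le> b k / \<delta>"
          using \<delta> divide_right_mono less_imp_le by blast+
        then show "c f k \<in> {\<lfloor>- b k / \<delta>\<rfloor>..\<lfloor>b k / \<delta>\<rfloor>}"
          using k by (auto simp: c_def intro!: floor_mono)
      qed (simp add: c_def)
    qed
    moreover have "finite (\<Pi>\<^sub>E k\<in>N. {\<lfloor>- b k / \<delta>\<rfloor>..\<lfloor>b k / \<delta>\<rfloor>})"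
      using N(1) by (intro finite_PiE) auto
    ultimately show ?thesis by (rule finite_subset)
  qed
  moreover have "\<forall>\<^sub>F n in sequentially. \<exists>A\<in>sets (product_law n). measure (product_law n) A \<le> e \<and>
       (\<forall>s\<in>space (product_law n) - A. \<forall>f\<in>F. \<forall>g\<in>F. c f = c g \<longrightarrow> \<bar>emp P n f s - emp P n g s\<bar> \<le> \<eta>)"
    using ev
  proof eventually_elim
    case (elim n)
    have "prob_space (product_law n)" by (intro prob_space_PiM P.prob_space_axioms)
    from outer_expectation_less_imp[OF this _ _ elim] H01
    obtain A where A: "A \<in> sets (product_law n)" "measure (product_law n) A \<le> e"
        "\<And>s. s \<in> space (product_law n) - A \<Longrightarrow> H (empirical_process P F n s) < 1" by blast
    have "\<bar>emp P n f s - emp P n g s\<bar> \<le> \<eta>"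
      if s: "s \<in> space (product_law n) - A" and fg: "f \<in> F" "g \<in> F" "c f = c g" for s f g
    proof -
      let ?z = "empirical_process P F n s"
      have zX: "?z \<in> mspace X" unfolding X_def by (rule empirical_process_in_l_infty[OF F])
      have "\<exists>k\<in>N. h k ?z \<noteq> 1"
      proof (rule ccontr)
        assume "\<not> (\<exists>k\<in>N. h k ?z \<noteq> 1)"
        then have "H ?z = 1" unfolding H_def by (intro prod.neutral) blast
        then show False using A(3)[OF s] by simp
      qed
      then obtain k where k: "k \<in> N" "h k ?z < 1" using h01(2) by (auto simp: less_le)
      have d: "mdist X k ?z \<le> 2 * \<delta>"
      proof -
        have "mdist X k ?z / \<delta> - 1 < 1" using k(2) unfolding h_def by linarith
        then show ?thesis using \<delta> by (simp add: pos_divide_less_eq)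
      qed
      have *: "\<bar>k f' - ?z f'\<bar> \<le> 2 * \<delta>" if "f' \<in> F" for f'
        using d that funspace_mdist_le[of k F "euclidean_metric :: real metric" ?z "2 * \<delta>"] NX[OF k(1)] zX False
        by (auto simp: X_def dist_real_def)
      have "\<lfloor>k f / \<delta>\<rfloor> = \<lfloor>k g / \<delta>\<rfloor>" using fun_cong[OF fg(3), of k] k(1) by (simp add: c_def)
      then have "\<bar>k f / \<delta> - k g / \<delta>\<bar> \<le> 1" by linarith
      then have "\<bar>k f - k g\<bar> \<le> \<delta>"
        using \<delta> by (simp add: diff_divide_distrib[symmetric] pos_divide_le_eq)
      moreover have "\<bar>?z f - ?z g\<bar> \<le> \<bar>k f - ?z f\<bar> + \<bar>k f - k g\<bar> + \<bar>k g - ?z g\<bar>" by linarith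
      ultimately have "\<bar>?z f - ?z g\<bar> \<le> 5 * \<delta>" using *[OF fg(1)] *[OF fg(2)] by linarith
      then show ?thesis using fg by (simp add: \<delta>_def emp_def empirical_process_def)
    qed
    then show ?case using A by blast
  qed
  ultimately show ?thesis by blast
qed

end

lemma std_normal_Iic_pos: "0 < measure std_normal_distribution {..x}"
proof -
  interpret N: prob_space std_normal_distribution
    by (rule prob_space_normal_density) simp
  have "emeasure std_normal_distribution {..x} \<noteq> 0"
  proof
    assume "emeasure std_normal_distribution {..x} = 0"
    then have "{..x} \<in> null_sets std_normal_distribution" by (simp add: null_sets_def)
    then have "AE y in lborel. y \<in> {..x} \<longrightarrow> std_normal_density y = 0"
      by (subst (asm) null_sets_density_iff) auto
    then have "AE y in lborel. \<not> y \<le> x"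
      by eventually_elim (use normal_density_pos[of 1 0] in \<open>auto simp: less_le\<close>)
    then have "emeasure lborel {..x} = 0"
      by (subst (asm) AE_iff_measurable[OF _ refl]) (auto simp: atMost_def)
    moreover have "emeasure lborel {x - 1..x} \<le> emeasure lborel {..x}"
      by (rule emeasure_mono) auto
    ultimately show False by simp
  qed
  then show ?thesis
    by (simp add: N.emeasure_eq_measure zero_less_measure_iff)
qed

context iid_sample
begin

text \<open>If the standard deviation of \<open>h\<close> exceeded \<open>\<eta>\<close>, then by the central limit theorem the probability of
  \<open>emp h < - \<eta>\<close> would asymptotically be at least that of \<open>{..-1}\<close> under the standard normal law, and hence exceed \<open>e\<close>.\<close>

lemma variance_le_of_tight_emp:
  fixes h :: "'o \<Rightarrow> real"
  assumes [measurable]: "h \<in> borel_measurable borel" and sq: "integrable P (\<lambda>ob. (h ob)\<^sup>2)" and \<eta>: "0 < \<eta>"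
    and e: "e < measure std_normal_distribution {..-1}"
    and small: "\<forall>\<^sub>F n in sequentially. \<exists>A\<in>sets (product_law n). measure (product_law n) A \<le> e \<and>
       (\<forall>s\<in>space (product_law n) - A. \<bar>emp P n h s\<bar> \<le> \<eta>)"
  shows "P.variance h \<le> \<eta>\<^sup>2"
proof (rule ccontr)
  assume not_le: "\<not> P.variance h \<le> \<eta>\<^sup>2"
  define \<sigma> where "\<sigma> = sqrt (P.variance h)"
  have \<sigma>2: "\<sigma>\<^sup>2 = P.variance h" by (simp add: \<sigma>_def)
  have \<sigma>: "\<eta> < \<sigma>" "0 < \<sigma>"
  proof -
    show "\<eta> < \<sigma>" using not_le \<eta> real_sqrt_less_mono[of "\<eta>\<^sup>2" "P.variance h"] by (simp add: \<sigma>_def)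
    then show "0 < \<sigma>" using \<eta> by simp
  qed
  have h1: "integrable P h" by (rule P.square_integrable_imp_integrable[OF _ sq]) simp
  define m where "m = P.expectation h"
  have sqm: "integrable P (\<lambda>ob. (h ob - m)\<^sup>2)" using h1 sq by (simp add: power2_diff)
  define S where "S n \<omega> = (\<Sum>i<n. h (Obs i \<omega>) - m) / sqrt (real n * \<sigma>\<^sup>2)" for n \<omega>
  have clt: "weak_conv_m (\<lambda>n. distr M borel (S n)) std_normal_distribution"
    unfolding S_def
  proof (rule central_limit_theorem[OF indep_Obs[of h borel]])
    show "expectation (\<lambda>\<omega>. h (Obs n \<omega>)) = m" for n by (simp add: m_def integral_Obs[of h])
    show "integrable M (\<lambda>\<omega>. (h (Obs n \<omega>))\<^sup>2)" for n by (rule integrable_Obs[OF sq])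
    show "variance (\<lambda>\<omega>. h (Obs n \<omega>)) = \<sigma>\<^sup>2" for n
      using integral_Obs[of h n] integral_Obs[of "\<lambda>ob. (h ob - m)\<^sup>2" n] by (simp add: \<sigma>2 m_def)
    show "distr M borel (\<lambda>\<omega>. h (Obs n \<omega>)) = distr P borel h" for n
      using distr_distr[of h borel borel "Obs n" M] by (simp add: law comp_def)
  qed (use \<sigma> in auto)
  interpret N: prob_space std_normal_distribution
    by (rule prob_space_normal_density) simp
  interpret N: real_distribution std_normal_distribution by standard simp
  have "measure std_normal_distribution {-1} = 0"
  proof -
    have "{-1::real} \<in> null_sets std_normal_distribution"
    proof (subst null_sets_density_iff)
      show "{-1::real} \<in> sets lborel \<and> (AE y in lborel. y \<in> {-1} \<longrightarrow> ennreal (std_normal_density y) = 0)"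
        by (intro conjI eventually_mono[OF AE_lborel_singleton[of "-1::real"]]) auto
    qed simp
    then show ?thesis by (simp add: null_sets_def measure_def)
  qed
  then have "isCont (cdf std_normal_distribution) (-1)" by (simp add: N.isCont_cdf)
  then have lim: "(\<lambda>n. cdf (distr M borel (S n)) (-1)) \<longlonglongrightarrow> measure std_normal_distribution {..-1}"
    using clt unfolding weak_conv_m_def weak_conv_def by (simp add: cdf_def2)
  have "\<forall>\<^sub>F n in sequentially. cdf (distr M borel (S n)) (-1) \<le> e"
    using small eventually_gt_at_top[of 0]
  proof eventually_elim
    case (elim n)
    then obtain A where A: "A \<in> sets (product_law n)" "measure (product_law n) A \<le> e"
       "\<And>s. s \<in> space (product_law n) - A \<Longrightarrow> \<bar>emp P n h s\<bar> \<le> \<eta>" by blast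
    have Sm: "S n \<in> borel_measurable M" unfolding S_def by measurable
    have "cdf (distr M borel (S n)) (-1) = prob {\<omega>\<in>space M. S n \<omega> \<le> -1}"
      unfolding cdf_def2 by (subst measure_distr[OF Sm]) (auto intro!: arg_cong[where f=prob])
    also have "\<dots> \<le> prob {\<omega>\<in>space M. \<sigma> \<le> \<bar>emp P n h (\<lambda>i. Obs i \<omega>)\<bar>}"
    proof (rule finite_measure_mono)
      show "{\<omega>\<in>space M. S n \<omega> \<le> -1} \<subseteq> {\<omega>\<in>space M. \<sigma> \<le> \<bar>emp P n h (\<lambda>i. Obs i \<omega>)\<bar>}"
      proof safe
        fix \<omega> assume "S n \<omega> \<le> -1"
        moreover have "emp P n h (\<lambda>i. Obs i \<omega>) = \<sigma> * S n \<omega>"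
          using \<sigma> elim(2) by (simp add: emp_eq_sum S_def m_def real_sqrt_mult)
        ultimately have "emp P n h (\<lambda>i. Obs i \<omega>) \<le> \<sigma> * (-1)"
          using \<sigma> by (simp only: mult_left_mono less_imp_le)
        then show "\<sigma> \<le> \<bar>emp P n h (\<lambda>i. Obs i \<omega>)\<bar>" by simp
      qed
      show "{\<omega>\<in>space M. \<sigma> \<le> \<bar>emp P n h (\<lambda>i. Obs i \<omega>)\<bar>} \<in> events"
        unfolding emp_def by measurable
    qed
    also have "\<dots> = measure (product_law n) {s\<in>space (product_law n). \<sigma> \<le> \<bar>emp P n h s\<bar>}"
      by (rule product_law_emp[symmetric]) (use elim in auto)
    also have "\<dots> \<le> measure (product_law n) A"
    proof (rule finite_measure.finite_measure_mono)
      show "finite_measure (product_law n)"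
        by (intro prob_space.finite_measure prob_space_PiM P.prob_space_axioms)
      show "{s\<in>space (product_law n). \<sigma> \<le> \<bar>emp P n h s\<bar>} \<subseteq> A"
      proof safe
        fix s assume "s \<in> space (product_law n)" "\<sigma> \<le> \<bar>emp P n h s\<bar>"
        then show "s \<in> A" using A(3)[of s] \<sigma>(1) by fastforce
      qed
    qed (rule A)
    finally show ?case using A(2) by simp
  qed
  then have "measure std_normal_distribution {..-1} \<le> e"
    by (rule tendsto_upperbound[OF lim]) simp
  then show False using e by simp
qed

lemma donsker_variance_cells:
  assumes F: "donsker P F" and \<eta>: "0 < \<eta>"
  shows "\<exists>c :: ('o \<Rightarrow> real) \<Rightarrow> ((('o \<Rightarrow> real) \<Rightarrow> real) \<Rightarrow> int). finite (c ` F) \<and>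
    (\<forall>f\<in>F. \<forall>g\<in>F. c f = c g \<longrightarrow> P.variance (\<lambda>ob. f ob - g ob) \<le> \<eta>\<^sup>2)"
proof -
  \<comment> \<open>any positive level below the normal probability works, independently of \<open>\<eta>\<close>\<close>
  define e where "e = measure std_normal_distribution {..-1} / 2"
  have e: "0 < e" "e < measure std_normal_distribution {..-1}"
    using std_normal_Iic_pos[of "-1"] by (simp_all add: e_def)
  obtain c :: "('o \<Rightarrow> real) \<Rightarrow> ((('o \<Rightarrow> real) \<Rightarrow> real) \<Rightarrow> int)" where c: "finite (c ` F)"
    "\<forall>\<^sub>F n in sequentially. \<exists>A\<in>sets (product_law n). measure (product_law n) A \<le> e \<and>
       (\<forall>s\<in>space (product_law n) - A. \<forall>f\<in>F. \<forall>g\<in>F. c f = c g \<longrightarrow> \<bar>emp P n f s - emp P n g s\<bar> \<le> \<eta>)"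
    using donsker_cells[OF F \<eta> e(1)] by (elim exE conjE)
  have "P.variance (\<lambda>ob. f ob - g ob) \<le> \<eta>\<^sup>2" if fg: "f \<in> F" "g \<in> F" "c f = c g" for f g
  proof -
    have [measurable]: "f \<in> borel_measurable borel" "g \<in> borel_measurable borel"
      and sq: "integrable P (\<lambda>ob. (f ob)\<^sup>2)" "integrable P (\<lambda>ob. (g ob)\<^sup>2)"
      using F fg by (auto simp: donsker_def)
    have int: "integrable P f" "integrable P g"
      using sq by (auto intro: P.square_integrable_imp_integrable)
    show ?thesis
    proof (rule variance_le_of_tight_emp[OF _ _ \<eta> e(2)])
      show "integrable P (\<lambda>ob. (f ob - g ob)\<^sup>2)"
        by (rule integrable_square_diff[OF _ sq(1) _ sq(2)]) measurable
      show "\<forall>\<^sub>F n in sequentially. \<exists>A\<in>sets (product_law n). measure (product_law n) A \<le> e \<and>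
         (\<forall>s\<in>space (product_law n) - A. \<bar>emp P n (\<lambda>ob. f ob - g ob) s\<bar> \<le> \<eta>)"
        using c(2)
      proof eventually_elim
        case (elim n)
        then show ?case
          unfolding emp_diff[OF int] using fg by blast
      qed
    qed measurable
  qed
  then show ?thesis using c(1) by blast
qed

text \<open>A Donsker class is totally bounded with respect to the standard deviation.  In a sequence violating the claim,
  infinitely many members therefore lie within \<open>\<delta>\<close> of each other; along a subsequence converging almost everywhere
  to \<open>f\<^sub>0\<close>, Fatou's lemma passes this bound on to the distance from \<open>f\<^sub>0\<close>.\<close>

lemma donsker_L1_imp_variance:
  assumes F: "donsker P F" and f0 [measurable]: "f0 \<in> borel_measurable borel" and sq0: "integrable P (\<lambda>ob. (f0 ob)\<^sup>2)"
    and \<delta>: "0 < \<delta>"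
  shows "\<exists>\<delta>'>0. \<forall>f\<in>F. P.expectation (\<lambda>ob. \<bar>f ob - f0 ob\<bar>) < \<delta>' \<longrightarrow> P.variance (\<lambda>ob. f ob - f0 ob) \<le> \<delta>\<^sup>2"
proof (rule ccontr)
  assume "\<not> ?thesis"
  then have "\<exists>f\<in>F. P.expectation (\<lambda>ob. \<bar>f ob - f0 ob\<bar>) < \<delta>' \<and> \<delta>\<^sup>2 < P.variance (\<lambda>ob. f ob - f0 ob)"
    if "0 < \<delta>'" for \<delta>' using that by (auto simp: not_le)
  from this[of "inverse (real (Suc m))" for m]
  have "\<forall>m. \<exists>f. f \<in> F \<and> P.expectation (\<lambda>ob. \<bar>f ob - f0 ob\<bar>) < inverse (real (Suc m)) \<and> \<delta>\<^sup>2 < P.variance (\<lambda>ob. f ob - f0 ob)"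
    by auto
  then obtain f where f: "\<forall>m. f m \<in> F \<and> P.expectation (\<lambda>ob. \<bar>f m ob - f0 ob\<bar>) < inverse (real (Suc m)) \<and> \<delta>\<^sup>2 < P.variance (\<lambda>ob. f m ob - f0 ob)"
    by (rule exE[OF choice])
  then have fF: "f m \<in> F" and fL1: "P.expectation (\<lambda>ob. \<bar>f m ob - f0 ob\<bar>) < inverse (real (Suc m))"
    and fvar: "\<delta>\<^sup>2 < P.variance (\<lambda>ob. f m ob - f0 ob)" for m by auto
  have fm [measurable]: "f m \<in> borel_measurable borel" and fsq: "integrable P (\<lambda>ob. (f m ob)\<^sup>2)" for m
    using F fF[of m] by (auto simp: donsker_def)
  have fint: "integrable P (f m)" for m
    using fsq[of m] by (auto intro: P.square_integrable_imp_integrable)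
  have f0int: "integrable P f0" using sq0 by (auto intro: P.square_integrable_imp_integrable)
  obtain c :: "('o \<Rightarrow> real) \<Rightarrow> ((('o \<Rightarrow> real) \<Rightarrow> real) \<Rightarrow> int)" where c: "finite (c ` F)"
    "\<forall>f\<in>F. \<forall>g\<in>F. c f = c g \<longrightarrow> P.variance (\<lambda>ob. f ob - g ob) \<le> \<delta>\<^sup>2"
    using donsker_variance_cells[OF F \<delta>] by (elim exE conjE)
  have "finite ((\<lambda>m. c (f m)) ` UNIV)"
    by (rule finite_subset[OF _ c(1)]) (use fF in auto)
  from pigeonhole_infinite[OF infinite_UNIV_nat this]
  obtain a where a: "infinite {m. c (f m) = c (f a)}" by auto
  define r where "r = enumerate {m. c (f m) = c (f a)}"
  have r: "strict_mono r" unfolding r_def by (rule strict_mono_enumerate[OF a])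
  have rc: "c (f (r m)) = c (f a)" for m
    using enumerate_in_set[OF a, of m] by (simp add: r_def)
  have lim1: "(\<lambda>m. P.expectation (\<lambda>ob. \<bar>f (r m) ob - f0 ob\<bar>)) \<longlonglongrightarrow> 0"
  proof (rule tendsto_sandwich[OF _ _ tendsto_const LIMSEQ_inverse_real_of_nat])
    show "\<forall>\<^sub>F m in sequentially. P.expectation (\<lambda>ob. \<bar>f (r m) ob - f0 ob\<bar>) \<le> inverse (real (Suc m))"
    proof (intro always_eventually allI)
      fix m
      have "inverse (real (Suc (r m))) \<le> inverse (real (Suc m))"
        using strict_mono_imp_increasing[OF r, of m] by (intro le_imp_inverse_le) auto
      then show "P.expectation (\<lambda>ob. \<bar>f (r m) ob - f0 ob\<bar>) \<le> inverse (real (Suc m))"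
        using fL1[of "r m"] by linarith
    qed
  qed (simp add: always_eventually)
  obtain t where t: "strict_mono t" "AE ob in P. (\<lambda>m. f (r (t m)) ob - f0 ob) \<longlonglongrightarrow> 0"
    using tendsto_L1_AE_subseq[of P "\<lambda>m ob. f (r m) ob - f0 ob"] fint f0int lim1 by auto
  define g where "g m = f (r (t m))" for m
  have gint: "integrable P (g m)" for m by (simp add: g_def fint)
  have gm [measurable]: "g m \<in> borel_measurable borel" for m by (simp add: g_def)
  have gF: "g m \<in> F" for m by (simp add: g_def fF)
  have glim: "AE ob in P. (\<lambda>m. g m ob) \<longlonglongrightarrow> f0 ob"
    using t(2) by eventually_elim (simp add: g_def LIM_zero_iff)
  have "(\<lambda>m. P.expectation (g m)) \<longlonglongrightarrow> P.expectation f0"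
  proof (rule Lim_null[THEN iffD2], rule tendsto_rabs_zero_cancel, rule tendsto_sandwich[OF _ _ tendsto_const])
    show "(\<lambda>m. P.expectation (\<lambda>ob. \<bar>g m ob - f0 ob\<bar>)) \<longlonglongrightarrow> 0"
      unfolding g_def using LIMSEQ_subseq_LIMSEQ[OF lim1 t(1)] by (simp add: comp_def)
    show "\<forall>\<^sub>F m in sequentially. \<bar>P.expectation (g m) - P.expectation f0\<bar> \<le> P.expectation (\<lambda>ob. \<bar>g m ob - f0 ob\<bar>)"
      using integral_abs_bound[of P "\<lambda>ob. g m ob - f0 ob" for m] gint f0int by (auto intro!: always_eventually)
  qed simp
  note mlim = this
  have dlim: "AE ob in P. (\<lambda>m. (g 0 ob - g m ob) - (P.expectation (g 0) - P.expectation (g m)))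
      \<longlonglongrightarrow> (g 0 ob - f0 ob) - (P.expectation (g 0) - P.expectation f0)"
    using glim by eventually_elim (intro tendsto_diff tendsto_const mlim)
  define d where "d m ob = ((g 0 ob - g m ob) - (P.expectation (g 0) - P.expectation (g m)))\<^sup>2" for m ob
  have [measurable]: "d m \<in> borel_measurable borel" for m unfolding d_def by measurable
  have dle: "(\<integral>\<^sup>+ob. ennreal (d m ob) \<partial>P) \<le> ennreal (\<delta>\<^sup>2)" for m
  proof -
    have "c (g 0) = c (g m)" by (simp add: g_def rc)
    then have v: "P.variance (\<lambda>ob. g 0 ob - g m ob) \<le> \<delta>\<^sup>2" using c(2) gF by blast
    have dv: "P.variance (\<lambda>ob. g 0 ob - g m ob) = P.expectation (d m)"
      unfolding d_def using gint by simp
    have gsq: "integrable P (\<lambda>ob. (g i ob)\<^sup>2)" for i by (simp add: g_def fsq)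
    have gg: "integrable P (\<lambda>ob. (g 0 ob - g m ob)\<^sup>2)" by (rule integrable_square_diff[OF _ gsq _ gsq]) measurable
    have k: "integrable P (\<lambda>ob. (P.expectation (g 0) - P.expectation (g m))\<^sup>2)" by simp
    have "integrable P (d m)" unfolding d_def by (rule integrable_square_diff[OF _ gg _ k]) measurable
    then show ?thesis
      using v unfolding dv by (subst nn_integral_eq_integral) (auto simp: d_def intro!: ennreal_leI)
  qed
  define d0 where "d0 ob = ((g 0 ob - f0 ob) - (P.expectation (g 0) - P.expectation f0))\<^sup>2" for ob
  have "(\<integral>\<^sup>+ob. ennreal (d0 ob) \<partial>P) = (\<integral>\<^sup>+ob. liminf (\<lambda>m. ennreal (d m ob)) \<partial>P)"
  proof (rule nn_integral_cong_AE)
    show "AE ob in P. ennreal (d0 ob) = liminf (\<lambda>m. ennreal (d m ob))"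
      using dlim
    proof eventually_elim
      case (elim ob)
      then have "(\<lambda>m. ennreal (d m ob)) \<longlonglongrightarrow> ennreal (d0 ob)"
        unfolding d_def d0_def by (intro tendsto_ennrealI tendsto_power)
      then show ?case by (intro lim_imp_Liminf[symmetric]) auto
    qed
  qed
  also have "\<dots> \<le> liminf (\<lambda>m. \<integral>\<^sup>+ob. ennreal (d m ob) \<partial>P)"
    by (rule nn_integral_liminf) measurable
  also have "\<dots> \<le> ennreal (\<delta>\<^sup>2)"
    by (intro Liminf_le always_eventually allI dle) simp
  finally have le: "(\<integral>\<^sup>+ob. ennreal (d0 ob) \<partial>P) \<le> ennreal (\<delta>\<^sup>2)" .
  have [measurable]: "d0 \<in> borel_measurable borel" unfolding d0_def by measurable
  have "P.expectation d0 \<le> \<delta>\<^sup>2"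
    using le by (subst integral_eq_nn_integral) (auto simp: d0_def enn2real_leI)
  moreover have "P.variance (\<lambda>ob. g 0 ob - f0 ob) = P.expectation d0"
    unfolding d0_def using gint f0int by simp
  ultimately show False using fvar[of "r (t 0)"] by (simp add: g_def)
qed

text \<open>As \<open>f\<^sub>0\<close> may lie outside the class, it is compared with one representative of each of
  the finitely many cells that contain functions close to it.\<close>

lemma donsker_equicontinuous:
  assumes F: "donsker P F" and f0 [measurable]: "f0 \<in> borel_measurable borel" and sq0: "integrable P (\<lambda>ob. (f0 ob)\<^sup>2)"
    and \<eta>: "0 < \<eta>" and e: "0 < e"
  shows "\<exists>\<delta>>0. \<forall>\<^sub>F n in sequentially. \<exists>A\<in>sets (product_law n). measure (product_law n) A \<le> e \<and>
    (\<forall>s\<in>space (product_law n) - A. \<forall>f\<in>F. P.expectation (\<lambda>ob. \<bar>f ob - f0 ob\<bar>) < \<delta> \<longrightarrow> \<bar>emp P n (\<lambda>ob. f ob - f0 ob) s\<bar> < \<eta>)"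
proof -
  have "0 < \<eta> / 2" "0 < e / 2" using \<eta> e by auto
  from donsker_cells[OF F this]
  obtain c :: "('o \<Rightarrow> real) \<Rightarrow> ((('o \<Rightarrow> real) \<Rightarrow> real) \<Rightarrow> int)" where c: "finite (c ` F)"
    "\<forall>\<^sub>F n in sequentially. \<exists>A\<in>sets (product_law n). measure (product_law n) A \<le> e / 2 \<and>
       (\<forall>s\<in>space (product_law n) - A. \<forall>f\<in>F. \<forall>g\<in>F. c f = c g \<longrightarrow> \<bar>emp P n f s - emp P n g s\<bar> \<le> \<eta> / 2)"
    by (elim exE conjE)
  \<comment> \<open>\<open>v\<close> is a variance for which Chebyshev's inequality at one representative of each of the at most \<open>k\<close> cells
    costs a total probability of at most \<open>e / 2\<close>\<close>
  define k where "k = real (card (c ` F)) + 1"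
  have k: "0 < k" by (simp add: k_def)
  define v where "v = e / 2 * (\<eta> / 2)\<^sup>2 / k"
  have v: "0 < v" using e \<eta> k by (simp add: v_def)
  then have "0 < sqrt v" by simp
  from donsker_L1_imp_variance[OF F f0 sq0 this]
  obtain \<delta> where \<delta>: "0 < \<delta>" and var: "\<And>f. f \<in> F \<Longrightarrow> P.expectation (\<lambda>ob. \<bar>f ob - f0 ob\<bar>) < \<delta> \<Longrightarrow> P.variance (\<lambda>ob. f ob - f0 ob) \<le> v"
    using v by auto
  define G where "G = {f\<in>F. P.expectation (\<lambda>ob. \<bar>f ob - f0 ob\<bar>) < \<delta>}"
  have GF: "G \<subseteq> F" by (auto simp: G_def)
  have finG: "finite (c ` G)" by (rule finite_subset[OF image_mono[OF GF] c(1)])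
  define rep where "rep i = (SOME f. f \<in> G \<and> c f = i)" for i
  have rep: "rep i \<in> G \<and> c (rep i) = i" if "i \<in> c ` G" for i
    unfolding rep_def by (rule someI_ex[of "\<lambda>f. f \<in> G \<and> c f = i"]) (use that in blast)
  have f0int: "integrable P f0" using sq0 by (auto intro: P.square_integrable_imp_integrable)
  have Fm: "f \<in> borel_measurable borel" "integrable P (\<lambda>ob. (f ob)\<^sup>2)" "integrable P f" if "f \<in> F" for f
    using F that by (auto simp: donsker_def intro: P.square_integrable_imp_integrable)
  have sqd: "integrable P (\<lambda>ob. (f ob - f0 ob)\<^sup>2)" if f: "f \<in> F" for f
    using Fm(1)[OF f] f0 by (intro integrable_square_diff[OF _ Fm(2)[OF f] _ sq0]) simp_all
  have "\<forall>\<^sub>F n in sequentially. \<exists>A\<in>sets (product_law n). measure (product_law n) A \<le> e \<and>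
    (\<forall>s\<in>space (product_law n) - A. \<forall>f\<in>F. P.expectation (\<lambda>ob. \<bar>f ob - f0 ob\<bar>) < \<delta> \<longrightarrow> \<bar>emp P n (\<lambda>ob. f ob - f0 ob) s\<bar> < \<eta>)"
    using c(2) eventually_gt_at_top[of 0]
  proof eventually_elim
    case (elim n)
    from elim(1) obtain A where A: "A \<in> sets (product_law n)" "measure (product_law n) A \<le> e / 2"
      and osc: "\<forall>s\<in>space (product_law n) - A. \<forall>f\<in>F. \<forall>g\<in>F. c f = c g \<longrightarrow> \<bar>emp P n f s - emp P n g s\<bar> \<le> \<eta> / 2"
      by (elim bexE conjE)
    interpret N: prob_space "product_law n" by (intro prob_space_PiM P.prob_space_axioms)
    define B where "B i = {s\<in>space (product_law n). \<eta> / 2 \<le> \<bar>emp P n (\<lambda>ob. rep i ob - f0 ob) s\<bar>}" for i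
    have B: "B i \<in> sets (product_law n)" "measure (product_law n) (B i) \<le> v / (\<eta> / 2)\<^sup>2" if i: "i \<in> c ` G" for i
    proof -
      have rF: "rep i \<in> F" and rG: "rep i \<in> G" using rep[OF i] GF by auto
      have m: "(\<lambda>ob. rep i ob - f0 ob) \<in> borel_measurable borel" using Fm(1)[OF rF] by measurable
      show "B i \<in> sets (product_law n)" unfolding B_def using emp_measurable[OF m, of n] by measurable
      have "measure (product_law n) (B i) \<le> P.variance (\<lambda>ob. rep i ob - f0 ob) / (\<eta> / 2)\<^sup>2"
        unfolding B_def by (rule emp_chebyshev[OF m sqd[OF rF]]) (use \<eta> elim in auto)
      also have "\<dots> \<le> v / (\<eta> / 2)\<^sup>2"
        using var[OF rF] rG by (intro divide_right_mono) (auto simp: G_def)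
      finally show "measure (product_law n) (B i) \<le> v / (\<eta> / 2)\<^sup>2" .
    qed
    define A' where "A' = A \<union> (\<Union>i\<in>c ` G. B i)"
    have UB: "(\<Union>i\<in>c ` G. B i) \<in> sets (product_law n)" using finG B(1) by (intro sets.finite_UN) auto
    have "measure (product_law n) (\<Union>i\<in>c ` G. B i) \<le> (\<Sum>i\<in>c ` G. measure (product_law n) (B i))"
      by (rule N.finite_measure_subadditive_finite[OF finG]) (use B(1) in auto)
    also have "\<dots> \<le> (\<Sum>i\<in>c ` G. v / (\<eta> / 2)\<^sup>2)" by (intro sum_mono B(2))
    also have "\<dots> = real (card (c ` G)) * (v / (\<eta> / 2)\<^sup>2)" by simp
    also have "\<dots> \<le> k * (v / (\<eta> / 2)\<^sup>2)"
      using card_mono[OF c(1) image_mono[OF GF]] v by (intro mult_right_mono) (auto simp: k_def)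
    also have "\<dots> = e / 2" using k \<eta> by (simp add: v_def)
    finally have "measure (product_law n) (\<Union>i\<in>c ` G. B i) \<le> e / 2" .
    moreover have "measure (product_law n) A' \<le> measure (product_law n) A + measure (product_law n) (\<Union>i\<in>c ` G. B i)"
      unfolding A'_def by (rule measure_Un_le[OF A(1) UB])
    ultimately have "measure (product_law n) A' \<le> e" using A(2) by linarith
    moreover have "\<bar>emp P n (\<lambda>ob. f ob - f0 ob) s\<bar> < \<eta>"
      if s: "s \<in> space (product_law n) - A'" and f: "f \<in> F" "P.expectation (\<lambda>ob. \<bar>f ob - f0 ob\<bar>) < \<delta>" for s f
    proof -
      have i: "c f \<in> c ` G" using f by (auto simp: G_def)
      have rF: "rep (c f) \<in> F" "c (rep (c f)) = c f" using rep[OF i] GF by auto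
      have "\<bar>emp P n f s - emp P n (rep (c f)) s\<bar> \<le> \<eta> / 2"
        using osc s f(1) rF by (auto simp: A'_def)
      moreover have "s \<notin> B (c f)" using s i by (auto simp: A'_def)
      then have "\<bar>emp P n (\<lambda>ob. rep (c f) ob - f0 ob) s\<bar> < \<eta> / 2"
        using s by (auto simp: B_def)
      moreover have "emp P n (\<lambda>ob. f ob - f0 ob) s
          = (emp P n f s - emp P n (rep (c f)) s) + emp P n (\<lambda>ob. rep (c f) ob - f0 ob) s"
        by (simp add: emp_diff Fm(3)[OF f(1)] Fm(3)[OF rF(1)] f0int)
      ultimately show ?thesis by linarith
    qed
    moreover have "A' \<in> sets (product_law n)" unfolding A'_def using A(1) UB by (rule sets.Un)
    ultimately show ?case by blast
  qed
  then show ?thesis using \<delta> by blast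
qed

text \<open>Equicontinuity at \<open>f\<^sub>0\<close> is uniform over the class, so it applies to functions computed from the same sample.\<close>

theorem donsker_emp:
  fixes fh :: "nat \<Rightarrow> 'w \<Rightarrow> 'o \<Rightarrow> real"
  assumes F: "donsker P F" and f0 [measurable]: "f0 \<in> borel_measurable borel" and sq0: "integrable P (\<lambda>ob. (f0 ob)\<^sup>2)"
    and E: "\<And>n. E n \<in> events" "(\<lambda>n. prob (E n)) \<longlonglongrightarrow> 1" and fh: "\<And>n \<omega>. \<omega> \<in> E n \<Longrightarrow> fh n \<omega> \<in> F"
    and meas: "\<And>n. (\<lambda>(\<omega>, ob). fh n \<omega> ob) \<in> borel_measurable (M \<Otimes>\<^sub>M borel)"
    and small: "small_oP M (\<lambda>n \<omega>. \<integral>\<^sup>+ob. ennreal \<bar>fh n \<omega> ob - f0 ob\<bar> \<partial>P) (\<lambda>_. 1)"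
  shows "small_oP M (\<lambda>n \<omega>. ennreal \<bar>emp P n (\<lambda>ob. fh n \<omega> ob - f0 ob) (\<lambda>i. Obs i \<omega>)\<bar>) (\<lambda>_. 1)"
  unfolding small_oP_1_iff
proof (intro allI impI)
  fix \<eta> :: real assume \<eta>: "0 < \<eta>"
  let ?p = "\<lambda>n. prob {\<omega>\<in>space M. ennreal \<eta> < ennreal \<bar>emp P n (\<lambda>ob. fh n \<omega> ob - f0 ob) (\<lambda>i. Obs i \<omega>)\<bar>}"
  show "?p \<longlonglongrightarrow> 0"
  proof (rule LIMSEQ_I)
    fix e :: real assume e: "0 < e"
    then have "0 < e / 4" by simp
    from donsker_equicontinuous[OF F f0 sq0 \<eta> this]
    obtain \<delta> where \<delta>: "0 < \<delta>" and ev: "\<forall>\<^sub>F n in sequentially. \<exists>A\<in>sets (product_law n). measure (product_law n) A \<le> e / 4 \<and>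
      (\<forall>s\<in>space (product_law n) - A. \<forall>f\<in>F. P.expectation (\<lambda>ob. \<bar>f ob - f0 ob\<bar>) < \<delta> \<longrightarrow> \<bar>emp P n (\<lambda>ob. f ob - f0 ob) s\<bar> < \<eta>)"
      by (elim exE conjE)
    define D where "D n = {\<omega>\<in>space M. ennreal (\<delta> / 2) < (\<integral>\<^sup>+ob. ennreal \<bar>fh n \<omega> ob - f0 ob\<bar> \<partial>P)}" for n
    have Dm: "D n \<in> events" for n unfolding D_def using meas[of n] by measurable
    have "(\<lambda>n. prob (D n)) \<longlonglongrightarrow> 0"
      using small \<delta> unfolding small_oP_1_iff D_def by simp
    then have evD: "\<forall>\<^sub>F n in sequentially. prob (D n) < e / 4"
      using e by (intro order_tendstoD(2)) auto
    have "\<forall>\<^sub>F n in sequentially. 1 - e / 4 < prob (E n)"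
      using order_tendstoD(1)[OF E(2)] e by simp
    then have "\<forall>\<^sub>F n in sequentially. norm (?p n - 0) < e"
      using evD ev eventually_gt_at_top[of 0]
    proof eventually_elim
      case (elim n)
      from elim(3) obtain A where A: "A \<in> sets (product_law n)" "measure (product_law n) A \<le> e / 4"
        and osc: "\<forall>s\<in>space (product_law n) - A. \<forall>f\<in>F. P.expectation (\<lambda>ob. \<bar>f ob - f0 ob\<bar>) < \<delta> \<longrightarrow> \<bar>emp P n (\<lambda>ob. f ob - f0 ob) s\<bar> < \<eta>"
        by (elim bexE conjE)
      let ?t = "\<lambda>\<omega>. \<lambda>i\<in>{..<n}. Obs i \<omega>"
      have tsp: "?t \<omega> \<in> space (product_law n)" for \<omega> by (simp add: space_PiM)
      have Asp: "A = {s\<in>space (product_law n). s \<in> A}" using sets.sets_into_space[OF A(1)] by auto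
      let ?A = "{\<omega>\<in>space M. ?t \<omega> \<in> A}"
      have "A \<in> sets (\<Pi>\<^sub>M i\<in>{..<n}. borel)" using A(1) by (simp only: sets_product_law)
      from measurable_sets[OF tuple_measurable this]
      have Am: "?A \<in> events" by (simp add: vimage_def Int_def conj_commute)
      have pA: "prob ?A \<le> e / 4"
        using product_law_measure[OF elim(4), of "\<lambda>s. s \<in> A"] A Asp by simp
      have "{\<omega>\<in>space M. ennreal \<eta> < ennreal \<bar>emp P n (\<lambda>ob. fh n \<omega> ob - f0 ob) (\<lambda>i. Obs i \<omega>)\<bar>}
          \<subseteq> ((space M - E n) \<union> D n) \<union> ?A"
      proof (intro subsetI, rule ccontr)
        fix \<omega>
        assume \<omega>: "\<omega> \<in> {\<omega>\<in>space M. ennreal \<eta> < ennreal \<bar>emp P n (\<lambda>ob. fh n \<omega> ob - f0 ob) (\<lambda>i. Obs i \<omega>)\<bar>}"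
          and n: "\<omega> \<notin> ((space M - E n) \<union> D n) \<union> ?A"
        have f: "fh n \<omega> \<in> F" using \<omega> n by (intro fh) auto
        then have [measurable]: "fh n \<omega> \<in> borel_measurable borel" using F by (auto simp: donsker_def)
        have le: "(\<integral>\<^sup>+ob. ennreal \<bar>fh n \<omega> ob - f0 ob\<bar> \<partial>P) \<le> ennreal (\<delta> / 2)"
          using \<omega> n by (auto simp: D_def not_less)
        have "P.expectation (\<lambda>ob. \<bar>fh n \<omega> ob - f0 ob\<bar>) \<le> \<delta> / 2"
          using enn2real_leI[OF _ le] \<delta> by (subst integral_eq_nn_integral) auto
        then have "P.expectation (\<lambda>ob. \<bar>fh n \<omega> ob - f0 ob\<bar>) < \<delta>" using \<delta> by simp
        then have "\<bar>emp P n (\<lambda>ob. fh n \<omega> ob - f0 ob) (?t \<omega>)\<bar> < \<eta>"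
          using osc[rule_format, of "?t \<omega>" "fh n \<omega>"] f n \<omega> tsp[of \<omega>] by auto
        then show False using \<omega> \<eta> by (auto simp: ennreal_less_iff)
      qed
      then have "?p n \<le> prob (((space M - E n) \<union> D n) \<union> ?A)"
        by (rule finite_measure_mono) (use E(1) Dm Am in auto)
      also have "\<dots> \<le> prob ((space M - E n) \<union> D n) + prob ?A"
        by (rule measure_Un_le) (use E(1) Dm Am in auto)
      also have "\<dots> \<le> (prob (space M - E n) + prob (D n)) + prob ?A"
        by (intro add_mono measure_Un_le order_refl) (use E(1) Dm in auto)
      also have "\<dots> < e"
        using elim(1,2) pA e prob_compl[OF E(1)[of n]] by simp
      finally show ?case by simp
    qed
    then show "\<exists>no. \<forall>n\<ge>no. norm (?p n - 0) < e"
      by (simp add: eventually_sequentially)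
  qed
qed

end

section \<open>Local alternatives\<close>

lemma inverse_root_limit: "(\<lambda>n. inverse (sqrt (real n))) \<longlonglongrightarrow> 0"
  by (intro tendsto_inverse_0_at_top filterlim_compose[OF sqrt_at_top filterlim_real_sequentially])

lemma root_n_iexp_limit:
  "(\<lambda>n. of_real (sqrt (real n)) * (iexp (a / sqrt (real n)) - 1)) \<longlonglongrightarrow> \<i> * of_real a"
proof (rule Lim_null[THEN iffD2], rule Lim_null_comparison)
  show "(\<lambda>n. a\<^sup>2 / 2 * inverse (sqrt (real n))) \<longlonglongrightarrow> 0"
    by (rule tendsto_mult_right_zero[OF inverse_root_limit])
  show "\<forall>\<^sub>F n in sequentially. norm (of_real (sqrt (real n)) * (iexp (a / sqrt (real n)) - 1) - \<i> * of_real a) \<le> a\<^sup>2 / 2 * inverse (sqrt (real n))"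
    using eventually_gt_at_top[of 0]
  proof eventually_elim
    case (elim n)
    define q where "q = sqrt (real n)"
    have q: "0 < q" using elim by (simp add: q_def)
    have "norm (iexp (a / q) - (1 + \<i> * of_real (a / q))) \<le> (a / q)\<^sup>2 / 2"
      using iexp_approx1[of "a / q" 1] by (simp add: power2_eq_square)
    then have "q * norm (iexp (a / q) - (1 + \<i> * of_real (a / q))) \<le> q * ((a / q)\<^sup>2 / 2)"
      using q by (intro mult_left_mono) auto
    also have "q * norm (iexp (a / q) - (1 + \<i> * of_real (a / q))) = norm (of_real q * (iexp (a / q) - (1 + \<i> * of_real (a / q))))"
      using q by (simp add: norm_mult)
    also have "of_real q * (iexp (a / q) - (1 + \<i> * of_real (a / q))) = of_real q * (iexp (a / q) - 1) - \<i> * of_real a"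
      using q by (simp add: field_simps)
    also have "q * ((a / q)\<^sup>2 / 2) = a\<^sup>2 / 2 * inverse q"
      using q by (simp add: field_simps power2_eq_square)
    finally show ?case by (simp add: q_def)
  qed
qed

lemma n_iexp_limit:
  "(\<lambda>n. of_nat n * (iexp (a / sqrt (real n)) - 1 - \<i> * of_real (a / sqrt (real n)))) \<longlonglongrightarrow> of_real (- (a\<^sup>2 / 2))"
proof (rule Lim_null[THEN iffD2], rule Lim_null_comparison)
  show "(\<lambda>n. \<bar>a\<bar> ^ 3 / 6 * inverse (sqrt (real n))) \<longlonglongrightarrow> 0"
    by (rule tendsto_mult_right_zero[OF inverse_root_limit])
  show "\<forall>\<^sub>F n in sequentially. norm (of_nat n * (iexp (a / sqrt (real n)) - 1 - \<i> * of_real (a / sqrt (real n))) - of_real (- (a\<^sup>2 / 2)))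
      \<le> \<bar>a\<bar> ^ 3 / 6 * inverse (sqrt (real n))"
    using eventually_gt_at_top[of 0]
  proof eventually_elim
    case (elim n)
    define q where "q = sqrt (real n)"
    have q: "0 < q" and n: "real n = q * q" using elim by (simp_all add: q_def)
    have cn: "(of_nat n :: complex) = of_real q * of_real q"
      using n by (metis of_real_mult of_real_of_nat_eq)
    let ?r = "iexp (a / q) - (1 + \<i> * of_real (a / q) - of_real ((a / q)\<^sup>2 / 2))"
    have "(\<Sum>k\<le>2. (\<i> * complex_of_real x) ^ k / fact k) = 1 + \<i> * of_real x + (\<i> * of_real x)\<^sup>2 / 2" for x
      by (simp add: numeral_2_eq_2)
    then have "(\<Sum>k\<le>2. (\<i> * complex_of_real x) ^ k / fact k) = 1 + \<i> * of_real x - of_real (x\<^sup>2 / 2)" for x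
      by (simp add: power_mult_distrib)
    then have "norm ?r \<le> \<bar>a / q\<bar> ^ 3 / 6"
      using iexp_approx1[of "a / q" 2] by (simp add: eval_nat_numeral)
    then have "(q * q) * norm ?r \<le> (q * q) * (\<bar>a / q\<bar> ^ 3 / 6)"
      using q by (intro mult_left_mono) auto
    also have "(q * q) * norm ?r = norm (of_real q * of_real q * ?r)"
      using q by (simp add: norm_mult)
    also have "of_real q * of_real q * ?r = of_nat n * (iexp (a / q) - 1 - \<i> * of_real (a / q)) - of_real (- (a\<^sup>2 / 2))"
      using q by (simp add: cn field_simps power2_eq_square)
    also have "(q * q) * (\<bar>a / q\<bar> ^ 3 / 6) = \<bar>a\<bar> ^ 3 / 6 * inverse q"
      using q by (simp add: field_simps power3_eq_cube)
    finally show ?case by (simp add: q_def)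
  qed
qed

text \<open>Compare with \<open>exp (z / n) ^ n\<close>: numbers of norm at most \<open>1\<close> satisfy \<open>\<bar>a\<^sup>n - b\<^sup>n\<bar> \<le> n \<bar>a - b\<bar>\<close>.  The condition on \<open>Re z\<close>
  puts \<open>exp (z / n)\<close> into the unit disc.\<close>

lemma power_tendsto_exp:
  fixes w :: "nat \<Rightarrow> complex"
  assumes w: "\<And>n. norm (w n) \<le> 1" and lim: "(\<lambda>n. of_nat n * (w n - 1)) \<longlonglongrightarrow> z" and z: "Re z \<le> 0"
  shows "(\<lambda>n. w n ^ n) \<longlonglongrightarrow> exp z"
proof -
  have e: "(\<lambda>n. of_nat n * (exp (z / of_nat n) - 1)) \<longlonglongrightarrow> z"
  proof (cases "z = 0")
    case False
    have "((\<lambda>h. (exp h - 1) / h) \<longlongrightarrow> (1::complex)) (at 0)"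
      using DERIV_exp[of "0::complex"] by (simp add: has_field_derivative_iff)
    moreover have "filterlim (\<lambda>n. z / of_nat n) (at 0) sequentially"
      unfolding filterlim_at
    proof
      show "(\<lambda>n. z / of_nat n) \<longlonglongrightarrow> 0"
        by (rule tendsto_divide_0[OF tendsto_const]) (rule tendsto_of_nat)
      show "\<forall>\<^sub>F n in sequentially. z / of_nat n \<in> UNIV \<and> z / of_nat n \<noteq> 0"
        using eventually_gt_at_top[of 0] by eventually_elim (use False in auto)
    qed
    ultimately have "(\<lambda>n. (exp (z / of_nat n) - 1) / (z / of_nat n)) \<longlonglongrightarrow> 1"
      by (rule filterlim_compose)
    from tendsto_mult_left[OF this, of z]
    have "(\<lambda>n. z * ((exp (z / of_nat n) - 1) / (z / of_nat n))) \<longlonglongrightarrow> z" by simp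
    moreover have "\<forall>\<^sub>F n in sequentially. z * ((exp (z / of_nat n) - 1) / (z / of_nat n)) = of_nat n * (exp (z / of_nat n) - 1)"
      using eventually_gt_at_top[of 0] by eventually_elim (use False in \<open>simp add: field_simps\<close>)
    ultimately show ?thesis by (rule Lim_transform_eventually)
  qed simp
  have "(\<lambda>n. w n ^ n - exp z) \<longlonglongrightarrow> 0"
  proof (rule Lim_null_comparison)
    show "(\<lambda>n. norm (of_nat n * (w n - 1) - of_nat n * (exp (z / of_nat n) - 1))) \<longlonglongrightarrow> 0"
      using tendsto_norm_zero[OF tendsto_diff[OF lim e, unfolded diff_self]] .
    show "\<forall>\<^sub>F n in sequentially. norm (w n ^ n - exp z) \<le> norm (of_nat n * (w n - 1) - of_nat n * (exp (z / of_nat n) - 1))"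
      using eventually_gt_at_top[of 0]
    proof eventually_elim
      case (elim n)
      have "exp z = exp (z / of_nat n) ^ n"
        using elim by (simp add: exp_of_nat_mult[symmetric])
      moreover have "norm (exp (z / of_nat n)) \<le> 1"
        using z elim by (simp add: divide_nonpos_pos)
      ultimately have "norm (w n ^ n - exp z) \<le> of_nat n * norm (w n - exp (z / of_nat n))"
        using norm_power_diff[of "w n" "exp (z / of_nat n)" n] w by simp
      also have "\<dots> = norm (of_nat n * (w n - exp (z / of_nat n)))" by (simp add: norm_mult)
      also have "of_nat n * (w n - exp (z / of_nat n)) = of_nat n * (w n - 1) - of_nat n * (exp (z / of_nat n) - 1)"
        by (simp add: algebra_simps)
      finally show ?case .
    qed
  qed
  then show ?thesis by (simp add: LIM_zero_iff)
qed

text \<open>A smooth submodel together with a choice of its score and of a bound for the score.\<close>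

locale local_alternative = iid_sample M Obs P
  for M :: "'w measure" and Obs :: "nat \<Rightarrow> 'w \<Rightarrow> 'o::topological_space" and P +
  fixes p :: "real \<Rightarrow> 'o \<Rightarrow> real" and g :: "'o \<Rightarrow> real" and B :: real
  assumes p_density: "\<And>t. t \<in> {0..1} \<Longrightarrow> p t \<in> borel_measurable P \<and> (\<forall>ob. 0 \<le> p t ob) \<and> (\<integral>\<^sup>+ob. ennreal (p t ob) \<partial>P) = 1"
    and p_0: "p 0 = (\<lambda>_. 1)"
    and g_measurable: "g \<in> borel_measurable P" and g_bounded: "\<And>ob. \<bar>g ob\<bar> \<le> B"
    and p_derivative: "\<And>e. 0 < e \<Longrightarrow> \<exists>d>0. \<forall>t\<in>{0..1}. 0 < t \<and> t < d \<longrightarrow> (AE ob in P. \<bar>(p t ob - 1) / t - g ob\<bar> \<le> e)"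

lemma (in iid_sample) smooth_submodel_imp_local_alternative:
  "smooth_submodel P p \<Longrightarrow> \<exists>g B. local_alternative M Obs P p g B"
  unfolding smooth_submodel_def local_alternative_def local_alternative_axioms_def
  using iid_sample_axioms by blast

context local_alternative
begin

definition pn :: "nat \<Rightarrow> 'o \<Rightarrow> real" where "pn n = p (1 / sqrt (real n))"

lemma root_in_unit: "1 / sqrt (real n) \<in> {0..1}"
  by (cases "n = 0") auto

lemma pn_measurable [measurable]: "pn n \<in> borel_measurable borel"
  and pn_nonneg [simp]: "0 \<le> pn n ob"
  and pn_total: "(\<integral>\<^sup>+ob. ennreal (pn n ob) \<partial>P) = 1"
  using p_density[OF root_in_unit[of n]] by (auto simp: pn_def)

lemma pn_integrable: "integrable P (pn n)" and pn_integral: "(\<integral>ob. pn n ob \<partial>P) = 1"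
proof -
  show "integrable P (pn n)" using pn_total[of n] by (intro integrableI_nonneg) auto
  show "(\<integral>ob. pn n ob \<partial>P) = 1" using pn_total[of n] by (subst integral_eq_nn_integral) auto
qed

lemma B_nonneg: "0 \<le> B" using g_bounded[of undefined] by linarith

lemma gm [measurable]: "g \<in> borel_measurable borel" using g_measurable by simp

text \<open>\<open>score n\<close> is the difference quotient of the densities at the local parameter \<open>1 / \<surd>n\<close>.\<close>

definition score :: "nat \<Rightarrow> 'o \<Rightarrow> real" where "score n ob = sqrt (real n) * (pn n ob - 1)"

lemma score_measurable [measurable]: "score n \<in> borel_measurable borel"
  unfolding score_def[abs_def] by measurable

lemma score_close:
  assumes e: "0 < e"
  shows "\<exists>N>0. \<forall>n\<ge>N. AE ob in P. \<bar>score n ob - g ob\<bar> \<le> e"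
proof -
  obtain d where d: "0 < d" "\<forall>t\<in>{0..1}. 0 < t \<and> t < d \<longrightarrow> (AE ob in P. \<bar>(p t ob - 1) / t - g ob\<bar> \<le> e)"
    using p_derivative[OF e] by blast
  have "(\<lambda>n. 1 / sqrt (real n)) \<longlonglongrightarrow> 0"
    using inverse_root_limit by (simp add: inverse_eq_divide)
  from order_tendstoD(2)[OF this d(1)] obtain N where N: "\<And>n. N \<le> n \<Longrightarrow> 1 / sqrt (real n) < d"
    by (auto simp: eventually_sequentially)
  have "AE ob in P. \<bar>score n ob - g ob\<bar> \<le> e" if "max N 1 \<le> n" for n
  proof -
    have n: "0 < n" "N \<le> n" using that by auto
    then have "AE ob in P. \<bar>(p (1 / sqrt (real n)) ob - 1) / (1 / sqrt (real n)) - g ob\<bar> \<le> e"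
      using d(2)[rule_format, OF root_in_unit[of n]] N[of n] by simp
    then show ?thesis by (simp add: score_def pn_def mult.commute)
  qed
  then show ?thesis by (intro exI[of _ "max N 1"]) auto
qed

lemma score_bounded: "\<exists>N>0. \<forall>n\<ge>N. AE ob in P. \<bar>score n ob\<bar> \<le> B + 1"
proof -
  obtain N where N: "0 < N" "\<forall>n\<ge>N. AE ob in P. \<bar>score n ob - g ob\<bar> \<le> 1"
    using score_close[of 1] by auto
  have "AE ob in P. \<bar>score n ob\<bar> \<le> B + 1" if "N \<le> n" for n
    using N(2)[rule_format, OF that]
  proof eventually_elim
    case (elim ob)
    then show ?case using g_bounded[of ob] by linarith
  qed
  then show ?thesis using N(1) by blast
qed

lemma score_limit: "AE ob in P. (\<lambda>n. score n ob) \<longlonglongrightarrow> g ob"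
proof -
  have "\<exists>N. \<forall>n\<ge>N. AE ob in P. \<bar>score n ob - g ob\<bar> \<le> inverse (real (Suc k))" for k
    using score_close[of "inverse (real (Suc k))"] by auto
  then obtain N where N: "\<And>k n. N k \<le> n \<Longrightarrow> AE ob in P. \<bar>score n ob - g ob\<bar> \<le> inverse (real (Suc k))" by metis
  have "AE ob in P. \<forall>k n. N k \<le> n \<longrightarrow> \<bar>score n ob - g ob\<bar> \<le> inverse (real (Suc k))"
    unfolding AE_all_countable using N by auto
  then show ?thesis
  proof eventually_elim
    case (elim ob)
    show ?case
    proof (rule LIMSEQ_I)
      fix r :: real assume "0 < r"
      then obtain k where "inverse (real (Suc k)) < r" using reals_Archimedean by blast
      then show "\<exists>no. \<forall>n\<ge>no. norm (score n ob - g ob) < r"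
        using elim by (intro exI[of _ "N k"]) force
    qed
  qed
qed

lemma score_integral_limit:
  assumes f: "integrable P f"
  shows "(\<lambda>n. \<integral>ob. score n ob * f ob \<partial>P) \<longlonglongrightarrow> (\<integral>ob. g ob * f ob \<partial>P)"
proof -
  obtain N where N: "0 < N" "\<forall>n\<ge>N. AE ob in P. \<bar>score n ob\<bar> \<le> B + 1" using score_bounded by blast
  have [measurable]: "f \<in> borel_measurable borel" using f by auto
  have "(\<lambda>n. \<integral>ob. score (n + N) ob * f ob \<partial>P) \<longlonglongrightarrow> (\<integral>ob. g ob * f ob \<partial>P)"
  proof (rule integral_dominated_convergence[where w="\<lambda>ob. (B + 1) * \<bar>f ob\<bar>"])
    show "integrable P (\<lambda>ob. (B + 1) * \<bar>f ob\<bar>)" using f by simp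
    show "AE ob in P. (\<lambda>n. score (n + N) ob * f ob) \<longlonglongrightarrow> g ob * f ob"
      using score_limit by eventually_elim (intro tendsto_mult tendsto_const LIMSEQ_ignore_initial_segment)
    show "AE ob in P. norm (score (n + N) ob * f ob) \<le> (B + 1) * \<bar>f ob\<bar>" for n
      using N(2)[rule_format, of "n + N"] by (auto elim!: eventually_mono simp: abs_mult mult_right_mono)
  qed measurable
  then show ?thesis by (rule LIMSEQ_offset)
qed

definition lik :: "nat \<Rightarrow> 'w \<Rightarrow> real" where "lik n \<omega> = (\<Prod>i<n. pn n (Obs i \<omega>))"

text \<open>The probability space on which the first \<open>n\<close> observations follow the local alternative.\<close>

definition alt :: "nat \<Rightarrow> 'w measure" where "alt n = density M (\<lambda>\<omega>. \<Prod>i<n. ennreal (pn n (Obs i \<omega>)))"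

lemma lik_measurable [measurable]: "lik n \<in> borel_measurable M"
  unfolding lik_def[abs_def] by measurable

lemma lik_nonneg: "0 \<le> lik n \<omega>" by (simp add: lik_def prod_nonneg)

lemma alt_eq: "alt n = density M (\<lambda>\<omega>. ennreal (lik n \<omega>))"
  by (simp add: alt_def lik_def prod_ennreal)

lemma space_alt [simp]: "space (alt n) = space M" and sets_alt [simp, measurable_cong]: "sets (alt n) = sets M"
  by (simp_all add: alt_def)

lemma nn_integral_Obs: "f \<in> borel_measurable borel \<Longrightarrow> (\<integral>\<^sup>+\<omega>. f (Obs i \<omega>) \<partial>M) = (\<integral>\<^sup>+ob. f ob \<partial>P)"
  using nn_integral_distr[of "Obs i" M borel f] by (simp add: law)

lemma nn_integral_prod_Obs:
  fixes f :: "'o \<Rightarrow> ennreal"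
  assumes [measurable]: "f \<in> borel_measurable borel"
  shows "(\<integral>\<^sup>+\<omega>. (\<Prod>i<n. f (Obs i \<omega>)) \<partial>M) = (\<integral>\<^sup>+ob. f ob \<partial>P) ^ n"
proof -
  have "(\<integral>\<^sup>+\<omega>. (\<Prod>i<n. f (Obs i \<omega>)) \<partial>M) = (\<Prod>i<n. \<integral>\<^sup>+\<omega>. f (Obs i \<omega>) \<partial>M)"
    by (rule indep_vars_nn_integral[OF _ indep_vars_subset[OF indep_Obs]]) auto
  then show ?thesis by (simp add: nn_integral_Obs)
qed

lemma prob_space_alt: "prob_space (alt n)"
proof (rule prob_spaceI)
  have "(\<integral>\<^sup>+\<omega>. (\<Prod>i<n. ennreal (pn n (Obs i \<omega>))) \<partial>M) = 1"
    by (subst nn_integral_prod_Obs) (auto simp: pn_total)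
  then show "emeasure (alt n) (space (alt n)) = 1"
    unfolding alt_def by (subst emeasure_density) (auto cong: nn_integral_cong)
qed

sublocale alt: prob_space "alt n" for n by (rule prob_space_alt)

text \<open>Contiguity.  The second moment of the likelihood ratio \<open>l\<close> is at most \<open>(1 + (B + 1)\<^sup>2 / n)\<^sup>n \<le> exp ((B + 1)\<^sup>2)\<close>,
  and \<open>l \<le> c + l\<^sup>2 / c\<close> for every \<open>c > 0\<close>.\<close>

lemma alt_small:
  assumes A: "\<And>n. A n \<in> sets M" and lim: "(\<lambda>n. prob (A n)) \<longlonglongrightarrow> 0"
  shows "(\<lambda>n. alt.prob n (A n)) \<longlonglongrightarrow> 0"
proof (rule LIMSEQ_I)
  fix e :: real assume e: "0 < e"
  obtain N where N: "0 < N" "\<forall>n\<ge>N. AE ob in P. \<bar>score n ob\<bar> \<le> B + 1" using score_bounded by blast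
  define K where "K = exp ((B + 1)\<^sup>2)"
  have K: "0 < K" by (simp add: K_def)
  have second: "(\<integral>\<^sup>+\<omega>. ennreal ((lik n \<omega>)\<^sup>2) \<partial>M) \<le> ennreal K" if n: "N \<le> n" for n
  proof -
    have n0: "0 < n" using N(1) n by simp
    have "AE ob in P. (pn n ob)\<^sup>2 \<le> (B + 1)\<^sup>2 / real n + (2 * pn n ob - 1)"
      using N(2)[rule_format, OF n]
    proof eventually_elim
      case (elim ob)
      have "(score n ob)\<^sup>2 \<le> (B + 1)\<^sup>2" using power_mono[OF elim, of 2] by simp
      then have "real n * (pn n ob - 1)\<^sup>2 \<le> (B + 1)\<^sup>2" by (simp add: score_def power_mult_distrib)
      then have "(pn n ob - 1)\<^sup>2 \<le> (B + 1)\<^sup>2 / real n" using n0 by (simp add: pos_le_divide_eq mult.commute)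
      then show ?case by (simp add: power2_diff)
    qed
    then have "(\<integral>\<^sup>+ob. ennreal ((pn n ob)\<^sup>2) \<partial>P) \<le> (\<integral>\<^sup>+ob. ennreal ((B + 1)\<^sup>2 / real n + (2 * pn n ob - 1)) \<partial>P)"
      by (intro nn_integral_mono_AE) (auto elim!: eventually_mono intro!: ennreal_leI)
    also have "\<dots> = ennreal (\<integral>ob. (B + 1)\<^sup>2 / real n + (2 * pn n ob - 1) \<partial>P)"
    proof (rule nn_integral_eq_integral)
      show "integrable P (\<lambda>ob. (B + 1)\<^sup>2 / real n + (2 * pn n ob - 1))" using pn_integrable by simp
      show "AE ob in P. 0 \<le> (B + 1)\<^sup>2 / real n + (2 * pn n ob - 1)"
        using \<open>AE ob in P. (pn n ob)\<^sup>2 \<le> _ ob\<close> by eventually_elim (auto intro: order_trans[OF zero_le_power2])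
    qed
    also have "(\<integral>ob. (B + 1)\<^sup>2 / real n + (2 * pn n ob - 1) \<partial>P) = 1 + (B + 1)\<^sup>2 / real n"
      using pn_integrable pn_integral P.prob_space by simp
    finally have le: "(\<integral>\<^sup>+ob. ennreal ((pn n ob)\<^sup>2) \<partial>P) \<le> ennreal (1 + (B + 1)\<^sup>2 / real n)" .
    have "(\<integral>\<^sup>+\<omega>. ennreal ((lik n \<omega>)\<^sup>2) \<partial>M) = (\<integral>\<^sup>+\<omega>. (\<Prod>i<n. ennreal ((pn n (Obs i \<omega>))\<^sup>2)) \<partial>M)"
      by (simp add: lik_def prod_power_distrib prod_ennreal)
    also have "\<dots> = (\<integral>\<^sup>+ob. ennreal ((pn n ob)\<^sup>2) \<partial>P) ^ n"
      by (rule nn_integral_prod_Obs) measurable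
    also have "\<dots> \<le> ennreal (1 + (B + 1)\<^sup>2 / real n) ^ n" by (rule power_mono[OF le]) simp
    also have "\<dots> = ennreal ((1 + (B + 1)\<^sup>2 / real n) ^ n)" by (rule ennreal_power) simp
    also have "\<dots> \<le> ennreal K"
      unfolding K_def by (intro ennreal_leI exp_ge_one_plus_x_over_n_power_n) (use n0 in \<open>auto intro: order_trans[of _ 0]\<close>)
    finally show ?thesis .
  qed
  have bound: "alt.prob n (A n) \<le> c * prob (A n) + K / c" if n: "N \<le> n" and c: "0 < c" for n c
  proof -
    have "ennreal (alt.prob n (A n)) = emeasure (alt n) (A n)"
      by (simp add: alt.emeasure_eq_measure)
    also have "\<dots> = (\<integral>\<^sup>+\<omega>. ennreal (lik n \<omega>) * indicator (A n) \<omega> \<partial>M)"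
      unfolding alt_eq using A[of n] by (subst emeasure_density) auto
    also have "\<dots> \<le> (\<integral>\<^sup>+\<omega>. ennreal c * indicator (A n) \<omega> + ennreal (1 / c) * ennreal ((lik n \<omega>)\<^sup>2) \<partial>M)"
    proof (rule nn_integral_mono)
      fix \<omega>
      have "lik n \<omega> \<le> c + 1 / c * (lik n \<omega>)\<^sup>2"
      proof (cases "lik n \<omega> \<le> c")
        case False
        then have "lik n \<omega> * c \<le> lik n \<omega> * lik n \<omega>" using lik_nonneg by (intro mult_left_mono) auto
        then have "lik n \<omega> \<le> 1 / c * (lik n \<omega>)\<^sup>2" using c by (simp add: field_simps power2_eq_square)
        then show ?thesis using c by simp
      qed (use c in \<open>simp add: add_increasing2\<close>)
      then have "ennreal (lik n \<omega>) \<le> ennreal (c + 1 / c * (lik n \<omega>)\<^sup>2)" by (rule ennreal_leI)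
      also have "\<dots> = ennreal c + ennreal (1 / c * (lik n \<omega>)\<^sup>2)" using c by (intro ennreal_plus) auto
      also have "ennreal (1 / c * (lik n \<omega>)\<^sup>2) = ennreal (1 / c) * ennreal ((lik n \<omega>)\<^sup>2)"
        using c by (intro ennreal_mult) auto
      finally have "ennreal (lik n \<omega>) \<le> ennreal c + ennreal (1 / c) * ennreal ((lik n \<omega>)\<^sup>2)" .
      then show "ennreal (lik n \<omega>) * indicator (A n) \<omega> \<le> ennreal c * indicator (A n) \<omega> + ennreal (1 / c) * ennreal ((lik n \<omega>)\<^sup>2)"
        by (auto simp: indicator_def)
    qed
    also have "\<dots> = ennreal c * ennreal (prob (A n)) + ennreal (1 / c) * (\<integral>\<^sup>+\<omega>. ennreal ((lik n \<omega>)\<^sup>2) \<partial>M)"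
      using A by (subst nn_integral_add) (auto simp: nn_integral_cmult nn_integral_cmult_indicator emeasure_eq_measure)
    also have "\<dots> \<le> ennreal c * ennreal (prob (A n)) + ennreal (1 / c) * ennreal K"
      by (intro add_left_mono mult_left_mono second[OF n]) simp
    also have "\<dots> = ennreal (c * prob (A n) + K / c)"
      using c K by (simp add: ennreal_mult[symmetric])
    finally show ?thesis
      using c K by (subst (asm) ennreal_le_iff) auto
  qed
  define c where "c = 2 * K / e"
  have c: "0 < c" "K / c = e / 2" using K e by (auto simp: c_def)
  have "(\<lambda>n. c * prob (A n)) \<longlonglongrightarrow> 0" by (rule tendsto_mult_right_zero[OF lim])
  then have "\<forall>\<^sub>F n in sequentially. c * prob (A n) < e / 2"
    using e by (intro order_tendstoD(2)) auto
  then have "\<forall>\<^sub>F n in sequentially. norm (alt.prob n (A n) - 0) < e"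
    using eventually_ge_at_top[of N]
  proof eventually_elim
    case (elim n)
    then show ?case using bound[OF elim(2) c(1)] c(2) by simp
  qed
  then show "\<exists>no. \<forall>n\<ge>no. norm (alt.prob n (A n) - 0) < e" by (simp add: eventually_sequentially)
qed

end

section \<open>Limit laws under local alternatives\<close>

lemma (in iid_sample) integral_prod_Obs:
  fixes f :: "'o \<Rightarrow> complex"
  assumes m: "f \<in> borel_measurable borel" and f: "integrable P f"
  shows "(\<integral>\<omega>. (\<Prod>i<n. f (Obs i \<omega>)) \<partial>M) = (\<integral>ob. f ob \<partial>P) ^ n"
proof -
  have i: "integrable M (\<lambda>\<omega>. f (Obs i \<omega>))" "(\<integral>\<omega>. f (Obs i \<omega>) \<partial>M) = (\<integral>ob. f ob \<partial>P)" for i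
    using integrable_distr[of "Obs i" M borel f] integral_distr[of "Obs i" M borel f] m f by (simp_all add: law)
  have "(\<integral>\<omega>. (\<Prod>i<n. f (Obs i \<omega>)) \<partial>M) = (\<Prod>i<n. \<integral>\<omega>. f (Obs i \<omega>) \<partial>M)"
    by (rule indep_vars_lebesgue_integral[OF _ indep_vars_subset[OF indep_Obs[OF m]]]) (simp_all add: i(1))
  then show ?thesis by (simp add: i)
qed

lemma borel_measurable_iexp:
  assumes f: "f \<in> borel_measurable N" shows "(\<lambda>x. iexp (f x)) \<in> borel_measurable N"
  by (rule measurable_compose[OF f]) (intro borel_measurable_continuous_onI continuous_intros)

lemma borel_measurable_complex_of_real:
  assumes f: "f \<in> borel_measurable N" shows "(\<lambda>x. complex_of_real (f x)) \<in> borel_measurable N"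
  by (rule measurable_compose[OF f]) (intro borel_measurable_continuous_onI continuous_intros)

lemma norm_iexp_minus_one_le: "norm (iexp x - 1) \<le> \<bar>x\<bar>"
  using iexp_approx1[of x 0] by simp

locale tilted_sum = local_alternative M Obs P p g B
  for M :: "'w measure" and Obs :: "nat \<Rightarrow> 'w \<Rightarrow> 'o::topological_space" and P p g B +
  fixes \<phi> :: "'o \<Rightarrow> real"
  assumes \<phi>_measurable [measurable]: "\<phi> \<in> borel_measurable borel"
    and \<phi>_square: "integrable P (\<lambda>ob. (\<phi> ob)\<^sup>2)"
    and \<phi>_mean: "(\<integral>ob. \<phi> ob \<partial>P) = 0"
begin

lemma \<phi>_integrable: "integrable P \<phi>"
  by (rule P.square_integrable_imp_integrable[OF _ \<phi>_square]) simp

definition v :: real where "v = (\<integral>ob. (\<phi> ob)\<^sup>2 \<partial>P)"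
definition drift :: real where "drift = (\<integral>ob. g ob * \<phi> ob \<partial>P)"

text \<open>The characteristic function of \<open>\<phi> / \<surd>n\<close> under the alternative, at a single observation.\<close>

definition char1 :: "real \<Rightarrow> nat \<Rightarrow> complex" where
  "char1 u n = (\<integral>ob. of_real (pn n ob) * iexp (u * \<phi> ob / sqrt (real n)) \<partial>P)"

lemma pn_iexp_measurable:
  assumes "f \<in> borel_measurable borel"
  shows "(\<lambda>ob. of_real (pn n ob) * iexp (f ob)) \<in> borel_measurable borel"
  by (intro borel_measurable_times borel_measurable_complex_of_real pn_measurable borel_measurable_iexp assms)

lemma pn_iexp_integrable:
  assumes f: "f \<in> borel_measurable borel"
  shows "integrable P (\<lambda>ob. of_real (pn n ob) * iexp (f ob))"
proof (rule Bochner_Integration.integrable_bound[OF pn_integrable[of n]])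
  show "(\<lambda>ob. of_real (pn n ob) * iexp (f ob)) \<in> borel_measurable P"
    using pn_iexp_measurable[OF f] by simp
  show "AE ob in P. norm (of_real (pn n ob) * iexp (f ob)) \<le> norm (pn n ob)"
    by (simp add: norm_mult)
qed

lemma norm_char1_le: "norm (char1 u n) \<le> 1"
proof -
  have "norm (char1 u n) \<le> (\<integral>ob. norm (of_real (pn n ob) * iexp (u * \<phi> ob / sqrt (real n))) \<partial>P)"
    unfolding char1_def by (rule integral_norm_bound)
  also have "\<dots> = 1"
    by (simp only: norm_mult norm_exp_i_times mult_1_right norm_of_real abs_of_nonneg[OF pn_nonneg] pn_integral)
  finally show ?thesis .
qed

text \<open>With \<open>x = u \<phi> / \<surd>n\<close> and density \<open>p\<close>, the integrand \<open>n (p e\<^sup>i\<^sup>x - 1)\<close> is \<open>n (e\<^sup>i\<^sup>x - 1 - i x)\<close>, plus the score times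
  \<open>\<surd>n (e\<^sup>i\<^sup>x - 1)\<close>, plus terms of mean zero.  The first two converge pointwise to \<open>- u\<^sup>2 \<phi>\<^sup>2 / 2\<close> and \<open>i u g \<phi>\<close>, dominated by
  \<open>u\<^sup>2 \<phi>\<^sup>2 / 2\<close> and \<open>(B + 1) \<bar>u \<phi>\<bar>\<close>.\<close>

lemma char1_limit: "(\<lambda>n. of_nat n * (char1 u n - 1)) \<longlonglongrightarrow> of_real (- (u\<^sup>2 * v / 2)) + \<i> * of_real (u * drift)"
proof -
  obtain N where N: "0 < N" "\<forall>n\<ge>N. AE ob in P. \<bar>score n ob\<bar> \<le> B + 1" using score_bounded by blast
  let ?a = "\<lambda>ob. u * \<phi> ob"
  let ?e = "\<lambda>n ob. iexp (?a ob / sqrt (real n))"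
  define F where "F n ob = of_nat n * (?e n ob - 1 - \<i> * of_real (?a ob / sqrt (real n)))
      + of_real (score n ob) * (of_real (sqrt (real n)) * (?e n ob - 1))" for n ob
  have em: "?e n \<in> borel_measurable P" for n by (intro borel_measurable_iexp) measurable
  have Fm: "F n \<in> borel_measurable P" for n
    unfolding F_def[abs_def]
    by (intro borel_measurable_add borel_measurable_times borel_measurable_diff borel_measurable_const borel_measurable_complex_of_real em) measurable
  define F0 where "F0 ob = of_real (- ((?a ob)\<^sup>2 / 2)) + of_real (g ob) * (\<i> * of_real (?a ob))" for ob
  have F0m: "F0 \<in> borel_measurable P" unfolding F0_def[abs_def] by measurable
  have ig: "integrable P (\<lambda>ob. g ob * \<phi> ob)"
  proof (rule Bochner_Integration.integrable_bound)
    show "integrable P (\<lambda>ob. B * \<phi> ob)" using \<phi>_integrable by simp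
    show "AE ob in P. norm (g ob * \<phi> ob) \<le> norm (B * \<phi> ob)"
      using g_bounded B_nonneg by (auto simp: abs_mult intro!: mult_right_mono)
  qed measurable
  have F_eq: "of_nat n * (of_real (pn n ob) * ?e n ob - 1)
      = F n ob + \<i> * of_real (sqrt (real n) * ?a ob) + of_real (sqrt (real n) * score n ob)" if n: "0 < n" for n ob
  proof -
    define q where "q = sqrt (real n)"
    have q: "0 < q" and nq: "real n = q * q" using n by (simp_all add: q_def)
    have cn: "(of_nat n :: complex) = of_real q * of_real q" using nq by (metis of_real_mult of_real_of_nat_eq)
    define E where "E = iexp (?a ob / q)"
    have "of_real q * of_real q * (of_real x * E - 1)
        = of_real q * of_real q * (E - 1 - \<i> * of_real (?a ob / q)) + of_real (q * (x - 1)) * (of_real q * (E - 1))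
          + \<i> * of_real (q * ?a ob) + of_real (q * (q * (x - 1)))" for x
      using q by (simp add: field_simps)
    then show ?thesis by (simp add: F_def score_def cn E_def flip: q_def)
  qed
  have pe: "integrable P (\<lambda>ob. of_real (pn n ob) * ?e n ob)" for n
    by (rule pn_iexp_integrable) measurable
  have isc: "integrable P (score n)" "(\<integral>ob. score n ob \<partial>P) = 0" for n
    unfolding score_def[abs_def] using pn_integrable[of n] pn_integral[of n] P.prob_space by simp_all
  have ia: "integrable P (\<lambda>ob. \<i> * complex_of_real (sqrt (real n) * ?a ob))" for n
    using \<phi>_integrable by simp
  have ib: "integrable P (\<lambda>ob. complex_of_real (sqrt (real n) * score n ob))" for n
    using isc(1) by simp
  have char_eq: "of_nat n * (char1 u n - 1) = (\<integral>ob. F n ob \<partial>P)" if n: "0 < n" for n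
  proof -
    have F: "F n ob = of_nat n * (of_real (pn n ob) * ?e n ob - 1) - \<i> * of_real (sqrt (real n) * ?a ob) - of_real (sqrt (real n) * score n ob)" for ob
      using F_eq[OF n, of ob] by simp
    have i1: "integrable P (\<lambda>ob. of_nat n * (of_real (pn n ob) * ?e n ob - 1))"
      using pe[of n] by simp
    have "(\<integral>ob. F n ob \<partial>P) = (\<integral>ob. of_nat n * (of_real (pn n ob) * ?e n ob - 1) \<partial>P)
        - (\<integral>ob. \<i> * of_real (sqrt (real n) * ?a ob) \<partial>P) - (\<integral>ob. of_real (sqrt (real n) * score n ob) \<partial>P)"
      unfolding F by (simp only: Bochner_Integration.integral_diff i1 ia ib Bochner_Integration.integrable_diff)
    also have "(\<integral>ob. \<i> * complex_of_real (sqrt (real n) * ?a ob) \<partial>P) = 0"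
    proof -
      have "(\<integral>ob. \<i> * complex_of_real (sqrt (real n) * ?a ob) \<partial>P) = \<i> * of_real (\<integral>ob. sqrt (real n) * ?a ob \<partial>P)"
        by (simp only: integral_mult_right_zero integral_complex_of_real)
      then show ?thesis by (simp add: \<phi>_mean)
    qed
    also have "(\<integral>ob. complex_of_real (sqrt (real n) * score n ob) \<partial>P) = 0"
      by (simp only: integral_complex_of_real) (simp add: isc(2))
    also have "(\<integral>ob. of_nat n * (of_real (pn n ob) * ?e n ob - 1) \<partial>P) = of_nat n * (char1 u n - 1)"
      using pe[of n] P.prob_space by (simp add: char1_def)
    finally show ?thesis by simp
  qed
  have lim: "(\<lambda>n. \<integral>ob. F (n + N) ob \<partial>P) \<longlonglongrightarrow> (\<integral>ob. F0 ob \<partial>P)"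
  proof (rule integral_dominated_convergence[where w="\<lambda>ob. (?a ob)\<^sup>2 / 2 + (B + 1) * \<bar>?a ob\<bar>"])
    show "integrable P (\<lambda>ob. (?a ob)\<^sup>2 / 2 + (B + 1) * \<bar>?a ob\<bar>)"
      using \<phi>_square \<phi>_integrable by (simp add: power_mult_distrib)
    show "AE ob in P. (\<lambda>n. F (n + N) ob) \<longlonglongrightarrow> F0 ob"
      using score_limit
    proof eventually_elim
      case (elim ob)
      have "(\<lambda>n. F n ob) \<longlonglongrightarrow> F0 ob"
        unfolding F_def F0_def
        by (intro tendsto_add tendsto_mult n_iexp_limit root_n_iexp_limit tendsto_of_real elim)
      then show ?case by (rule LIMSEQ_ignore_initial_segment)
    qed
    show "AE ob in P. norm (F (n + N) ob) \<le> (?a ob)\<^sup>2 / 2 + (B + 1) * \<bar>?a ob\<bar>" for n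
      using N(2)[rule_format, of "n + N", OF le_add2]
    proof eventually_elim
      case (elim ob)
      define m where "m = n + N"
      have m: "0 < m" using N(1) by (simp add: m_def)
      define q where "q = sqrt (real m)"
      have q: "0 < q" and nq: "real m = q * q" using m by (simp_all add: q_def)
      define x where "x = ?a ob / q"
      have "norm (iexp x - 1 - \<i> * of_real x) \<le> x\<^sup>2 / 2"
        using iexp_approx1[of x 1] by (simp add: power2_eq_square diff_diff_eq)
      then have "real m * norm (iexp x - 1 - \<i> * of_real x) \<le> real m * (x\<^sup>2 / 2)"
        by (intro mult_left_mono) auto
      also have "real m * (x\<^sup>2 / 2) = (?a ob)\<^sup>2 / 2"
        using q by (simp add: x_def nq power_divide power2_eq_square)
      finally have 1: "norm (of_nat m * (iexp x - 1 - \<i> * of_real x)) \<le> (?a ob)\<^sup>2 / 2"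
        by (simp add: norm_mult)
      have "q * norm (iexp x - 1) \<le> q * \<bar>x\<bar>"
        using norm_iexp_minus_one_le q by (intro mult_left_mono) auto
      also have "q * \<bar>x\<bar> = \<bar>?a ob\<bar>" using q by (simp add: x_def)
      finally have 2: "norm (of_real q * (iexp x - 1)) \<le> \<bar>?a ob\<bar>" using q by (simp add: norm_mult)
      have 3: "norm (of_real (score m ob) * (of_real q * (iexp x - 1))) \<le> (B + 1) * \<bar>?a ob\<bar>"
        unfolding norm_mult[of "of_real (score m ob)"] using elim 2 B_nonneg by (intro mult_mono) (auto simp: m_def)
      show ?case
        using norm_triangle_mono[OF 1 3] by (simp add: F_def x_def q_def flip: m_def)
    qed
  qed (use Fm F0m in auto)
  have F0: "(\<integral>ob. F0 ob \<partial>P) = of_real (- (u\<^sup>2 * v / 2)) + \<i> * of_real (u * drift)"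
  proof -
    define \<alpha> where "\<alpha> ob = - (u\<^sup>2 * (\<phi> ob)\<^sup>2 / 2)" for ob
    define \<gamma> where "\<gamma> ob = u * (g ob * \<phi> ob)" for ob
    have "integrable P \<alpha>" "integrable P \<gamma>"
      unfolding \<alpha>_def[abs_def] \<gamma>_def[abs_def] using \<phi>_square ig by simp_all
    then have "(\<integral>ob. complex_of_real (\<alpha> ob) + \<i> * of_real (\<gamma> ob) \<partial>P)
       = (\<integral>ob. complex_of_real (\<alpha> ob) \<partial>P) + (\<integral>ob. \<i> * of_real (\<gamma> ob) \<partial>P)"
      by (intro Bochner_Integration.integral_add) simp_all
    also have "\<dots> = of_real (\<integral>ob. \<alpha> ob \<partial>P) + \<i> * of_real (\<integral>ob. \<gamma> ob \<partial>P)"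
      by (simp only: integral_mult_right_zero integral_complex_of_real)
    also have "(\<integral>ob. \<alpha> ob \<partial>P) = - (u\<^sup>2 * v / 2)" by (simp add: \<alpha>_def v_def)
    also have "(\<integral>ob. \<gamma> ob \<partial>P) = u * drift" by (simp add: \<gamma>_def drift_def)
    finally show ?thesis
      by (simp add: F0_def \<alpha>_def \<gamma>_def power_mult_distrib mult_ac)
  qed
  have "(\<lambda>n. \<integral>ob. F n ob \<partial>P) \<longlonglongrightarrow> of_real (- (u\<^sup>2 * v / 2)) + \<i> * of_real (u * drift)"
    using LIMSEQ_offset[OF lim] unfolding F0 .
  moreover have "\<forall>\<^sub>F n in sequentially. (\<integral>ob. F n ob \<partial>P) = of_nat n * (char1 u n - 1)"
    using eventually_gt_at_top[of 0] by eventually_elim (simp add: char_eq)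
  ultimately show ?thesis by (rule Lim_transform_eventually)
qed

definition Sn :: "nat \<Rightarrow> 'w \<Rightarrow> real" where "Sn n \<omega> = (\<Sum>i<n. \<phi> (Obs i \<omega>)) / sqrt (real n)"

lemma Sn_measurable [measurable]: "Sn n \<in> borel_measurable M"
  unfolding Sn_def[abs_def] by measurable

lemma char_Sn: "(\<integral>\<omega>. iexp (u * Sn n \<omega>) \<partial>alt n) = char1 u n ^ n"
proof -
  have m: "(\<lambda>\<omega>. iexp (u * Sn n \<omega>)) \<in> borel_measurable M" by (intro borel_measurable_iexp) measurable
  have "(\<integral>\<omega>. iexp (u * Sn n \<omega>) \<partial>alt n) = (\<integral>\<omega>. lik n \<omega> *\<^sub>R iexp (u * Sn n \<omega>) \<partial>M)"
    unfolding alt_eq by (rule integral_density[OF m lik_measurable]) (simp add: lik_nonneg)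
  also have "(\<lambda>\<omega>. lik n \<omega> *\<^sub>R iexp (u * Sn n \<omega>))
      = (\<lambda>\<omega>. \<Prod>i<n. of_real (pn n (Obs i \<omega>)) * iexp (u * \<phi> (Obs i \<omega>) / sqrt (real n)))"
  proof
    fix \<omega>
    have "iexp (u * Sn n \<omega>) = (\<Prod>i<n. iexp (u * \<phi> (Obs i \<omega>) / sqrt (real n)))"
      by (simp add: Sn_def sum_distrib_left sum_divide_distrib exp_sum)
    then show "lik n \<omega> *\<^sub>R iexp (u * Sn n \<omega>) = (\<Prod>i<n. of_real (pn n (Obs i \<omega>)) * iexp (u * \<phi> (Obs i \<omega>) / sqrt (real n)))"
      by (simp add: scaleR_conv_of_real lik_def prod.distrib)
  qed
  also have "(\<integral>\<omega>. (\<Prod>i<n. of_real (pn n (Obs i \<omega>)) * iexp (u * \<phi> (Obs i \<omega>) / sqrt (real n))) \<partial>M) = char1 u n ^ n"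
    unfolding char1_def
    by (rule integral_prod_Obs[of "\<lambda>ob. of_real (pn n ob) * iexp (u * \<phi> ob / sqrt (real n))"])
      (intro pn_iexp_measurable pn_iexp_integrable; measurable)+
  finally show ?thesis .
qed

lemma v_nonneg: "0 \<le> v" by (simp add: v_def)

lemma char_Sn_limit: "(\<lambda>n. \<integral>\<omega>. iexp (u * Sn n \<omega>) \<partial>alt n) \<longlonglongrightarrow> exp (of_real (- (u\<^sup>2 * v / 2)) + \<i> * of_real (u * drift))"
  unfolding char_Sn by (rule power_tendsto_exp[OF norm_char1_le char1_limit]) (simp add: v_nonneg)

end

lemma real_distribution_normal_law: "real_distribution (normal_law x)"
proof -
  interpret real_distribution std_normal_distribution by (rule real_dist_normal_dist)
  show ?thesis unfolding normal_law_def by (rule real_distribution_distr) simp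
qed

lemma char_normal_law: "0 \<le> x \<Longrightarrow> char (normal_law x) u = exp (of_real (- (u\<^sup>2 * x / 2)))"
proof -
  assume x: "0 \<le> x"
  have "char (normal_law x) u = char std_normal_distribution (u * sqrt x)"
    unfolding char_def normal_law_def
    by (subst integral_distr) (auto simp: mult_ac intro: borel_measurable_iexp)
  moreover have "(complex_of_real (sqrt x))\<^sup>2 = of_real x"
    using x by (simp flip: of_real_power)
  ultimately show ?thesis
    by (simp add: char_std_normal_distribution power_mult_distrib flip: exp_of_real)
qed

context tilted_sum
begin

text \<open>The statistic is \<open>Sn\<close> minus the shift of the parameter, up to a remainder that contiguity makes negligible.  The
  shift cancels the mean that \<open>Sn\<close> acquires under the alternative, so the limit does not depend on the submodel.\<close>

theorem weak_limit_under_alternative: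
  fixes T :: "nat \<Rightarrow> 'w \<Rightarrow> real" and \<theta> :: real and \<theta>' :: "nat \<Rightarrow> real"
  assumes T [measurable]: "\<And>n. T n \<in> borel_measurable M"
    and linear: "small_oP M (\<lambda>n \<omega>. ennreal \<bar>T n \<omega> - \<theta> - (\<Sum>i<n. \<phi> (Obs i \<omega>)) / real n\<bar>) (\<lambda>n. real n powr (-1/2))"
    and path: "(\<lambda>n. sqrt (real n) * (\<theta>' n - \<theta>)) \<longlonglongrightarrow> drift"
  shows "weak_conv_m (\<lambda>n. distr (alt n) borel (\<lambda>\<omega>. sqrt (real n) * (T n \<omega> - \<theta>' n))) (normal_law v)"
proof (rule levy_continuity)
  have U: "(\<lambda>\<omega>. sqrt (real n) * (T n \<omega> - \<theta>' n)) \<in> borel_measurable (alt n)" for n by measurable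
  show "real_distribution (distr (alt n) borel (\<lambda>\<omega>. sqrt (real n) * (T n \<omega> - \<theta>' n)))" for n
    by (rule alt.real_distribution_distr[OF U])
  show "real_distribution (normal_law v)" by (rule real_distribution_normal_law)
  fix u :: real
  define R where "R n \<omega> = sqrt (real n) * (T n \<omega> - \<theta> - (\<Sum>i<n. \<phi> (Obs i \<omega>)) / real n)" for n \<omega>
  have Rm [measurable]: "R n \<in> borel_measurable M" for n unfolding R_def[abs_def] by measurable
  define d where "d n = sqrt (real n) * (\<theta>' n - \<theta>)" for n
  have R_small: "(\<lambda>n. alt.prob n {\<omega>\<in>space M. \<delta> < \<bar>R n \<omega>\<bar>}) \<longlonglongrightarrow> 0" if \<delta>: "0 < \<delta>" for \<delta>
  proof (rule alt_small)
    show "{\<omega>\<in>space M. \<delta> < \<bar>R n \<omega>\<bar>} \<in> events" for n by measurable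
    have "ennreal \<delta> < ennreal (sqrt (real n)) * ennreal \<bar>T n \<omega> - \<theta> - (\<Sum>i<n. \<phi> (Obs i \<omega>)) / real n\<bar> \<longleftrightarrow> \<delta> < \<bar>R n \<omega>\<bar>" for n \<omega>
      using \<delta> by (simp add: R_def abs_mult ennreal_mult[symmetric] ennreal_less_iff)
    then show "(\<lambda>n. prob {\<omega>\<in>space M. \<delta> < \<bar>R n \<omega>\<bar>}) \<longlonglongrightarrow> 0"
      using linear[unfolded small_oP_root_n small_oP_1_iff, rule_format, OF \<delta>] by simp
  qed
  define c0 where "c0 n = (\<integral>\<omega>. iexp (u * Sn n \<omega>) \<partial>alt n)" for n
  define c1 where "c1 n = char (distr (alt n) borel (\<lambda>\<omega>. sqrt (real n) * (T n \<omega> - \<theta>' n))) u" for n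
  have diff: "norm (c1 n - iexp (- (u * d n)) * c0 n) \<le> \<bar>u\<bar> * \<delta> + 2 * alt.prob n {\<omega>\<in>space M. \<delta> < \<bar>R n \<omega>\<bar>}"
    if n: "0 < n" and \<delta>: "0 < \<delta>" for n \<delta>
  proof -
    have split: "sqrt (real n) * (T n \<omega> - \<theta>' n) = Sn n \<omega> - d n + R n \<omega>" for \<omega>
    proof -
      have "q * (t - a) = x / q - q * (a - b) + q * (t - b - x / (q * q))" if "0 < q" for q t a b x :: real
        using that by (simp add: field_simps)
      from this[of "sqrt (real n)"] show ?thesis using n by (simp add: Sn_def d_def R_def)
    qed
    have em: "(\<lambda>\<omega>. iexp (f \<omega>)) \<in> borel_measurable (alt n)" if "f \<in> borel_measurable M" for f
      using that by (intro borel_measurable_iexp) simp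
    have ei: "integrable (alt n) (\<lambda>\<omega>. iexp (f \<omega>))" if "f \<in> borel_measurable M" for f
      by (rule alt.integrable_const_bound[where B=1]) (use em[OF that] in auto)
    let ?A = "{\<omega>\<in>space M. \<delta> < \<bar>R n \<omega>\<bar>}"
    have A: "?A \<in> sets (alt n)" by simp
    have f1: "(\<lambda>\<omega>. u * (Sn n \<omega> - d n + R n \<omega>)) \<in> borel_measurable M" and f2: "(\<lambda>\<omega>. u * (Sn n \<omega> - d n)) \<in> borel_measurable M"
      by measurable
    have "c1 n = (\<integral>\<omega>. iexp (u * (Sn n \<omega> - d n + R n \<omega>)) \<partial>alt n)"
      unfolding c1_def char_def
      by (subst integral_distr[OF U]) (intro borel_measurable_iexp, simp, simp only: split)
    moreover have "iexp (- (u * d n)) * c0 n = (\<integral>\<omega>. iexp (u * (Sn n \<omega> - d n)) \<partial>alt n)"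
    proof -
      have "iexp (u * (Sn n \<omega> - d n)) = iexp (- (u * d n)) * iexp (u * Sn n \<omega>)" for \<omega>
        by (simp add: exp_add[symmetric] algebra_simps)
      then show ?thesis unfolding c0_def by simp
    qed
    ultimately have "c1 n - iexp (- (u * d n)) * c0 n
        = (\<integral>\<omega>. iexp (u * (Sn n \<omega> - d n + R n \<omega>)) - iexp (u * (Sn n \<omega> - d n)) \<partial>alt n)"
      using ei[OF f1] ei[OF f2] by (simp only: Bochner_Integration.integral_diff)
    then have "norm (c1 n - iexp (- (u * d n)) * c0 n)
        \<le> (\<integral>\<omega>. norm (iexp (u * (Sn n \<omega> - d n + R n \<omega>)) - iexp (u * (Sn n \<omega> - d n))) \<partial>alt n)"
      by (simp only: integral_norm_bound)
    also have "\<dots> \<le> (\<integral>\<omega>. \<bar>u\<bar> * \<delta> + 2 * indicator ?A \<omega> \<partial>alt n)"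
    proof (rule integral_mono)
      show "integrable (alt n) (\<lambda>\<omega>. norm (iexp (u * (Sn n \<omega> - d n + R n \<omega>)) - iexp (u * (Sn n \<omega> - d n))))"
        using ei[OF f1] ei[OF f2] by (intro integrable_norm Bochner_Integration.integrable_diff)
      show "integrable (alt n) (\<lambda>\<omega>. \<bar>u\<bar> * \<delta> + 2 * indicator ?A \<omega>)"
        using A by (simp add: integrable_indicator_iff alt.emeasure_eq_measure)
      fix \<omega> assume \<omega>: "\<omega> \<in> space (alt n)"
      have "iexp (u * (Sn n \<omega> - d n + R n \<omega>)) - iexp (u * (Sn n \<omega> - d n)) = iexp (u * (Sn n \<omega> - d n)) * (iexp (u * R n \<omega>) - 1)"
        by (simp add: exp_add[symmetric] algebra_simps)
      then have eq: "norm (iexp (u * (Sn n \<omega> - d n + R n \<omega>)) - iexp (u * (Sn n \<omega> - d n))) = norm (iexp (u * R n \<omega>) - 1)"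
        by (simp only: norm_mult norm_exp_i_times mult_1_left)
      show "norm (iexp (u * (Sn n \<omega> - d n + R n \<omega>)) - iexp (u * (Sn n \<omega> - d n))) \<le> \<bar>u\<bar> * \<delta> + 2 * indicator ?A \<omega>"
        unfolding eq
      proof (cases "\<omega> \<in> ?A")
        case True
        have "norm (iexp (u * R n \<omega>) - 1) \<le> norm (iexp (u * R n \<omega>)) + norm (1::complex)"
          by (rule norm_triangle_ineq4)
        also have "\<dots> = 2" by (simp only: norm_exp_i_times norm_one one_add_one)
        finally show "norm (iexp (u * R n \<omega>) - 1) \<le> \<bar>u\<bar> * \<delta> + 2 * indicator ?A \<omega>"
          using True \<delta> by (simp add: add_increasing)
      next
        case False
        then have "\<bar>R n \<omega>\<bar> \<le> \<delta>" using \<omega> by auto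
        then have "\<bar>u * R n \<omega>\<bar> \<le> \<bar>u\<bar> * \<delta>" by (simp add: abs_mult mult_left_mono)
        then show "norm (iexp (u * R n \<omega>) - 1) \<le> \<bar>u\<bar> * \<delta> + 2 * indicator ?A \<omega>"
          using norm_iexp_minus_one_le[of "u * R n \<omega>"] False by simp
      qed
    qed
    also have "\<dots> = \<bar>u\<bar> * \<delta> + 2 * alt.prob n ?A"
    proof -
      have "integrable (alt n) (indicator ?A :: _ \<Rightarrow> real)"
        using A by (simp add: integrable_indicator_iff alt.emeasure_eq_measure)
      then show ?thesis using A alt.prob_space[of n] by simp
    qed
    finally show ?thesis .
  qed
  have "(\<lambda>n. c1 n - iexp (- (u * d n)) * c0 n) \<longlonglongrightarrow> 0"
  proof (rule LIMSEQ_I)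
    fix e :: real assume e: "0 < e"
    define \<delta> where "\<delta> = e / (2 * (\<bar>u\<bar> + 1))"
    have \<delta>: "0 < \<delta>" using e by (simp add: \<delta>_def)
    have "\<bar>u\<bar> * \<delta> < (\<bar>u\<bar> + 1) * \<delta>" using \<delta> by simp
    also have "\<dots> = e / 2"
    proof -
      have "w * (e / (2 * w)) = e / 2" if "0 < w" for w using that by simp
      from this[of "\<bar>u\<bar> + 1"] show ?thesis unfolding \<delta>_def by simp
    qed
    finally have u: "\<bar>u\<bar> * \<delta> < e / 2" .
    have "\<forall>\<^sub>F n in sequentially. alt.prob n {\<omega>\<in>space M. \<delta> < \<bar>R n \<omega>\<bar>} < e / 4"
      using e by (intro order_tendstoD(2)[OF R_small[OF \<delta>]]) simp
    then have "\<forall>\<^sub>F n in sequentially. norm (c1 n - iexp (- (u * d n)) * c0 n - 0) < e"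
      using eventually_gt_at_top[of 0]
    proof eventually_elim
      case (elim n)
      then show ?case using diff[OF elim(2) \<delta>] u by simp
    qed
    then show "\<exists>no. \<forall>n\<ge>no. norm (c1 n - iexp (- (u * d n)) * c0 n - 0) < e" by (simp add: eventually_sequentially)
  qed
  moreover have "(\<lambda>n. iexp (- (u * d n)) * c0 n)
      \<longlonglongrightarrow> iexp (- (u * drift)) * exp (of_real (- (u\<^sup>2 * v / 2)) + \<i> * of_real (u * drift))"
    unfolding c0_def
    by (intro tendsto_mult char_Sn_limit tendsto_exp tendsto_const tendsto_of_real tendsto_minus path[folded d_def])
  ultimately have "c1 \<longlonglongrightarrow> iexp (- (u * drift)) * exp (of_real (- (u\<^sup>2 * v / 2)) + \<i> * of_real (u * drift))"
    using tendsto_add by fastforce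
  also have "iexp (- (u * drift)) * exp (of_real (- (u\<^sup>2 * v / 2)) + \<i> * of_real (u * drift)) = char (normal_law v) u"
    unfolding char_normal_law[OF v_nonneg] exp_add[symmetric] by simp
  finally show "(\<lambda>n. char (distr (alt n) borel (\<lambda>\<omega>. sqrt (real n) * (T n \<omega> - \<theta>' n))) u) \<longlonglongrightarrow> char (normal_law v) u"
    unfolding c1_def .
qed

end

text \<open>The degenerate submodel gives the central limit theorem under \<open>M\<close> itself.\<close>

lemma smooth_submodel_const: "prob_space P \<Longrightarrow> smooth_submodel P (\<lambda>_ _. 1)"
  unfolding smooth_submodel_def
  by (auto simp: prob_space.emeasure_space_1 intro!: exI[of _ "\<lambda>_. 0"] exI[of _ "0::real"] exI[of _ "1::real"])

text \<open>An asymptotically linear estimator is regular if its influence curve is a gradient of the parameter along the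
  submodels.\<close>

theorem (in iid_sample) regular_and_normal:
  fixes Psi :: "'o measure \<Rightarrow> real" and T :: "nat \<Rightarrow> 'w \<Rightarrow> real"
  assumes \<phi>: "\<phi> \<in> borel_measurable borel" "integrable P (\<lambda>ob. (\<phi> ob)\<^sup>2)" "(\<integral>ob. \<phi> ob \<partial>P) = 0"
    and T: "\<And>n. T n \<in> borel_measurable M"
    and linear: "asymptotically_linear M Obs (Psi P) T \<phi>"
    and path: "\<And>p g B. local_alternative M Obs P p g B \<Longrightarrow>
      (\<lambda>n. sqrt (real n) * (Psi (density P (\<lambda>ob. ennreal (p (1 / sqrt (real n)) ob))) - Psi P)) \<longlonglongrightarrow> (\<integral>ob. g ob * \<phi> ob \<partial>P)"
  shows "RAL M Obs P Psi T \<phi>"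
    and "weak_conv_m (\<lambda>n. distr M borel (\<lambda>\<omega>. sqrt (real n) * (T n \<omega> - Psi P))) (normal_law (\<integral>ob. (\<phi> ob)\<^sup>2 \<partial>P))"
proof -
  let ?v = "\<integral>ob. (\<phi> ob)\<^sup>2 \<partial>P"
  have lim: "weak_conv_m
             (\<lambda>n. let p_n = p (1 / sqrt (real n)) in
                distr (density M (\<lambda>\<omega>. \<Prod>i<n. ennreal (p_n (Obs i \<omega>)))) borel
                  (\<lambda>\<omega>. sqrt (real n) * (T n \<omega> - Psi (density P (\<lambda>ob. ennreal (p_n ob))))))
             (normal_law ?v)" if p: "smooth_submodel P p" for p
  proof -
    obtain g B where "local_alternative M Obs P p g B"
      using smooth_submodel_imp_local_alternative[OF p] by blast
    then interpret L: local_alternative M Obs P p g B .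
    interpret L: tilted_sum M Obs P p g B \<phi> by unfold_locales (use \<phi> in auto)
    show ?thesis
      using L.weak_limit_under_alternative[OF T linear[unfolded asymptotically_linear_def], of "\<lambda>n. Psi (density P (\<lambda>ob. ennreal (p (1 / sqrt (real n)) ob)))"]
        path[OF L.local_alternative_axioms]
      by (simp add: Let_def L.v_def L.drift_def L.alt_def L.pn_def)
  qed
  show "RAL M Obs P Psi T \<phi>"
    unfolding RAL_def regular_estimator_def using lim real_distribution_normal_law linear by blast
  have "density M (\<lambda>\<omega>. 1) = M" "density P (\<lambda>ob. 1) = P" by (rule density_1)+
  then show "weak_conv_m (\<lambda>n. distr M borel (\<lambda>\<omega>. sqrt (real n) * (T n \<omega> - Psi P))) (normal_law ?v)"
    using lim[OF smooth_submodel_const[OF P.prob_space_axioms]] by (simp add: Let_def)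
qed

section \<open>Norms of estimation errors\<close>

lemma L2_norm_square:
  "L2_norm P h * L2_norm P h = (\<integral>\<^sup>+ob. ennreal ((h (covs ob))\<^sup>2) \<partial>P)"
proof -
  let ?I = "\<integral>\<^sup>+ob. ennreal ((h (covs ob))\<^sup>2) \<partial>P"
  show ?thesis
  proof (cases "?I = \<infinity>")
    case False
    then have "ennreal (sqrt (enn2real ?I)) * ennreal (sqrt (enn2real ?I)) = ?I"
      by (simp add: ennreal_mult[symmetric] less_top)
    then show ?thesis using False by (simp add: L2_norm_def Let_def)
  qed (simp add: L2_norm_def Let_def ennreal_top_mult)
qed

lemma ennreal_le_of_square_le:
  fixes x y :: ennreal assumes "x\<^sup>2 \<le> y\<^sup>2" shows "x \<le> y"
proof (rule ccontr)
  assume "\<not> x \<le> y"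
  then have yx: "y < x" by simp
  then have "y \<noteq> top" by auto
  then have "y * y < x * x"
  proof (cases "y = 0")
    case True then show ?thesis using yx by (simp add: ennreal_zero_less_mult_iff)
  next
    case False
    have "y * y < y * x"
      using yx False \<open>y \<noteq> top\<close> by (intro ennreal_mult_strict_left_mono) (auto simp: less_top zero_less_iff_neq_zero)
    also have "\<dots> \<le> x * x" using yx by (intro mult_right_mono) auto
    finally show ?thesis .
  qed
  then show False using assms by (simp add: power2_eq_square not_less[symmetric])
qed

lemma (in obs_law) L2_norm_Cauchy_Schwarz:
  assumes [measurable]: "h \<in> borel_measurable borel" "k \<in> borel_measurable borel"
  shows "(\<integral>\<^sup>+ob. ennreal \<bar>h (covs ob) * k (covs ob)\<bar> \<partial>P) \<le> L2_norm P h * L2_norm P k"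
proof (rule ennreal_le_of_square_le)
  have "(\<integral>\<^sup>+ob. ennreal \<bar>h (covs ob)\<bar> * ennreal \<bar>k (covs ob)\<bar> \<partial>P)\<^sup>2
      \<le> (\<integral>\<^sup>+ob. (ennreal \<bar>h (covs ob)\<bar>)\<^sup>2 \<partial>P) * (\<integral>\<^sup>+ob. (ennreal \<bar>k (covs ob)\<bar>)\<^sup>2 \<partial>P)"
    by (rule Cauchy_Schwarz_nn_integral) measurable
  then show "(\<integral>\<^sup>+ob. ennreal \<bar>h (covs ob) * k (covs ob)\<bar> \<partial>P)\<^sup>2 \<le> (L2_norm P h * L2_norm P k)\<^sup>2"
    by (simp add: abs_mult ennreal_mult ennreal_power power2_eq_square[of "L2_norm P h * L2_norm P k"] mult_ac
        L2_norm_square[symmetric])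
qed

lemma (in obs_law) est_err_measurable:
  assumes h: "(\<lambda>(\<omega>, x). h n \<omega> x) \<in> borel_measurable (N \<Otimes>\<^sub>M borel)" and [measurable]: "f \<in> borel_measurable borel"
  shows "est_err P h f n \<in> borel_measurable N"
proof -
  have [measurable]: "(\<lambda>(\<omega>, x). h n \<omega> x) \<in> borel_measurable (N \<Otimes>\<^sub>M borel)" by (rule h)
  have [measurable]: "(\<lambda>\<omega>. \<integral>\<^sup>+ob. ennreal ((f (covs ob) - h n \<omega> (covs ob))\<^sup>2) \<partial>P) \<in> borel_measurable N"
    by measurable
  show ?thesis
    unfolding est_err_def L2_norm_def Let_def by measurable
qed

lemma (in prob_space) small_oP_of_square:
  assumes W: "\<And>n. W n \<in> borel_measurable M" "small_oP M W (\<lambda>_. 1)"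
    and le: "\<And>n. AE \<omega> in M. (Z n \<omega>)\<^sup>2 \<le> W n \<omega>"
  shows "small_oP M Z (\<lambda>_. 1)"
  unfolding small_oP_1_iff
proof (intro allI impI)
  fix \<eta> :: real assume \<eta>: "0 < \<eta>"
  have [measurable]: "W n \<in> borel_measurable M" for n by (rule W)
  have lim: "(\<lambda>n. prob {\<omega>\<in>space M. ennreal (\<eta>\<^sup>2 / 2) < W n \<omega>}) \<longlonglongrightarrow> 0"
    using W(2) \<eta> by (simp add: small_oP_1_iff)
  show "(\<lambda>n. prob {\<omega>\<in>space M. ennreal \<eta> < Z n \<omega>}) \<longlonglongrightarrow> 0"
  proof (rule tendsto_sandwich[OF _ _ tendsto_const lim])
    show "\<forall>\<^sub>F n in sequentially. prob {\<omega>\<in>space M. ennreal \<eta> < Z n \<omega>} \<le> prob {\<omega>\<in>space M. ennreal (\<eta>\<^sup>2 / 2) < W n \<omega>}"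
    proof (rule always_eventually, rule allI, rule finite_measure_mono_AE)
      fix n
      show "AE \<omega> in M. \<omega> \<in> {\<omega>\<in>space M. ennreal \<eta> < Z n \<omega>} \<longrightarrow> \<omega> \<in> {\<omega>\<in>space M. ennreal (\<eta>\<^sup>2 / 2) < W n \<omega>}"
        using le[of n]
      proof eventually_elim
        case (elim \<omega>)
        have "ennreal (\<eta>\<^sup>2 / 2) < W n \<omega>" if "ennreal \<eta> < Z n \<omega>"
        proof -
          have "ennreal (\<eta>\<^sup>2 / 2) < ennreal (\<eta>\<^sup>2)" using \<eta> by (simp add: ennreal_less_iff)
          also have "\<dots> = (ennreal \<eta>)\<^sup>2" using \<eta> by (simp add: ennreal_power)
          also have "\<dots> \<le> (Z n \<omega>)\<^sup>2" using that by (intro power_mono) auto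
          also have "\<dots> \<le> W n \<omega>" by (rule elim)
          finally show ?thesis .
        qed
        then show ?case by auto
      qed
    qed measurable
  qed simp
qed

lemma (in iid_sample) emp_Obs_measurable:
  assumes d: "(\<lambda>(\<omega>, ob). d \<omega> ob) \<in> borel_measurable (M \<Otimes>\<^sub>M borel)"
  shows "(\<lambda>\<omega>. emp P n (d \<omega>) (\<lambda>i. Obs i \<omega>)) \<in> borel_measurable M"
proof -
  have "(\<lambda>\<omega>. (\<omega>, \<lambda>i\<in>{..<n}. Obs i \<omega>)) \<in> measurable M (M \<Otimes>\<^sub>M (\<Pi>\<^sub>M i\<in>{..<n}. borel))"
    by measurable
  from measurable_compose[OF this emp_random_measurable[OF d, of n]] show ?thesis by simp
qed

section \<open>The remainder of the estimator\<close>

text \<open>Here \<open>a\<close> and \<open>y\<close> are residuals, \<open>b'\<close> and \<open>l'\<close> are estimates of \<open>b\<close> and \<open>l' + l\<close>, and \<open>u\<close>, \<open>m\<close>, \<open>l\<close>, \<open>b - b'\<close> are the errors.  Every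
  summand on the left is a product of residuals times one error, hence its square is at most a multiple of a
  polynomial in the residuals times the sum of the squared errors.\<close>

lemma cross_terms_bound:
  fixes a y u m b b' l eps :: real
  assumes "0 < eps" "eps < b" "eps < b'"
  shows "(a * y * (1 / b' - 1 / b) + a * m / b' + u * y / b')\<^sup>2
    \<le> (3 / eps ^ 4 + 6 / eps\<^sup>2) * ((1 + a\<^sup>2 + y\<^sup>2 + (a * y)\<^sup>2 + (a\<^sup>2)\<^sup>2) * (l\<^sup>2 + u\<^sup>2 + m\<^sup>2 + (b - b')\<^sup>2))"
    (is "_ \<le> _ * (?W * ?v)")
  and "\<bar>l'\<bar> < K \<Longrightarrow> (a\<^sup>2 * (l' / b' - (l' + l) / b) + 2 * l' * a * u / b')\<^sup>2
    \<le> (3 / eps\<^sup>2 + 3 * K\<^sup>2 / eps ^ 4 + 12 * K\<^sup>2 / eps\<^sup>2) * ((1 + a\<^sup>2 + y\<^sup>2 + (a * y)\<^sup>2 + (a\<^sup>2)\<^sup>2) * (l\<^sup>2 + u\<^sup>2 + m\<^sup>2 + (b - b')\<^sup>2))"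
proof -
  have pos: "0 < b" "0 < b'" using assms by auto
  have sq3: "(p + q + r)\<^sup>2 \<le> 3 * p\<^sup>2 + 3 * q\<^sup>2 + 3 * r\<^sup>2" for p q r :: real
    using sum_squares_bound[of p q] sum_squares_bound[of q r] sum_squares_bound[of p r]
    by (simp add: power2_eq_square algebra_simps)
  have i2: "(1 / x)\<^sup>2 \<le> 1 / eps\<^sup>2" if "eps < x" for x
    using that assms(1) by (auto simp: power_divide intro!: divide_left_mono power_mono)
  have t: "1 / b' - 1 / b = (b - b') * (1 / b) * (1 / b')" using pos by (simp add: field_simps)
  have t2: "(1 / b' - 1 / b)\<^sup>2 \<le> (b - b')\<^sup>2 / eps ^ 4"
  proof -
    have "(1 / b)\<^sup>2 * (1 / b')\<^sup>2 \<le> 1 / eps\<^sup>2 * (1 / eps\<^sup>2)" using assms by (intro mult_mono i2) auto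
    then have "(b - b')\<^sup>2 * ((1 / b)\<^sup>2 * (1 / b')\<^sup>2) \<le> (b - b')\<^sup>2 * (1 / eps\<^sup>2 * (1 / eps\<^sup>2))"
      by (intro mult_left_mono) auto
    then show ?thesis unfolding t power_mult_distrib by (simp add: power4_eq_xxxx power2_eq_square mult.assoc)
  qed
  have W: "1 \<le> ?W" "a\<^sup>2 \<le> ?W" "y\<^sup>2 \<le> ?W" "(a * y)\<^sup>2 \<le> ?W" "(a\<^sup>2)\<^sup>2 \<le> ?W" "0 \<le> ?W"
    by (simp_all add: add_increasing add_increasing2)
  have v: "l\<^sup>2 \<le> ?v" "u\<^sup>2 \<le> ?v" "m\<^sup>2 \<le> ?v" "(b - b')\<^sup>2 \<le> ?v" "0 \<le> ?v"
    by (simp_all add: add_increasing add_increasing2)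
  have x1: "(a * y * (1 / b' - 1 / b))\<^sup>2 \<le> 1 / eps ^ 4 * (?W * ?v)"
  proof -
    have "(a * y)\<^sup>2 * (1 / b' - 1 / b)\<^sup>2 \<le> (a * y)\<^sup>2 * ((b - b')\<^sup>2 / eps ^ 4)" by (rule mult_left_mono[OF t2]) simp
    also have "\<dots> = 1 / eps ^ 4 * ((a * y)\<^sup>2 * (b - b')\<^sup>2)" by simp
    also have "\<dots> \<le> 1 / eps ^ 4 * (?W * ?v)" using W v by (intro mult_left_mono mult_mono) auto
    finally show ?thesis by (simp only: power_mult_distrib)
  qed
  have wv: "w\<^sup>2 * (z\<^sup>2 * (1 / b')\<^sup>2) \<le> 1 / eps\<^sup>2 * (?W * ?v)" if "w\<^sup>2 \<le> ?W" "z\<^sup>2 \<le> ?v" for w z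
  proof -
    have "w\<^sup>2 * (z\<^sup>2 * (1 / b')\<^sup>2) \<le> w\<^sup>2 * (z\<^sup>2 * (1 / eps\<^sup>2))" using i2[OF assms(3)] by (intro mult_left_mono) auto
    also have "\<dots> = 1 / eps\<^sup>2 * (w\<^sup>2 * z\<^sup>2)" by simp
    also have "\<dots> \<le> 1 / eps\<^sup>2 * (?W * ?v)" using W v that by (intro mult_left_mono mult_mono) auto
    finally show ?thesis .
  qed
  have x2: "(a * m / b')\<^sup>2 \<le> 1 / eps\<^sup>2 * (?W * ?v)"
    using wv[OF W(2) v(3)] by (simp add: power_divide power_mult_distrib)
  have x3: "(u * y / b')\<^sup>2 \<le> 1 / eps\<^sup>2 * (?W * ?v)"
    using wv[OF W(3) v(2)] by (simp add: power_divide power_mult_distrib mult.commute)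
  have "(a * y * (1 / b' - 1 / b) + a * m / b' + u * y / b')\<^sup>2
      \<le> 3 * (1 / eps ^ 4 * (?W * ?v)) + 3 * (1 / eps\<^sup>2 * (?W * ?v)) + 3 * (1 / eps\<^sup>2 * (?W * ?v))"
    by (rule order_trans[OF sq3]) (intro add_mono mult_left_mono x1 x2 x3; simp)
  also have "\<dots> = (3 / eps ^ 4 + 6 / eps\<^sup>2) * (?W * ?v)" by (simp add: distrib_right add_divide_distrib[symmetric])
  finally show "(a * y * (1 / b' - 1 / b) + a * m / b' + u * y / b')\<^sup>2 \<le> (3 / eps ^ 4 + 6 / eps\<^sup>2) * (?W * ?v)" .
  assume K: "\<bar>l'\<bar> < K"
  have lK: "l'\<^sup>2 \<le> K\<^sup>2" using power_mono[of "\<bar>l'\<bar>" K 2] K by simp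
  have split: "a\<^sup>2 * (l' / b' - (l' + l) / b) + 2 * l' * a * u / b' = - (a\<^sup>2 * l * (1 / b)) + a\<^sup>2 * l' * (1 / b' - 1 / b) + 2 * l' * a * u / b'"
    by (simp add: divide_inverse algebra_simps)
  have y1: "(- (a\<^sup>2 * l * (1 / b)))\<^sup>2 \<le> 1 / eps\<^sup>2 * (?W * ?v)"
  proof -
    have "(a\<^sup>2)\<^sup>2 * (l\<^sup>2 * (1 / b)\<^sup>2) \<le> (a\<^sup>2)\<^sup>2 * (l\<^sup>2 * (1 / eps\<^sup>2))" using i2[OF assms(2)] by (intro mult_left_mono) auto
    also have "\<dots> = 1 / eps\<^sup>2 * ((a\<^sup>2)\<^sup>2 * l\<^sup>2)" by simp
    also have "\<dots> \<le> 1 / eps\<^sup>2 * (?W * ?v)" using W v by (intro mult_left_mono mult_mono) auto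
    finally show ?thesis by (simp only: power2_minus power_mult_distrib mult.assoc)
  qed
  have y2: "(a\<^sup>2 * l' * (1 / b' - 1 / b))\<^sup>2 \<le> K\<^sup>2 / eps ^ 4 * (?W * ?v)"
  proof -
    have "(a\<^sup>2)\<^sup>2 * (l'\<^sup>2 * (1 / b' - 1 / b)\<^sup>2) \<le> (a\<^sup>2)\<^sup>2 * (K\<^sup>2 * ((b - b')\<^sup>2 / eps ^ 4))"
      using t2 lK by (intro mult_left_mono mult_mono) auto
    also have "\<dots> = K\<^sup>2 / eps ^ 4 * ((a\<^sup>2)\<^sup>2 * (b - b')\<^sup>2)" by simp
    also have "\<dots> \<le> K\<^sup>2 / eps ^ 4 * (?W * ?v)" using W v by (intro mult_left_mono mult_mono) auto
    finally show ?thesis by (simp only: power_mult_distrib mult.assoc)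
  qed
  have y3: "(2 * l' * a * u / b')\<^sup>2 \<le> 4 * K\<^sup>2 / eps\<^sup>2 * (?W * ?v)"
  proof -
    have "l'\<^sup>2 * (a\<^sup>2 * (u\<^sup>2 * (1 / b')\<^sup>2)) \<le> K\<^sup>2 * (1 / eps\<^sup>2 * (?W * ?v))"
      by (rule mult_mono[OF lK wv[OF W(2) v(2)]]) auto
    then show ?thesis by (simp add: power_mult_distrib power_divide mult.assoc)
  qed
  have "(a\<^sup>2 * (l' / b' - (l' + l) / b) + 2 * l' * a * u / b')\<^sup>2
      \<le> 3 * (1 / eps\<^sup>2 * (?W * ?v)) + 3 * (K\<^sup>2 / eps ^ 4 * (?W * ?v)) + 3 * (4 * K\<^sup>2 / eps\<^sup>2 * (?W * ?v))"
    unfolding split by (rule order_trans[OF sq3]) (intro add_mono mult_left_mono y1 y2 y3; simp)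
  also have "\<dots> = (3 / eps\<^sup>2 + 3 * K\<^sup>2 / eps ^ 4 + 12 * K\<^sup>2 / eps\<^sup>2) * (?W * ?v)"
    by (simp only: distrib_right)
  finally show "(a\<^sup>2 * (l' / b' - (l' + l) / b) + 2 * l' * a * u / b')\<^sup>2
    \<le> (3 / eps\<^sup>2 + 3 * K\<^sup>2 / eps ^ 4 + 12 * K\<^sup>2 / eps\<^sup>2) * (?W * ?v)" .
qed

context moment_law
begin

text \<open>The weight of the squared errors in \<open>cross_terms_bound\<close>; its conditional mean is bounded, so that in
  integrals it costs only a constant.\<close>

definition W :: "'p obs \<Rightarrow> real" where
  "W ob = 1 + (A0 ob)\<^sup>2 + (Y0 ob)\<^sup>2 + (A0 ob * Y0 ob)\<^sup>2 + ((A0 ob)\<^sup>2)\<^sup>2"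

lemma W_measurable [measurable]: "W \<in> borel_measurable borel"
  unfolding W_def[abs_def] by measurable

lemma W_nonneg: "0 \<le> W ob" by (simp add: W_def)

lemma mean_dominated_W: "mean_dominated W (5 * \<kappa>)"
proof -
  have one: "mean_dominated (\<lambda>ob. 1) \<kappa>" by (rule mean_dominated_moment) simp
  have 1: "mean_dominated (\<lambda>ob. 1 + (A0 ob)\<^sup>2) (\<kappa> + \<kappa>)"
    by (rule mean_dominated_add[OF _ _ one moments(3)]) (use \<kappa>_nonneg in auto)
  have 2: "mean_dominated (\<lambda>ob. 1 + (A0 ob)\<^sup>2 + (Y0 ob)\<^sup>2) (\<kappa> + \<kappa> + \<kappa>)"
    by (rule mean_dominated_add[OF _ _ 1 moments(4)]) (use \<kappa>_nonneg in auto)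
  have 3: "mean_dominated (\<lambda>ob. 1 + (A0 ob)\<^sup>2 + (Y0 ob)\<^sup>2 + (A0 ob * Y0 ob)\<^sup>2) (\<kappa> + \<kappa> + \<kappa> + \<kappa>)"
    by (rule mean_dominated_add[OF _ _ 2 moments(6)]) (use \<kappa>_nonneg in auto)
  have "mean_dominated (\<lambda>ob. 1 + (A0 ob)\<^sup>2 + (Y0 ob)\<^sup>2 + (A0 ob * Y0 ob)\<^sup>2 + ((A0 ob)\<^sup>2)\<^sup>2) (\<kappa> + \<kappa> + \<kappa> + \<kappa> + \<kappa>)"
    by (rule mean_dominated_add[OF _ _ 3 moments(5)]) (use \<kappa>_nonneg in auto)
  then show ?thesis by (simp add: W_def[abs_def])
qed

lemma weighted_square_le:
  assumes [measurable]: "r \<in> borel_measurable borel" and r: "\<And>x. 0 \<le> r x" and c: "0 \<le> c"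
    and le: "AE ob in P. (d ob)\<^sup>2 \<le> c * (W ob * r (covs ob))"
  shows "(\<integral>\<^sup>+ob. ennreal ((d ob)\<^sup>2) \<partial>P) \<le> ennreal (c * (5 * \<kappa>)) * (\<integral>\<^sup>+ob. ennreal (r (covs ob)) \<partial>P)"
proof -
  have "(\<integral>\<^sup>+ob. ennreal ((d ob)\<^sup>2) \<partial>P) \<le> (\<integral>\<^sup>+ob. ennreal c * (ennreal (r (covs ob)) * ennreal (W ob)) \<partial>P)"
  proof (rule nn_integral_mono_AE)
    show "AE ob in P. ennreal ((d ob)\<^sup>2) \<le> ennreal c * (ennreal (r (covs ob)) * ennreal (W ob))"
      using le by eventually_elim (simp add: ennreal_mult[symmetric] c r W_nonneg ennreal_leI mult.commute)
  qed
  also have "\<dots> = ennreal c * (\<integral>\<^sup>+ob. ennreal (r (covs ob)) * ennreal (W ob) \<partial>P)"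
    by (rule nn_integral_cmult) measurable
  also have "\<dots> \<le> ennreal c * (ennreal (5 * \<kappa>) * (\<integral>\<^sup>+ob. ennreal (r (covs ob)) \<partial>P))"
    by (intro mult_left_mono mean_dominatedD[OF mean_dominated_W]) simp_all
  also have "\<dots> = ennreal (c * (5 * \<kappa>)) * (\<integral>\<^sup>+ob. ennreal (r (covs ob)) \<partial>P)"
    using c \<kappa>_nonneg by (subst ennreal_mult[of c]) (auto simp: mult.assoc)
  finally show ?thesis .
qed

end

locale plug_in_estimation = iid_sample M Obs P + L: moment_law P eps K
  for M :: "'w measure" and Obs :: "nat \<Rightarrow> 'w \<Rightarrow> 'p::finite obs" and P :: "'p obs measure" and eps K :: real +
  fixes muh pih lamh beth :: "('w, 'p) estimator" and \<nu> \<tau> :: real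
  assumes random: "\<And>n h. h \<in> {muh, pih, lamh, beth} \<Longrightarrow> random_function M (h n)"
    and consistent: "consistent M P muh (mu_fun P)" "consistent M P pih (pi_fun P)"
      "consistent M P lamh (lambda_fun P)" "consistent M P beth (beta_fun P)"
    and beth_gt: "\<And>n. AE \<omega> in M. AE ob in P. eps < beth n \<omega> (covs ob)"
    and lamh_bounded: "\<And>n. AE \<omega> in M. AE ob in P. lamh n \<omega> (covs ob) \<in> {-K<..<K}"
    and exponents: "\<nu> \<ge> 1" "\<tau> \<ge> 0" "\<nu> + \<tau> \<ge> 2"
    and pi_rate: "small_oP M (est_err P pih (pi_fun P)) (\<lambda>n. real n powr (- \<nu> / 4))"
    and mu_rate: "small_oP M (est_err P muh (mu_fun P)) (\<lambda>n. real n powr (- \<tau> / 4))"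
    and lambda_beta_rate: "small_oP M (\<lambda>n \<omega>. est_err P lamh (lambda_fun P) n \<omega> * est_err P beth (beta_fun P) n \<omega>)
           (\<lambda>n. real n powr (- 1 / 2))"
begin

lemma randomD: "random_function N (h n) \<Longrightarrow> (\<lambda>(\<omega>, x). h n \<omega> x) \<in> borel_measurable (N \<Otimes>\<^sub>M borel)"
  by (simp add: random_function_def)

lemma estimators_measurable [measurable]:
  "(\<lambda>(\<omega>, x). muh n \<omega> x) \<in> borel_measurable (M \<Otimes>\<^sub>M borel)"
  "(\<lambda>(\<omega>, x). pih n \<omega> x) \<in> borel_measurable (M \<Otimes>\<^sub>M borel)"
  "(\<lambda>(\<omega>, x). lamh n \<omega> x) \<in> borel_measurable (M \<Otimes>\<^sub>M borel)"
  "(\<lambda>(\<omega>, x). beth n \<omega> x) \<in> borel_measurable (M \<Otimes>\<^sub>M borel)"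
  by (rule randomD; rule random; simp)+

lemma estimators_sections:
  assumes "\<omega> \<in> space M"
  shows "muh n \<omega> \<in> borel_measurable borel" "pih n \<omega> \<in> borel_measurable borel"
    "lamh n \<omega> \<in> borel_measurable borel" "beth n \<omega> \<in> borel_measurable borel"
  using measurable_compose_Pair1[OF assms estimators_measurable(1)] measurable_compose_Pair1[OF assms estimators_measurable(2)]
    measurable_compose_Pair1[OF assms estimators_measurable(3)] measurable_compose_Pair1[OF assms estimators_measurable(4)]
  by simp_all

text \<open>Errors of the estimates of \<open>\<pi>\<close>, \<open>\<mu>\<close>, \<open>\<lambda>\<close> and \<open>\<beta>\<close>.\<close>

abbreviation "du n \<omega> x \<equiv> pi_fun P x - pih n \<omega> x"
abbreviation "dm n \<omega> x \<equiv> mu_fun P x - muh n \<omega> x"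
abbreviation "dl n \<omega> x \<equiv> lambda_fun P x - lamh n \<omega> x"
abbreviation "db n \<omega> x \<equiv> beta_fun P x - beth n \<omega> x"

definition sq_err :: "nat \<Rightarrow> 'w \<Rightarrow> real ^ 'p \<Rightarrow> real" where
  "sq_err n \<omega> x = (dl n \<omega> x)\<^sup>2 + (du n \<omega> x)\<^sup>2 + (dm n \<omega> x)\<^sup>2 + (db n \<omega> x)\<^sup>2"

text \<open>\<open>V\<close> collects the squared norms of the errors, which are \<open>o\<^sub>P(1)\<close> by consistency; \<open>Z\<close> collects the products of
  norms that occur in the bias, which are \<open>o\<^sub>P(n\<^sup>-\<^sup>1\<^sup>/\<^sup>2)\<close>.\<close>

definition V :: "nat \<Rightarrow> 'w \<Rightarrow> ennreal" where "V n \<omega> = (\<integral>\<^sup>+ob. ennreal (sq_err n \<omega> (covs ob)) \<partial>P)"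

definition Z :: "nat \<Rightarrow> 'w \<Rightarrow> ennreal" where
  "Z n \<omega> = est_err P lamh (lambda_fun P) n \<omega> * est_err P beth (beta_fun P) n \<omega>
    + (est_err P pih (pi_fun P) n \<omega> * est_err P muh (mu_fun P) n \<omega>
       + est_err P pih (pi_fun P) n \<omega> * est_err P pih (pi_fun P) n \<omega>)"

lemma est_errs_measurable [measurable]:
  "est_err P muh (mu_fun P) n \<in> borel_measurable M" "est_err P pih (pi_fun P) n \<in> borel_measurable M"
  "est_err P lamh (lambda_fun P) n \<in> borel_measurable M" "est_err P beth (beta_fun P) n \<in> borel_measurable M"
  by (rule L.est_err_measurable; measurable)+

lemma V_measurable [measurable]: "V n \<in> borel_measurable M"
  unfolding V_def[abs_def] sq_err_def by measurable

lemma Z_measurable [measurable]: "Z n \<in> borel_measurable M"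
  unfolding Z_def[abs_def] by measurable

lemma V_small: "small_oP M V (\<lambda>_. 1)"
proof -
  have sq: "small_oP M (\<lambda>n \<omega>. est_err P h f n \<omega> * est_err P h f n \<omega>) (\<lambda>_. 1)"
    if "consistent M P h f" "\<And>n. est_err P h f n \<in> borel_measurable M" for h :: "('w, 'p) estimator" and f
    using small_oP_mult[OF that(2) that(1)[unfolded consistent_def] that(2) that(1)[unfolded consistent_def]] by simp
  have "small_oP M (\<lambda>n \<omega>. est_err P lamh (lambda_fun P) n \<omega> * est_err P lamh (lambda_fun P) n \<omega>
      + est_err P pih (pi_fun P) n \<omega> * est_err P pih (pi_fun P) n \<omega>
      + est_err P muh (mu_fun P) n \<omega> * est_err P muh (mu_fun P) n \<omega>
      + est_err P beth (beta_fun P) n \<omega> * est_err P beth (beta_fun P) n \<omega>) (\<lambda>_. 1)"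
    by (intro small_oP_add sq consistent) (simp_all, measurable)
  then show ?thesis
  proof (rule small_oP_mono[rotated, where c=1])
    fix n :: nat
    show "AE \<omega> in M. V n \<omega> \<le> ennreal 1 * (est_err P lamh (lambda_fun P) n \<omega> * est_err P lamh (lambda_fun P) n \<omega>
      + est_err P pih (pi_fun P) n \<omega> * est_err P pih (pi_fun P) n \<omega>
      + est_err P muh (mu_fun P) n \<omega> * est_err P muh (mu_fun P) n \<omega>
      + est_err P beth (beta_fun P) n \<omega> * est_err P beth (beta_fun P) n \<omega>)"
    proof (rule AE_I2)
      fix \<omega> assume \<omega>: "\<omega> \<in> space M"
      note [measurable] = estimators_sections[OF \<omega>]
      show "V n \<omega> \<le> ennreal 1 * (est_err P lamh (lambda_fun P) n \<omega> * est_err P lamh (lambda_fun P) n \<omega>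
      + est_err P pih (pi_fun P) n \<omega> * est_err P pih (pi_fun P) n \<omega>
      + est_err P muh (mu_fun P) n \<omega> * est_err P muh (mu_fun P) n \<omega>
      + est_err P beth (beta_fun P) n \<omega> * est_err P beth (beta_fun P) n \<omega>)"
        unfolding est_err_def L2_norm_square V_def sq_err_def
        by (simp add: nn_integral_add)
    qed
  qed simp_all
qed

lemma Z_small: "small_oP M Z (\<lambda>n. real n powr (- 1 / 2))"
  unfolding Z_def[abs_def]
proof (intro small_oP_add)
  show "small_oP M (\<lambda>n \<omega>. est_err P lamh (lambda_fun P) n \<omega> * est_err P beth (beta_fun P) n \<omega>) (\<lambda>n. real n powr (- 1 / 2))"
    by (rule lambda_beta_rate)
  show "small_oP M (\<lambda>n \<omega>. est_err P pih (pi_fun P) n \<omega> * est_err P muh (mu_fun P) n \<omega>) (\<lambda>n. real n powr (- 1 / 2))"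
  proof (rule small_oP_rate_mono[OF _ small_oP_mult[OF _ pi_rate _ mu_rate]])
    fix n :: nat assume "0 < n"
    then show "real n powr (- \<nu> / 4) * real n powr (- \<tau> / 4) \<le> real n powr (- 1 / 2)"
      unfolding powr_add[symmetric] using exponents by (intro powr_mono) auto
  qed auto
  show "small_oP M (\<lambda>n \<omega>. est_err P pih (pi_fun P) n \<omega> * est_err P pih (pi_fun P) n \<omega>) (\<lambda>n. real n powr (- 1 / 2))"
  proof (rule small_oP_rate_mono[OF _ small_oP_mult[OF _ pi_rate _ pi_rate]])
    fix n :: nat assume "0 < n"
    then show "real n powr (- \<nu> / 4) * real n powr (- \<nu> / 4) \<le> real n powr (- 1 / 2)"
      unfolding powr_add[symmetric] using exponents by (intro powr_mono) auto
  qed auto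
qed auto

text \<open>\<open>D1\<close>, \<open>D2\<close>, \<open>D3\<close> are the estimation errors of the three functions in the Donsker condition.  Expanding
  in residuals and errors splits \<open>D2\<close> and \<open>D3\<close> into \<open>d2\<close>, \<open>d3\<close>, whose terms contain one error and are small in \<open>L\<^sub>2\<close>, and \<open>e2\<close>,
  \<open>e3\<close>, which contain two and are controlled only in \<open>L\<^sub>1\<close>.\<close>

definition D1 :: "nat \<Rightarrow> 'w \<Rightarrow> 'p obs \<Rightarrow> real" where
  "D1 n \<omega> ob = lamh n \<omega> (covs ob) - lambda_fun P (covs ob)"

definition D2 :: "nat \<Rightarrow> 'w \<Rightarrow> 'p obs \<Rightarrow> real" where
  "D2 n \<omega> ob = (trt ob - pih n \<omega> (covs ob)) * (resp ob - muh n \<omega> (covs ob)) / beth n \<omega> (covs ob)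
     - L.A0 ob * L.Y0 ob / beta_fun P (covs ob)"

definition D3 :: "nat \<Rightarrow> 'w \<Rightarrow> 'p obs \<Rightarrow> real" where
  "D3 n \<omega> ob = lamh n \<omega> (covs ob) * (trt ob - pih n \<omega> (covs ob))\<^sup>2 / beth n \<omega> (covs ob)
     - lambda_fun P (covs ob) * (L.A0 ob)\<^sup>2 / beta_fun P (covs ob)"

definition d2 :: "nat \<Rightarrow> 'w \<Rightarrow> 'p obs \<Rightarrow> real" where
  "d2 n \<omega> ob = L.A0 ob * L.Y0 ob * (1 / beth n \<omega> (covs ob) - 1 / beta_fun P (covs ob))
     + L.A0 ob * dm n \<omega> (covs ob) / beth n \<omega> (covs ob) + du n \<omega> (covs ob) * L.Y0 ob / beth n \<omega> (covs ob)"

definition e2 :: "nat \<Rightarrow> 'w \<Rightarrow> 'p obs \<Rightarrow> real" where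
  "e2 n \<omega> ob = du n \<omega> (covs ob) * dm n \<omega> (covs ob) / beth n \<omega> (covs ob)"

definition d3 :: "nat \<Rightarrow> 'w \<Rightarrow> 'p obs \<Rightarrow> real" where
  "d3 n \<omega> ob = (L.A0 ob)\<^sup>2 * (lamh n \<omega> (covs ob) / beth n \<omega> (covs ob) - lambda_fun P (covs ob) / beta_fun P (covs ob))
     + 2 * lamh n \<omega> (covs ob) * L.A0 ob * du n \<omega> (covs ob) / beth n \<omega> (covs ob)"

definition e3 :: "nat \<Rightarrow> 'w \<Rightarrow> 'p obs \<Rightarrow> real" where
  "e3 n \<omega> ob = lamh n \<omega> (covs ob) * (du n \<omega> (covs ob) * du n \<omega> (covs ob)) / beth n \<omega> (covs ob)"

lemma D2_eq: "D2 n \<omega> ob = d2 n \<omega> ob + e2 n \<omega> ob"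
  by (simp add: D2_def d2_def e2_def L.A0_def L.Y0_def divide_inverse algebra_simps)

lemma D3_eq: "D3 n \<omega> ob = d3 n \<omega> ob + e3 n \<omega> ob"
  by (simp add: D3_def d3_def e3_def L.A0_def divide_inverse power2_eq_square algebra_simps)

lemma parts_measurable:
  assumes "\<forall>h\<in>{muh, pih, lamh, beth}. random_function G (h n)"
  shows "(\<lambda>(\<omega>, ob). D1 n \<omega> ob) \<in> borel_measurable (G \<Otimes>\<^sub>M borel)"
    "(\<lambda>(\<omega>, ob). d2 n \<omega> ob) \<in> borel_measurable (G \<Otimes>\<^sub>M borel)"
    "(\<lambda>(\<omega>, ob). e2 n \<omega> ob) \<in> borel_measurable (G \<Otimes>\<^sub>M borel)"
    "(\<lambda>(\<omega>, ob). d3 n \<omega> ob) \<in> borel_measurable (G \<Otimes>\<^sub>M borel)"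
    "(\<lambda>(\<omega>, ob). e3 n \<omega> ob) \<in> borel_measurable (G \<Otimes>\<^sub>M borel)"
proof -
  have [measurable]: "(\<lambda>(\<omega>, x). muh n \<omega> x) \<in> borel_measurable (G \<Otimes>\<^sub>M borel)"
    "(\<lambda>(\<omega>, x). pih n \<omega> x) \<in> borel_measurable (G \<Otimes>\<^sub>M borel)"
    "(\<lambda>(\<omega>, x). lamh n \<omega> x) \<in> borel_measurable (G \<Otimes>\<^sub>M borel)"
    "(\<lambda>(\<omega>, x). beth n \<omega> x) \<in> borel_measurable (G \<Otimes>\<^sub>M borel)"
    using assms by (auto intro: randomD)
  show "(\<lambda>(\<omega>, ob). D1 n \<omega> ob) \<in> borel_measurable (G \<Otimes>\<^sub>M borel)"
    unfolding D1_def by measurable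
  show "(\<lambda>(\<omega>, ob). d2 n \<omega> ob) \<in> borel_measurable (G \<Otimes>\<^sub>M borel)"
    unfolding d2_def by measurable
  show "(\<lambda>(\<omega>, ob). e2 n \<omega> ob) \<in> borel_measurable (G \<Otimes>\<^sub>M borel)"
    unfolding e2_def by measurable
  show "(\<lambda>(\<omega>, ob). d3 n \<omega> ob) \<in> borel_measurable (G \<Otimes>\<^sub>M borel)"
    unfolding d3_def by measurable
  show "(\<lambda>(\<omega>, ob). e3 n \<omega> ob) \<in> borel_measurable (G \<Otimes>\<^sub>M borel)"
    unfolding e3_def by measurable
qed

lemma sq_err_section:
  assumes \<omega>: "\<omega> \<in> space M" shows "sq_err n \<omega> \<in> borel_measurable borel"
proof -
  note [measurable] = estimators_sections[OF \<omega>]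
  show ?thesis unfolding sq_err_def[abs_def] by measurable
qed

lemma sq_err_nonneg: "0 \<le> sq_err n \<omega> x" by (simp add: sq_err_def)

lemma L2_bound:
  assumes c: "0 \<le> c" and le: "AE \<omega> in M. AE ob in P. (d n \<omega> ob)\<^sup>2 \<le> c * (L.W ob * sq_err n \<omega> (covs ob))"
  shows "AE \<omega> in M. (\<integral>\<^sup>+ob. ennreal ((d n \<omega> ob)\<^sup>2) \<partial>P) \<le> ennreal (c * (5 * L.\<kappa>)) * V n \<omega>"
  using le AE_space
proof eventually_elim
  case (elim \<omega>)
  then show ?case unfolding V_def by (intro L.weighted_square_le sq_err_section sq_err_nonneg c)
qed

lemma d1_L2: "\<exists>C>0. \<forall>n. AE \<omega> in M. (\<integral>\<^sup>+ob. ennreal ((D1 n \<omega> ob)\<^sup>2) \<partial>P) \<le> ennreal C * V n \<omega>"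
proof (intro exI[of _ "1 * (5 * L.\<kappa>)"] conjI allI L2_bound)
  show "0 < 1 * (5 * L.\<kappa>)" using L.\<kappa>_ge_1 by simp
  fix n
  have "(D1 n \<omega> ob)\<^sup>2 \<le> 1 * (L.W ob * sq_err n \<omega> (covs ob))" for \<omega> ob
  proof -
    have "1 * (dl n \<omega> (covs ob))\<^sup>2 \<le> L.W ob * sq_err n \<omega> (covs ob)"
      by (intro mult_mono) (auto simp: L.W_def sq_err_def)
    then show ?thesis by (simp add: D1_def power2_commute)
  qed
  then show "AE \<omega> in M. AE ob in P. (D1 n \<omega> ob)\<^sup>2 \<le> 1 * (L.W ob * sq_err n \<omega> (covs ob))" by simp
qed simp

lemma d2_L2: "\<exists>C>0. \<forall>n. AE \<omega> in M. (\<integral>\<^sup>+ob. ennreal ((d2 n \<omega> ob)\<^sup>2) \<partial>P) \<le> ennreal C * V n \<omega>"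
proof (intro exI[of _ "(3 / eps ^ 4 + 6 / eps\<^sup>2) * (5 * L.\<kappa>)"] conjI allI L2_bound)
  show "0 < (3 / eps ^ 4 + 6 / eps\<^sup>2) * (5 * L.\<kappa>)" "0 \<le> 3 / eps ^ 4 + 6 / eps\<^sup>2"
    using L.\<kappa>_ge_1 L.eps_pos by (auto intro!: mult_pos_pos add_pos_pos)
  fix n
  show "AE \<omega> in M. AE ob in P. (d2 n \<omega> ob)\<^sup>2 \<le> (3 / eps ^ 4 + 6 / eps\<^sup>2) * (L.W ob * sq_err n \<omega> (covs ob))"
    using beth_gt[of n]
  proof eventually_elim
    case (elim \<omega>)
    then show ?case using L.AE_beta_gt
      by eventually_elim (unfold d2_def L.W_def sq_err_def, intro cross_terms_bound L.eps_pos)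
  qed
qed

lemma d3_L2: "\<exists>C>0. \<forall>n. AE \<omega> in M. (\<integral>\<^sup>+ob. ennreal ((d3 n \<omega> ob)\<^sup>2) \<partial>P) \<le> ennreal C * V n \<omega>"
proof (intro exI[of _ "(3 / eps\<^sup>2 + 3 * K\<^sup>2 / eps ^ 4 + 12 * K\<^sup>2 / eps\<^sup>2) * (5 * L.\<kappa>)"] conjI allI L2_bound)
  show "0 < (3 / eps\<^sup>2 + 3 * K\<^sup>2 / eps ^ 4 + 12 * K\<^sup>2 / eps\<^sup>2) * (5 * L.\<kappa>)" "0 \<le> 3 / eps\<^sup>2 + 3 * K\<^sup>2 / eps ^ 4 + 12 * K\<^sup>2 / eps\<^sup>2"
    using L.\<kappa>_ge_1 L.eps_pos L.K_pos by (auto intro!: mult_pos_pos add_pos_pos)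
  fix n
  show "AE \<omega> in M. AE ob in P. (d3 n \<omega> ob)\<^sup>2 \<le> (3 / eps\<^sup>2 + 3 * K\<^sup>2 / eps ^ 4 + 12 * K\<^sup>2 / eps\<^sup>2) * (L.W ob * sq_err n \<omega> (covs ob))"
    using beth_gt[of n] lamh_bounded[of n]
  proof eventually_elim
    case (elim \<omega>)
    then show ?case using L.AE_beta_gt
    proof eventually_elim
      case (elim ob)
      then have "\<bar>lamh n \<omega> (covs ob)\<bar> < K" by auto
      from cross_terms_bound(2)[OF L.eps_pos elim(3) elim(1) this, of "L.A0 ob" "lambda_fun P (covs ob) - lamh n \<omega> (covs ob)"]
      show ?case by (simp add: d3_def L.W_def sq_err_def)
    qed
  qed
qed

end

section \<open>The empirical process at the estimation errors\<close>

context plug_in_estimation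
begin

text \<open>A product of two errors has an \<open>L\<^sub>1\<close> norm bounded both at the fast rate of \<open>Z\<close>, which serves sample splitting and
  the bias, and by \<open>V\<close>, which is finite off a small event.\<close>

lemma product_L1:
  assumes c: "0 \<le> c" and \<omega>: "\<omega> \<in> space M"
    and h: "h \<in> borel_measurable borel" and k: "k \<in> borel_measurable borel"
    and le: "AE ob in P. \<bar>e ob\<bar> \<le> c * \<bar>h (covs ob) * k (covs ob)\<bar>"
    and hk: "\<And>x. (h x)\<^sup>2 + (k x)\<^sup>2 \<le> 2 * sq_err n \<omega> x"
    and Z: "L2_norm P h * L2_norm P k \<le> Z n \<omega>"
  shows "(\<integral>\<^sup>+ob. ennreal \<bar>e ob\<bar> \<partial>P) \<le> ennreal c * Z n \<omega>" "(\<integral>\<^sup>+ob. ennreal \<bar>e ob\<bar> \<partial>P) \<le> ennreal c * V n \<omega>"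
proof -
  note [measurable] = h k sq_err_section[OF \<omega>]
  have "(\<integral>\<^sup>+ob. ennreal \<bar>e ob\<bar> \<partial>P) \<le> (\<integral>\<^sup>+ob. ennreal c * ennreal \<bar>h (covs ob) * k (covs ob)\<bar> \<partial>P)"
    using le by (intro nn_integral_mono_AE) (auto elim!: eventually_mono simp: ennreal_mult[symmetric] c intro!: ennreal_leI)
  also have "\<dots> = ennreal c * (\<integral>\<^sup>+ob. ennreal \<bar>h (covs ob) * k (covs ob)\<bar> \<partial>P)"
    by (rule nn_integral_cmult) measurable
  finally have 1: "(\<integral>\<^sup>+ob. ennreal \<bar>e ob\<bar> \<partial>P) \<le> ennreal c * (\<integral>\<^sup>+ob. ennreal \<bar>h (covs ob) * k (covs ob)\<bar> \<partial>P)" .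
  have "(\<integral>\<^sup>+ob. ennreal \<bar>h (covs ob) * k (covs ob)\<bar> \<partial>P) \<le> Z n \<omega>"
    by (rule order_trans[OF L.L2_norm_Cauchy_Schwarz[OF h k] Z])
  then show "(\<integral>\<^sup>+ob. ennreal \<bar>e ob\<bar> \<partial>P) \<le> ennreal c * Z n \<omega>"
    by (intro order_trans[OF 1] mult_left_mono) auto
  have "(\<integral>\<^sup>+ob. ennreal \<bar>h (covs ob) * k (covs ob)\<bar> \<partial>P) \<le> V n \<omega>"
    unfolding V_def
  proof (intro nn_integral_mono ennreal_leI)
    fix ob
    show "\<bar>h (covs ob) * k (covs ob)\<bar> \<le> sq_err n \<omega> (covs ob)"
      using mult_le_squares[of "h (covs ob)" "k (covs ob)"] hk[of "covs ob"] by simp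
  qed
  then show "(\<integral>\<^sup>+ob. ennreal \<bar>e ob\<bar> \<partial>P) \<le> ennreal c * V n \<omega>"
    by (intro order_trans[OF 1] mult_left_mono) auto
qed

lemma Z_ge:
  "L2_norm P (du n \<omega>) * L2_norm P (dm n \<omega>) \<le> Z n \<omega>" "L2_norm P (du n \<omega>) * L2_norm P (du n \<omega>) \<le> Z n \<omega>"
  by (simp_all add: Z_def est_err_def add_increasing add_increasing2)

lemma e2_L1: "\<exists>C>0. \<forall>n. AE \<omega> in M. (\<integral>\<^sup>+ob. ennreal \<bar>e2 n \<omega> ob\<bar> \<partial>P) \<le> ennreal C * Z n \<omega>
    \<and> (\<integral>\<^sup>+ob. ennreal \<bar>e2 n \<omega> ob\<bar> \<partial>P) \<le> ennreal C * V n \<omega>"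
proof (intro exI[of _ "1 / eps"] conjI allI)
  show "0 < 1 / eps" using L.eps_pos by simp
  fix n
  show "AE \<omega> in M. (\<integral>\<^sup>+ob. ennreal \<bar>e2 n \<omega> ob\<bar> \<partial>P) \<le> ennreal (1 / eps) * Z n \<omega>
    \<and> (\<integral>\<^sup>+ob. ennreal \<bar>e2 n \<omega> ob\<bar> \<partial>P) \<le> ennreal (1 / eps) * V n \<omega>"
    using beth_gt[of n] AE_space
  proof eventually_elim
    case (elim \<omega>)
    note [measurable] = estimators_sections[OF elim(2)]
    have le: "AE ob in P. \<bar>e2 n \<omega> ob\<bar> \<le> 1 / eps * \<bar>du n \<omega> (covs ob) * dm n \<omega> (covs ob)\<bar>"
      using elim(1)
    proof eventually_elim
      case (elim ob)
      have "\<bar>du n \<omega> (covs ob) * dm n \<omega> (covs ob)\<bar> / \<bar>beth n \<omega> (covs ob)\<bar> \<le> \<bar>du n \<omega> (covs ob) * dm n \<omega> (covs ob)\<bar> / eps"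
        using elim L.eps_pos by (intro frac_le) auto
      then show ?case by (simp add: e2_def)
    qed
    show ?case
      by (intro conjI; rule product_L1[OF _ elim(2) _ _ le _ Z_ge(1)])
        (use L.eps_pos in \<open>auto simp: sq_err_def add_increasing add_increasing2\<close>)
  qed
qed

lemma e3_L1: "\<exists>C>0. \<forall>n. AE \<omega> in M. (\<integral>\<^sup>+ob. ennreal \<bar>e3 n \<omega> ob\<bar> \<partial>P) \<le> ennreal C * Z n \<omega>
    \<and> (\<integral>\<^sup>+ob. ennreal \<bar>e3 n \<omega> ob\<bar> \<partial>P) \<le> ennreal C * V n \<omega>"
proof (intro exI[of _ "K / eps"] conjI allI)
  show "0 < K / eps" using L.eps_pos L.K_pos by simp
  fix n
  show "AE \<omega> in M. (\<integral>\<^sup>+ob. ennreal \<bar>e3 n \<omega> ob\<bar> \<partial>P) \<le> ennreal (K / eps) * Z n \<omega>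
    \<and> (\<integral>\<^sup>+ob. ennreal \<bar>e3 n \<omega> ob\<bar> \<partial>P) \<le> ennreal (K / eps) * V n \<omega>"
    using beth_gt[of n] lamh_bounded[of n] AE_space
  proof eventually_elim
    case (elim \<omega>)
    note [measurable] = estimators_sections[OF elim(3)]
    have le: "AE ob in P. \<bar>e3 n \<omega> ob\<bar> \<le> K / eps * \<bar>du n \<omega> (covs ob) * du n \<omega> (covs ob)\<bar>"
      using elim(1,2)
    proof eventually_elim
      case (elim ob)
      have "\<bar>lamh n \<omega> (covs ob)\<bar> * \<bar>du n \<omega> (covs ob) * du n \<omega> (covs ob)\<bar> / \<bar>beth n \<omega> (covs ob)\<bar> \<le> K * \<bar>du n \<omega> (covs ob) * du n \<omega> (covs ob)\<bar> / eps"
        using elim L.eps_pos L.K_pos by (intro frac_le mult_right_mono mult_nonneg_nonneg) auto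
      then show ?case by (simp add: e3_def abs_mult)
    qed
    show ?case
      by (intro conjI; rule product_L1[OF _ elim(3) _ _ le _ Z_ge(2)])
        (use L.eps_pos L.K_pos in \<open>auto simp: sq_err_def add_increasing add_increasing2\<close>)
  qed
qed

text \<open>Off these events all functions under consideration are integrable, so that \<open>emp\<close> is additive on them.\<close>

definition Bad :: "nat \<Rightarrow> 'w set" where "Bad n = {\<omega>\<in>space M. 1 < V n \<omega>}"

lemma Bad_measurable [measurable]: "Bad n \<in> events" unfolding Bad_def by measurable

lemma Bad_small: "(\<lambda>n. prob (Bad n)) \<longlonglongrightarrow> 0"
  using V_small[unfolded small_oP_1_iff, rule_format, of 1] by (simp add: Bad_def)

lemma integrable_of_V:
  assumes "\<omega> \<in> space M" "\<omega> \<notin> Bad n" and d: "d \<in> borel_measurable borel"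
  shows "(\<integral>\<^sup>+ob. ennreal \<bar>d ob\<bar> \<partial>P) \<le> ennreal C * V n \<omega> \<Longrightarrow> integrable P d"
    and "(\<integral>\<^sup>+ob. ennreal ((d ob)\<^sup>2) \<partial>P) \<le> ennreal C * V n \<omega> \<Longrightarrow> integrable P d"
proof -
  have "V n \<omega> \<le> 1" using assms by (auto simp: Bad_def not_less)
  then have "ennreal C * V n \<omega> \<le> ennreal C * 1" by (intro mult_left_mono) auto
  then have fin: "ennreal C * V n \<omega> < \<infinity>" by (simp add: le_less_trans)
  show "integrable P d" if "(\<integral>\<^sup>+ob. ennreal \<bar>d ob\<bar> \<partial>P) \<le> ennreal C * V n \<omega>"
    using le_less_trans[OF that fin] d by (intro integrableI_bounded) auto
  show "integrable P d" if "(\<integral>\<^sup>+ob. ennreal ((d ob)\<^sup>2) \<partial>P) \<le> ennreal C * V n \<omega>"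
  proof (rule P.square_integrable_imp_integrable)
    show "integrable P (\<lambda>ob. (d ob)\<^sup>2)"
      using le_less_trans[OF that fin] d by (intro integrableI_bounded) auto
  qed (use d in simp)
qed

lemma emp_parts_splitting:
  assumes split: "sample_splitting M Obs {muh, pih, lamh, beth}"
    and dm: "\<And>n G. \<forall>h\<in>{muh, pih, lamh, beth}. random_function G (h n) \<Longrightarrow> (\<lambda>(\<omega>, ob). d n \<omega> ob) \<in> borel_measurable (G \<Otimes>\<^sub>M borel)"
    and em: "\<And>n G. \<forall>h\<in>{muh, pih, lamh, beth}. random_function G (h n) \<Longrightarrow> (\<lambda>(\<omega>, ob). e n \<omega> ob) \<in> borel_measurable (G \<Otimes>\<^sub>M borel)"
    and dle: "0 < C" "\<And>n. AE \<omega> in M. (\<integral>\<^sup>+ob. ennreal ((d n \<omega> ob)\<^sup>2) \<partial>P) \<le> ennreal C * V n \<omega>"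
    and ele: "0 < C'" "\<And>n. AE \<omega> in M. (\<integral>\<^sup>+ob. ennreal \<bar>e n \<omega> ob\<bar> \<partial>P) \<le> ennreal C' * Z n \<omega>
      \<and> (\<integral>\<^sup>+ob. ennreal \<bar>e n \<omega> ob\<bar> \<partial>P) \<le> ennreal C' * V n \<omega>"
  shows "small_oP M (\<lambda>n \<omega>. ennreal \<bar>emp P n (\<lambda>ob. d n \<omega> ob + e n \<omega> ob) (\<lambda>i. Obs i \<omega>)\<bar>) (\<lambda>_. 1)"
proof -
  from split obtain G where G: "\<And>n. subalgebra M (G n)" "\<And>n. indep_set (sets (G n)) (sets (tuple_algebra n))"
    "\<And>n. \<forall>h\<in>{muh, pih, lamh, beth}. random_function (G n) (h n)"
    unfolding sample_splitting_def by metis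
  have rM: "\<forall>h\<in>{muh, pih, lamh, beth}. random_function M (h n)" for n using random by blast
  have d: "small_oP M (\<lambda>n \<omega>. ennreal \<bar>emp P n (d n \<omega>) (\<lambda>i. Obs i \<omega>)\<bar>) (\<lambda>_. 1)"
  proof (rule splitting_emp_L2[OF G(1,2)])
    show "(\<lambda>(\<omega>, ob). d n \<omega> ob) \<in> borel_measurable (G n \<Otimes>\<^sub>M borel)" for n by (rule dm[OF G(3)])
    show "small_oP M (\<lambda>n \<omega>. \<integral>\<^sup>+ob. ennreal ((d n \<omega> ob)\<^sup>2) \<partial>P) (\<lambda>_. 1)"
      by (rule small_oP_mono[OF V_measurable V_small _ dle(1)]) (use dle(2) in auto)
  qed
  have e: "small_oP M (\<lambda>n \<omega>. ennreal \<bar>emp P n (e n \<omega>) (\<lambda>i. Obs i \<omega>)\<bar>) (\<lambda>_. 1)"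
  proof (rule splitting_emp_L1[OF G(1,2)])
    show "(\<lambda>(\<omega>, ob). e n \<omega> ob) \<in> borel_measurable (G n \<Otimes>\<^sub>M borel)" for n by (rule em[OF G(3)])
    show "small_oP M (\<lambda>n \<omega>. \<integral>\<^sup>+ob. ennreal \<bar>e n \<omega> ob\<bar> \<partial>P) (\<lambda>n. real n powr (-1/2))"
      by (rule small_oP_mono[OF Z_measurable Z_small _ ele(1)]) (use ele(2) in \<open>auto elim: eventually_mono\<close>)
  qed
  note [measurable] = emp_Obs_measurable[OF dm[OF rM]] emp_Obs_measurable[OF em[OF rM]]
  have "small_oP M (\<lambda>n \<omega>. ennreal \<bar>emp P n (d n \<omega>) (\<lambda>i. Obs i \<omega>)\<bar> + ennreal \<bar>emp P n (e n \<omega>) (\<lambda>i. Obs i \<omega>)\<bar>) (\<lambda>_. 1)"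
    by (rule small_oP_add[OF _ d _ e]) simp_all
  then show ?thesis
  proof (rule small_oP_dominated[where c=1 and Bad=Bad, rotated])
    fix n :: nat
    show "AE \<omega> in M. \<omega> \<notin> Bad n \<longrightarrow> ennreal \<bar>emp P n (\<lambda>ob. d n \<omega> ob + e n \<omega> ob) (\<lambda>i. Obs i \<omega>)\<bar>
      \<le> ennreal 1 * (ennreal \<bar>emp P n (d n \<omega>) (\<lambda>i. Obs i \<omega>)\<bar> + ennreal \<bar>emp P n (e n \<omega>) (\<lambda>i. Obs i \<omega>)\<bar>)"
      using dle(2)[of n] ele(2)[of n] AE_space
    proof eventually_elim
      case (elim \<omega>)
      show ?case
      proof
        assume nB: "\<omega> \<notin> Bad n"
        have db: "d n \<omega> \<in> borel_measurable borel" and eb: "e n \<omega> \<in> borel_measurable borel"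
          using measurable_compose_Pair1[OF elim(3) dm[OF rM]] measurable_compose_Pair1[OF elim(3) em[OF rM]] by simp_all
        have "integrable P (d n \<omega>)" by (rule integrable_of_V(2)[OF elim(3) nB db elim(1)])
        moreover have "integrable P (e n \<omega>)" by (rule integrable_of_V(1)[OF elim(3) nB eb conjunct2[OF elim(2)]])
        ultimately show "ennreal \<bar>emp P n (\<lambda>ob. d n \<omega> ob + e n \<omega> ob) (\<lambda>i. Obs i \<omega>)\<bar>
          \<le> ennreal 1 * (ennreal \<bar>emp P n (d n \<omega>) (\<lambda>i. Obs i \<omega>)\<bar> + ennreal \<bar>emp P n (e n \<omega>) (\<lambda>i. Obs i \<omega>)\<bar>)"
          by (simp add: emp_add flip: ennreal_plus)
      qed
    qed
  qed (simp_all add: Bad_small)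
qed

lemma emp_parts_donsker:
  assumes F: "donsker P F" and E: "\<And>n. E n \<in> events" "(\<lambda>n. prob (E n)) \<longlonglongrightarrow> 1"
    and f0: "f0 \<in> borel_measurable borel" "integrable P (\<lambda>ob. (f0 ob)\<^sup>2)"
    and inF: "\<And>n \<omega>. \<omega> \<in> E n \<Longrightarrow> (\<lambda>ob. d n \<omega> ob + e n \<omega> ob + f0 ob) \<in> F"
    and dm: "\<And>n G. \<forall>h\<in>{muh, pih, lamh, beth}. random_function G (h n) \<Longrightarrow> (\<lambda>(\<omega>, ob). d n \<omega> ob) \<in> borel_measurable (G \<Otimes>\<^sub>M borel)"
    and em: "\<And>n G. \<forall>h\<in>{muh, pih, lamh, beth}. random_function G (h n) \<Longrightarrow> (\<lambda>(\<omega>, ob). e n \<omega> ob) \<in> borel_measurable (G \<Otimes>\<^sub>M borel)"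
    and dle: "0 < C" "\<And>n. AE \<omega> in M. (\<integral>\<^sup>+ob. ennreal ((d n \<omega> ob)\<^sup>2) \<partial>P) \<le> ennreal C * V n \<omega>"
    and ele: "0 < C'" "\<And>n. AE \<omega> in M. (\<integral>\<^sup>+ob. ennreal \<bar>e n \<omega> ob\<bar> \<partial>P) \<le> ennreal C' * Z n \<omega>
      \<and> (\<integral>\<^sup>+ob. ennreal \<bar>e n \<omega> ob\<bar> \<partial>P) \<le> ennreal C' * V n \<omega>"
  shows "small_oP M (\<lambda>n \<omega>. ennreal \<bar>emp P n (\<lambda>ob. d n \<omega> ob + e n \<omega> ob) (\<lambda>i. Obs i \<omega>)\<bar>) (\<lambda>_. 1)"
proof -
  have rM: "\<forall>h\<in>{muh, pih, lamh, beth}. random_function M (h n)" for n using random by blast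
  note [measurable] = dm[OF rM] em[OF rM] f0(1)
  have d2: "small_oP M (\<lambda>n \<omega>. \<integral>\<^sup>+ob. ennreal ((d n \<omega> ob)\<^sup>2) \<partial>P) (\<lambda>_. 1)"
    by (rule small_oP_mono[OF V_measurable V_small _ dle(1)]) (use dle(2) in auto)
  have d1: "small_oP M (\<lambda>n \<omega>. \<integral>\<^sup>+ob. ennreal \<bar>d n \<omega> ob\<bar> \<partial>P) (\<lambda>_. 1)"
  proof (rule small_oP_of_square[OF _ d2])
    show "AE \<omega> in M. (\<integral>\<^sup>+ob. ennreal \<bar>d n \<omega> ob\<bar> \<partial>P)\<^sup>2 \<le> (\<integral>\<^sup>+ob. ennreal ((d n \<omega> ob)\<^sup>2) \<partial>P)" for n
    proof (rule AE_I2)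
      fix \<omega> assume \<omega>: "\<omega> \<in> space M"
      have "d n \<omega> \<in> borel_measurable borel"
        using measurable_compose_Pair1[OF \<omega> dm[OF rM]] by simp
      then show "(\<integral>\<^sup>+ob. ennreal \<bar>d n \<omega> ob\<bar> \<partial>P)\<^sup>2 \<le> (\<integral>\<^sup>+ob. ennreal ((d n \<omega> ob)\<^sup>2) \<partial>P)"
        using Cauchy_Schwarz_nn_integral[of "\<lambda>ob. ennreal \<bar>d n \<omega> ob\<bar>" P "\<lambda>_. 1"] P.emeasure_space_1
        by (simp add: ennreal_power)
    qed
  qed measurable
  have e1: "small_oP M (\<lambda>n \<omega>. \<integral>\<^sup>+ob. ennreal \<bar>e n \<omega> ob\<bar> \<partial>P) (\<lambda>_. 1)"
    by (rule small_oP_mono[OF V_measurable V_small _ ele(1)]) (use ele(2) in \<open>auto elim: eventually_mono\<close>)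
  have "small_oP M (\<lambda>n \<omega>. (\<integral>\<^sup>+ob. ennreal \<bar>d n \<omega> ob\<bar> \<partial>P) + (\<integral>\<^sup>+ob. ennreal \<bar>e n \<omega> ob\<bar> \<partial>P)) (\<lambda>_. 1)"
    by (rule small_oP_add[OF _ d1 _ e1]) simp_all
  then have "small_oP M (\<lambda>n \<omega>. \<integral>\<^sup>+ob. ennreal \<bar>d n \<omega> ob + e n \<omega> ob\<bar> \<partial>P) (\<lambda>_. 1)"
  proof (rule small_oP_mono[where c=1, rotated])
    fix n :: nat
    show "AE \<omega> in M. (\<integral>\<^sup>+ob. ennreal \<bar>d n \<omega> ob + e n \<omega> ob\<bar> \<partial>P)
      \<le> ennreal 1 * ((\<integral>\<^sup>+ob. ennreal \<bar>d n \<omega> ob\<bar> \<partial>P) + (\<integral>\<^sup>+ob. ennreal \<bar>e n \<omega> ob\<bar> \<partial>P))"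
    proof (rule AE_I2)
      fix \<omega> assume \<omega>: "\<omega> \<in> space M"
      have [measurable]: "d n \<omega> \<in> borel_measurable borel" "e n \<omega> \<in> borel_measurable borel"
        using measurable_compose_Pair1[OF \<omega> dm[OF rM]] measurable_compose_Pair1[OF \<omega> em[OF rM]] by simp_all
      have "(\<integral>\<^sup>+ob. ennreal \<bar>d n \<omega> ob + e n \<omega> ob\<bar> \<partial>P) \<le> (\<integral>\<^sup>+ob. ennreal \<bar>d n \<omega> ob\<bar> + ennreal \<bar>e n \<omega> ob\<bar> \<partial>P)"
        by (intro nn_integral_mono) (simp flip: ennreal_plus add: abs_triangle_ineq ennreal_leI)
      then show "(\<integral>\<^sup>+ob. ennreal \<bar>d n \<omega> ob + e n \<omega> ob\<bar> \<partial>P)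
        \<le> ennreal 1 * ((\<integral>\<^sup>+ob. ennreal \<bar>d n \<omega> ob\<bar> \<partial>P) + (\<integral>\<^sup>+ob. ennreal \<bar>e n \<omega> ob\<bar> \<partial>P))"
        by (simp add: nn_integral_add)
    qed
  qed simp_all
  moreover have "(\<lambda>(\<omega>, ob). d n \<omega> ob + e n \<omega> ob + f0 ob) \<in> borel_measurable (M \<Otimes>\<^sub>M borel)" for n
    by measurable
  ultimately show ?thesis
    using donsker_emp[OF F f0 E, where fh="\<lambda>n \<omega> ob. d n \<omega> ob + e n \<omega> ob + f0 ob"] inF by simp
qed

text \<open>\<open>D1\<close> has no \<open>L\<^sub>1\<close> part, so the part \<open>e\<close> is zero for it.\<close>

lemma emp_D_small:
  assumes "sample_splitting M Obs {muh, pih, lamh, beth} \<or> donsker_condition M P muh pih lamh beth"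
  shows "small_oP M (\<lambda>n \<omega>. ennreal \<bar>emp P n (D1 n \<omega>) (\<lambda>i. Obs i \<omega>)\<bar>) (\<lambda>_. 1)"
    and "small_oP M (\<lambda>n \<omega>. ennreal \<bar>emp P n (D2 n \<omega>) (\<lambda>i. Obs i \<omega>)\<bar>) (\<lambda>_. 1)"
    and "small_oP M (\<lambda>n \<omega>. ennreal \<bar>emp P n (D3 n \<omega>) (\<lambda>i. Obs i \<omega>)\<bar>) (\<lambda>_. 1)"
proof -
  obtain C1 C2 C3 where C1: "0 < C1" "\<forall>n. AE \<omega> in M. (\<integral>\<^sup>+ob. ennreal ((D1 n \<omega> ob)\<^sup>2) \<partial>P) \<le> ennreal C1 * V n \<omega>"
    and C2: "0 < C2" "\<forall>n. AE \<omega> in M. (\<integral>\<^sup>+ob. ennreal ((d2 n \<omega> ob)\<^sup>2) \<partial>P) \<le> ennreal C2 * V n \<omega>"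
    and C3: "0 < C3" "\<forall>n. AE \<omega> in M. (\<integral>\<^sup>+ob. ennreal ((d3 n \<omega> ob)\<^sup>2) \<partial>P) \<le> ennreal C3 * V n \<omega>"
    using d1_L2 d2_L2 d3_L2 by (elim exE conjE)
  obtain C2' C3' where C2': "0 < C2'" "\<forall>n. AE \<omega> in M. (\<integral>\<^sup>+ob. ennreal \<bar>e2 n \<omega> ob\<bar> \<partial>P) \<le> ennreal C2' * Z n \<omega>
        \<and> (\<integral>\<^sup>+ob. ennreal \<bar>e2 n \<omega> ob\<bar> \<partial>P) \<le> ennreal C2' * V n \<omega>"
    and C3': "0 < C3'" "\<forall>n. AE \<omega> in M. (\<integral>\<^sup>+ob. ennreal \<bar>e3 n \<omega> ob\<bar> \<partial>P) \<le> ennreal C3' * Z n \<omega>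
        \<and> (\<integral>\<^sup>+ob. ennreal \<bar>e3 n \<omega> ob\<bar> \<partial>P) \<le> ennreal C3' * V n \<omega>"
    using e2_L1 e3_L1 by (elim exE conjE)
  have D1_0: "D1 n \<omega> = (\<lambda>ob. D1 n \<omega> ob + 0)" for n \<omega> by simp
  have e0: "AE \<omega> in M. (\<integral>\<^sup>+ob. ennreal \<bar>0 :: real\<bar> \<partial>P) \<le> ennreal 1 * Z n \<omega> \<and> (\<integral>\<^sup>+ob. ennreal \<bar>0 :: real\<bar> \<partial>P) \<le> ennreal 1 * V n \<omega>" for n
    by simp
  have D2e: "D2 n \<omega> = (\<lambda>ob. d2 n \<omega> ob + e2 n \<omega> ob)" for n \<omega> by (simp add: fun_eq_iff D2_eq)
  have D3e: "D3 n \<omega> = (\<lambda>ob. d3 n \<omega> ob + e3 n \<omega> ob)" for n \<omega> by (simp add: fun_eq_iff D3_eq)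
  have zm: "(\<lambda>(\<omega>, ob). 0 :: real) \<in> borel_measurable (G \<Otimes>\<^sub>M borel)" for G :: "'w measure" by simp
  have "small_oP M (\<lambda>n \<omega>. ennreal \<bar>emp P n (\<lambda>ob. D1 n \<omega> ob + 0) (\<lambda>i. Obs i \<omega>)\<bar>) (\<lambda>_. 1)
      \<and> small_oP M (\<lambda>n \<omega>. ennreal \<bar>emp P n (\<lambda>ob. d2 n \<omega> ob + e2 n \<omega> ob) (\<lambda>i. Obs i \<omega>)\<bar>) (\<lambda>_. 1)
      \<and> small_oP M (\<lambda>n \<omega>. ennreal \<bar>emp P n (\<lambda>ob. d3 n \<omega> ob + e3 n \<omega> ob) (\<lambda>i. Obs i \<omega>)\<bar>) (\<lambda>_. 1)"
    using assms
  proof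
    assume split: "sample_splitting M Obs {muh, pih, lamh, beth}"
    show ?thesis
    proof (intro conjI)
      show "small_oP M (\<lambda>n \<omega>. ennreal \<bar>emp P n (\<lambda>ob. D1 n \<omega> ob + 0) (\<lambda>i. Obs i \<omega>)\<bar>) (\<lambda>_. 1)"
        by (rule emp_parts_splitting[where d=D1 and e="\<lambda>_ _ _. 0", OF split parts_measurable(1) zm C1(1) C1(2)[rule_format] _ e0]) simp_all
      show "small_oP M (\<lambda>n \<omega>. ennreal \<bar>emp P n (\<lambda>ob. d2 n \<omega> ob + e2 n \<omega> ob) (\<lambda>i. Obs i \<omega>)\<bar>) (\<lambda>_. 1)"
        by (rule emp_parts_splitting[where d=d2 and e=e2, OF split parts_measurable(2) parts_measurable(3) C2(1) C2(2)[rule_format] C2'(1) C2'(2)[rule_format]])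
      show "small_oP M (\<lambda>n \<omega>. ennreal \<bar>emp P n (\<lambda>ob. d3 n \<omega> ob + e3 n \<omega> ob) (\<lambda>i. Obs i \<omega>)\<bar>) (\<lambda>_. 1)"
        by (rule emp_parts_splitting[where d=d3 and e=e3, OF split parts_measurable(4) parts_measurable(5) C3(1) C3(2)[rule_format] C3'(1) C3'(2)[rule_format]])
    qed
  next
    assume "donsker_condition M P muh pih lamh beth"
    then obtain F E where F: "donsker P F" and E: "\<forall>n. E n \<in> sets M" "(\<lambda>n. measure M (E n)) \<longlonglongrightarrow> 1"
      and inF: "\<forall>n. \<forall>\<omega>\<in>E n.
           (\<lambda>ob. lamh n \<omega> (covs ob)) \<in> F \<and>
           (\<lambda>ob. (trt ob - pih n \<omega> (covs ob)) * (resp ob - muh n \<omega> (covs ob))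
                   / beth n \<omega> (covs ob)) \<in> F \<and>
           (\<lambda>ob. lamh n \<omega> (covs ob) * (trt ob - pih n \<omega> (covs ob))\<^sup>2
                   / beth n \<omega> (covs ob)) \<in> F"
      unfolding donsker_condition_def by (elim exE conjE)
    have F1: "(\<lambda>ob. D1 n \<omega> ob + 0 + lambda_fun P (covs ob)) \<in> F"
      and F2: "(\<lambda>ob. d2 n \<omega> ob + e2 n \<omega> ob + L.A0 ob * L.Y0 ob / beta_fun P (covs ob)) \<in> F"
      and F3: "(\<lambda>ob. d3 n \<omega> ob + e3 n \<omega> ob + lambda_fun P (covs ob) * (L.A0 ob)\<^sup>2 / beta_fun P (covs ob)) \<in> F"
      if "\<omega> \<in> E n" for n \<omega>
      using inF that unfolding D2_eq[symmetric] D3_eq[symmetric] by (simp_all add: D1_def D2_def D3_def)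
    show ?thesis
    proof (intro conjI)
      show "small_oP M (\<lambda>n \<omega>. ennreal \<bar>emp P n (\<lambda>ob. D1 n \<omega> ob + 0) (\<lambda>i. Obs i \<omega>)\<bar>) (\<lambda>_. 1)"
        by (rule emp_parts_donsker[where d=D1 and e="\<lambda>_ _ _. 0", OF F E(1)[rule_format] E(2) L.limit_functions_measurable(1) L.limit_functions_square_integrable(1)
            F1 parts_measurable(1) zm C1(1) C1(2)[rule_format] _ e0]) simp_all
      show "small_oP M (\<lambda>n \<omega>. ennreal \<bar>emp P n (\<lambda>ob. d2 n \<omega> ob + e2 n \<omega> ob) (\<lambda>i. Obs i \<omega>)\<bar>) (\<lambda>_. 1)"
        by (rule emp_parts_donsker[where d=d2 and e=e2, OF F E(1)[rule_format] E(2) L.limit_functions_measurable(2) L.limit_functions_square_integrable(2)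
            F2 parts_measurable(2) parts_measurable(3) C2(1) C2(2)[rule_format] C2'(1) C2'(2)[rule_format]])
      show "small_oP M (\<lambda>n \<omega>. ennreal \<bar>emp P n (\<lambda>ob. d3 n \<omega> ob + e3 n \<omega> ob) (\<lambda>i. Obs i \<omega>)\<bar>) (\<lambda>_. 1)"
        by (rule emp_parts_donsker[where d=d3 and e=e3, OF F E(1)[rule_format] E(2) L.limit_functions_measurable(3) L.limit_functions_square_integrable(3)
            F3 parts_measurable(4) parts_measurable(5) C3(1) C3(2)[rule_format] C3'(1) C3'(2)[rule_format]])
    qed
  qed
  then show "small_oP M (\<lambda>n \<omega>. ennreal \<bar>emp P n (D1 n \<omega>) (\<lambda>i. Obs i \<omega>)\<bar>) (\<lambda>_. 1)"
    and "small_oP M (\<lambda>n \<omega>. ennreal \<bar>emp P n (D2 n \<omega>) (\<lambda>i. Obs i \<omega>)\<bar>) (\<lambda>_. 1)"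
    and "small_oP M (\<lambda>n \<omega>. ennreal \<bar>emp P n (D3 n \<omega>) (\<lambda>i. Obs i \<omega>)\<bar>) (\<lambda>_. 1)"
    unfolding D2e D3e by simp_all
qed

text \<open>The remaining product of errors in the bias; it has no counterpart in the empirical process.\<close>

definition e1 :: "nat \<Rightarrow> 'w \<Rightarrow> 'p obs \<Rightarrow> real" where
  "e1 n \<omega> ob = dl n \<omega> (covs ob) * db n \<omega> (covs ob) / beth n \<omega> (covs ob)"

lemma e1_L1: "AE \<omega> in M. (\<integral>\<^sup>+ob. ennreal \<bar>e1 n \<omega> ob\<bar> \<partial>P) \<le> ennreal (1 / eps) * Z n \<omega>"
  using beth_gt[of n] AE_space
proof eventually_elim
  case (elim \<omega>)
  note [measurable] = estimators_sections[OF elim(2)]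
  have le: "AE ob in P. \<bar>e1 n \<omega> ob\<bar> \<le> 1 / eps * \<bar>dl n \<omega> (covs ob) * db n \<omega> (covs ob)\<bar>"
    using elim(1)
  proof eventually_elim
    case (elim ob)
    have "\<bar>dl n \<omega> (covs ob) * db n \<omega> (covs ob)\<bar> / \<bar>beth n \<omega> (covs ob)\<bar> \<le> \<bar>dl n \<omega> (covs ob) * db n \<omega> (covs ob)\<bar> / eps"
      using elim L.eps_pos by (intro frac_le) auto
    then show ?case by (simp add: e1_def)
  qed
  have Z: "L2_norm P (dl n \<omega>) * L2_norm P (db n \<omega>) \<le> Z n \<omega>"
    by (simp add: Z_def est_err_def add_increasing add_increasing2)
  show ?case
    by (rule product_L1(1)[OF _ elim(2) _ _ le _ Z])
      (use L.eps_pos in \<open>auto simp: sq_err_def add_increasing add_increasing2\<close>)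
qed

abbreviation plug :: "nat \<Rightarrow> 'w \<Rightarrow> 'p obs \<Rightarrow> real" where
  "plug n \<omega> \<equiv> plug_in (muh n \<omega>) (pih n \<omega>) (lamh n \<omega>) (beth n \<omega>)"

lemma integrable_error_squares:
  assumes \<omega>: "\<omega> \<in> space M" "\<omega> \<notin> Bad n"
  shows "integrable P (\<lambda>ob. (du n \<omega> (covs ob))\<^sup>2)" "integrable P (\<lambda>ob. (dm n \<omega> (covs ob))\<^sup>2)"
proof -
  note [measurable] = estimators_sections[OF \<omega>(1)]
  have sq: "integrable P (\<lambda>ob. (f (covs ob))\<^sup>2)"
    if [measurable]: "f \<in> borel_measurable borel" and le: "\<And>x. (f x)\<^sup>2 \<le> sq_err n \<omega> x" for f
  proof (rule integrable_of_V(1)[OF \<omega>, where C=1])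
    show "(\<lambda>ob. (f (covs ob))\<^sup>2) \<in> borel_measurable borel" by measurable
    have "(\<integral>\<^sup>+ob. ennreal \<bar>(f (covs ob))\<^sup>2\<bar> \<partial>P) \<le> V n \<omega>"
      unfolding V_def abs_power2 by (intro nn_integral_mono ennreal_leI le)
    then show "(\<integral>\<^sup>+ob. ennreal \<bar>(f (covs ob))\<^sup>2\<bar> \<partial>P) \<le> ennreal 1 * V n \<omega>" by simp
  qed
  show "integrable P (\<lambda>ob. (du n \<omega> (covs ob))\<^sup>2)"
    by (rule sq) (measurable, simp add: sq_err_def)
  show "integrable P (\<lambda>ob. (dm n \<omega> (covs ob))\<^sup>2)"
    by (rule sq) (measurable, simp add: sq_err_def)
qed

text \<open>By \<open>plug_in_bias\<close> the difference is the mean of \<open>e1 + e2 - e3\<close>.\<close>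

lemma plug_mean_error: "\<exists>C>0. \<forall>n. AE \<omega> in M. \<omega> \<notin> Bad n \<longrightarrow>
    integrable P (plug n \<omega>) \<and> ennreal \<bar>(\<integral>ob. plug n \<omega> ob \<partial>P) - psi P\<bar> \<le> ennreal C * Z n \<omega>"
proof -
  obtain C2 C3 where C2: "0 < C2" "\<forall>n. AE \<omega> in M. (\<integral>\<^sup>+ob. ennreal \<bar>e2 n \<omega> ob\<bar> \<partial>P) \<le> ennreal C2 * Z n \<omega>
        \<and> (\<integral>\<^sup>+ob. ennreal \<bar>e2 n \<omega> ob\<bar> \<partial>P) \<le> ennreal C2 * V n \<omega>"
    and C3: "0 < C3" "\<forall>n. AE \<omega> in M. (\<integral>\<^sup>+ob. ennreal \<bar>e3 n \<omega> ob\<bar> \<partial>P) \<le> ennreal C3 * Z n \<omega>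
        \<and> (\<integral>\<^sup>+ob. ennreal \<bar>e3 n \<omega> ob\<bar> \<partial>P) \<le> ennreal C3 * V n \<omega>"
    using e2_L1 e3_L1 by (elim exE conjE)
  show ?thesis
  proof (intro exI[of _ "1 / eps + C2 + C3"] conjI allI)
    show "0 < 1 / eps + C2 + C3" using C2(1) C3(1) L.eps_pos by (simp add: add_pos_pos)
    fix n
    show "AE \<omega> in M. \<omega> \<notin> Bad n \<longrightarrow>
        integrable P (plug n \<omega>) \<and> ennreal \<bar>(\<integral>ob. plug n \<omega> ob \<partial>P) - psi P\<bar> \<le> ennreal (1 / eps + C2 + C3) * Z n \<omega>"
      using beth_gt[of n] lamh_bounded[of n] e1_L1[of n] C2(2)[rule_format, of n] C3(2)[rule_format, of n] AE_space
    proof eventually_elim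
      case (elim \<omega>)
      show ?case
      proof
        assume nB: "\<omega> \<notin> Bad n"
        note m = estimators_sections[OF elim(6), of n]
        note [measurable] = m
        have l: "AE ob in P. \<bar>lamh n \<omega> (covs ob)\<bar> \<le> K" using elim(2) by eventually_elim auto
        note bias = L.plug_in_bias[OF m L.integrable_resp L.integrable_trt
          L.integrable_residual_squares[unfolded L.A0_def L.Y0_def] integrable_error_squares[OF elim(6) nB]
          L.integrable_lambda L.AE_beta_ne_0 L.eps_pos elim(1) l]
        let ?bias = "\<lambda>ob. e1 n \<omega> ob + e2 n \<omega> ob - e3 n \<omega> ob"
        have b: "integrable P (plug n \<omega>)" "integrable P ?bias" "(\<integral>ob. plug n \<omega> ob \<partial>P) - psi P = (\<integral>ob. ?bias ob \<partial>P)"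
          using bias by (simp_all add: e1_def e2_def e3_def power2_eq_square)
        have [measurable]: "e1 n \<omega> \<in> borel_measurable borel" "e2 n \<omega> \<in> borel_measurable borel" "e3 n \<omega> \<in> borel_measurable borel"
          unfolding e1_def[abs_def] e2_def[abs_def] e3_def[abs_def] by measurable
        have "ennreal \<bar>\<integral>ob. ?bias ob \<partial>P\<bar> \<le> (\<integral>\<^sup>+ob. ennreal \<bar>?bias ob\<bar> \<partial>P)"
          using integral_norm_bound_ennreal[OF b(2)] by simp
        also have "\<dots> \<le> (\<integral>\<^sup>+ob. ennreal \<bar>e1 n \<omega> ob\<bar> + ennreal \<bar>e2 n \<omega> ob\<bar> + ennreal \<bar>e3 n \<omega> ob\<bar> \<partial>P)"
          by (intro nn_integral_mono) (simp flip: ennreal_plus add: ennreal_leI)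
        also have "\<dots> = (\<integral>\<^sup>+ob. ennreal \<bar>e1 n \<omega> ob\<bar> \<partial>P) + (\<integral>\<^sup>+ob. ennreal \<bar>e2 n \<omega> ob\<bar> \<partial>P) + (\<integral>\<^sup>+ob. ennreal \<bar>e3 n \<omega> ob\<bar> \<partial>P)"
          by (simp add: nn_integral_add)
        also have "\<dots> \<le> ennreal (1 / eps) * Z n \<omega> + ennreal C2 * Z n \<omega> + ennreal C3 * Z n \<omega>"
          using elim(3,4,5) by (intro add_mono) auto
        also have "\<dots> = ennreal (1 / eps + C2 + C3) * Z n \<omega>"
          using C2(1) C3(1) L.eps_pos by (simp add: distrib_right)
        finally show "integrable P (plug n \<omega>) \<and> ennreal \<bar>(\<integral>ob. plug n \<omega> ob \<partial>P) - psi P\<bar> \<le> ennreal (1 / eps + C2 + C3) * Z n \<omega>"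
          using b by simp
      qed
    qed
  qed
qed

section \<open>Asymptotic linearity\<close>

lemma psi_hat_eq: "psi_hat Obs muh pih lamh beth n \<omega> = (\<Sum>i<n. plug n \<omega> (Obs i \<omega>)) / real n"
  by (simp add: psi_hat_def plug_in_def Let_def split_beta)

lemma psi_hat_measurable [measurable]: "psi_hat Obs muh pih lamh beth n \<in> borel_measurable M"
proof -
  have [measurable]: "(\<lambda>\<omega>. h n \<omega> (covs (Obs i \<omega>))) \<in> borel_measurable M"
    if h: "(\<lambda>(\<omega>, x). h n \<omega> x) \<in> borel_measurable (M \<Otimes>\<^sub>M borel)" for h :: "('w, 'p) estimator" and i
    using measurable_compose[OF _ h, of "\<lambda>\<omega>. (\<omega>, covs (Obs i \<omega>))" M] by simp
  note [measurable] = this[OF estimators_measurable(1)] this[OF estimators_measurable(2)]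
    this[OF estimators_measurable(3)] this[OF estimators_measurable(4)]
  show ?thesis unfolding psi_hat_eq[abs_def] plug_in_def by measurable
qed

lemma plug_eq: "plug n \<omega> ob = D1 n \<omega> ob + D2 n \<omega> ob - D3 n \<omega> ob + phi_psi P ob + psi P"
  by (simp add: L.phi_psi_eq plug_in_def D1_def D2_def D3_def L.A0_def L.Y0_def divide_inverse
      power2_eq_square algebra_simps)

lemma integrable_D: "AE \<omega> in M. \<omega> \<notin> Bad n \<longrightarrow>
    integrable P (D1 n \<omega>) \<and> integrable P (D2 n \<omega>) \<and> integrable P (D3 n \<omega>)"
proof -
  obtain C1 C2 C3 where C1: "\<forall>n. AE \<omega> in M. (\<integral>\<^sup>+ob. ennreal ((D1 n \<omega> ob)\<^sup>2) \<partial>P) \<le> ennreal C1 * V n \<omega>"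
    and C2: "\<forall>n. AE \<omega> in M. (\<integral>\<^sup>+ob. ennreal ((d2 n \<omega> ob)\<^sup>2) \<partial>P) \<le> ennreal C2 * V n \<omega>"
    and C3: "\<forall>n. AE \<omega> in M. (\<integral>\<^sup>+ob. ennreal ((d3 n \<omega> ob)\<^sup>2) \<partial>P) \<le> ennreal C3 * V n \<omega>"
    using d1_L2 d2_L2 d3_L2 by (elim exE conjE)
  obtain C2' C3' where C2': "\<forall>n. AE \<omega> in M. (\<integral>\<^sup>+ob. ennreal \<bar>e2 n \<omega> ob\<bar> \<partial>P) \<le> ennreal C2' * Z n \<omega>
        \<and> (\<integral>\<^sup>+ob. ennreal \<bar>e2 n \<omega> ob\<bar> \<partial>P) \<le> ennreal C2' * V n \<omega>"
    and C3': "\<forall>n. AE \<omega> in M. (\<integral>\<^sup>+ob. ennreal \<bar>e3 n \<omega> ob\<bar> \<partial>P) \<le> ennreal C3' * Z n \<omega>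
        \<and> (\<integral>\<^sup>+ob. ennreal \<bar>e3 n \<omega> ob\<bar> \<partial>P) \<le> ennreal C3' * V n \<omega>"
    using e2_L1 e3_L1 by (elim exE conjE)
  have rM: "\<forall>h\<in>{muh, pih, lamh, beth}. random_function M (h n)" using random by blast
  show ?thesis
    using C1[rule_format, of n] C2[rule_format, of n] C3[rule_format, of n] C2'[rule_format, of n] C3'[rule_format, of n] AE_space
  proof eventually_elim
    case (elim \<omega>)
    show ?case
    proof
      assume nB: "\<omega> \<notin> Bad n"
      have m: "D1 n \<omega> \<in> borel_measurable borel" "d2 n \<omega> \<in> borel_measurable borel" "e2 n \<omega> \<in> borel_measurable borel"
        "d3 n \<omega> \<in> borel_measurable borel" "e3 n \<omega> \<in> borel_measurable borel"
        using measurable_compose_Pair1[OF elim(6) parts_measurable(1)[OF rM]]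
          measurable_compose_Pair1[OF elim(6) parts_measurable(2)[OF rM]]
          measurable_compose_Pair1[OF elim(6) parts_measurable(3)[OF rM]]
          measurable_compose_Pair1[OF elim(6) parts_measurable(4)[OF rM]]
          measurable_compose_Pair1[OF elim(6) parts_measurable(5)[OF rM]] by simp_all
      have 1: "integrable P (D1 n \<omega>)" by (rule integrable_of_V(2)[OF elim(6) nB m(1) elim(1)])
      have "integrable P (d2 n \<omega>)" by (rule integrable_of_V(2)[OF elim(6) nB m(2) elim(2)])
      moreover have "integrable P (e2 n \<omega>)" by (rule integrable_of_V(1)[OF elim(6) nB m(3) conjunct2[OF elim(4)]])
      ultimately have 2: "integrable P (D2 n \<omega>)" unfolding D2_eq[abs_def] by (rule Bochner_Integration.integrable_add)
      have "integrable P (d3 n \<omega>)" by (rule integrable_of_V(2)[OF elim(6) nB m(4) elim(3)])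
      moreover have "integrable P (e3 n \<omega>)" by (rule integrable_of_V(1)[OF elim(6) nB m(5) conjunct2[OF elim(5)]])
      ultimately have 3: "integrable P (D3 n \<omega>)" unfolding D3_eq[abs_def] by (rule Bochner_Integration.integrable_add)
      show "integrable P (D1 n \<omega>) \<and> integrable P (D2 n \<omega>) \<and> integrable P (D3 n \<omega>)" using 1 2 3 by simp
    qed
  qed
qed

lemma error_decomposition:
  assumes n: "0 < n" and D: "integrable P (D1 n \<omega>)" "integrable P (D2 n \<omega>)" "integrable P (D3 n \<omega>)"
  shows "sqrt (real n) * (psi_hat Obs muh pih lamh beth n \<omega> - psi P - (\<Sum>i<n. phi_psi P (Obs i \<omega>)) / real n)
    = emp P n (D1 n \<omega>) (\<lambda>i. Obs i \<omega>) + emp P n (D2 n \<omega>) (\<lambda>i. Obs i \<omega>) - emp P n (D3 n \<omega>) (\<lambda>i. Obs i \<omega>)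
      + sqrt (real n) * ((\<integral>ob. plug n \<omega> ob \<partial>P) - psi P)"
proof -
  let ?D = "\<lambda>ob. D1 n \<omega> ob + D2 n \<omega> ob - D3 n \<omega> ob"
  have S: "(\<Sum>i<n. plug n \<omega> (Obs i \<omega>)) = (\<Sum>i<n. ?D (Obs i \<omega>)) + (\<Sum>i<n. phi_psi P (Obs i \<omega>)) + real n * psi P"
    unfolding plug_eq by (simp add: sum.distrib)
  have I: "(\<integral>ob. plug n \<omega> ob \<partial>P) = (\<integral>ob. ?D ob \<partial>P) + psi P"
    unfolding plug_eq using D L.integrable_phi_psi L.integral_phi_psi by simp
  have "sqrt (real n) * (psi_hat Obs muh pih lamh beth n \<omega> - psi P - (\<Sum>i<n. phi_psi P (Obs i \<omega>)) / real n)
      = emp P n ?D (\<lambda>i. Obs i \<omega>) + sqrt (real n) * ((\<integral>ob. plug n \<omega> ob \<partial>P) - psi P)"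
    unfolding psi_hat_eq S I emp_def using n by (simp add: add_divide_distrib algebra_simps)
  also have "emp P n ?D (\<lambda>i. Obs i \<omega>) = emp P n (D1 n \<omega>) (\<lambda>i. Obs i \<omega>) + emp P n (D2 n \<omega>) (\<lambda>i. Obs i \<omega>) - emp P n (D3 n \<omega>) (\<lambda>i. Obs i \<omega>)"
    using D by (simp add: emp_add emp_diff)
  finally show ?thesis .
qed

theorem psi_hat_asymptotically_linear:
  assumes "sample_splitting M Obs {muh, pih, lamh, beth} \<or> donsker_condition M P muh pih lamh beth"
  shows "asymptotically_linear M Obs (psi P) (psi_hat Obs muh pih lamh beth) (phi_psi P)"
proof -
  obtain C where C: "0 < C" "\<forall>n. AE \<omega> in M. \<omega> \<notin> Bad n \<longrightarrow>
    integrable P (plug n \<omega>) \<and> ennreal \<bar>(\<integral>ob. plug n \<omega> ob \<partial>P) - psi P\<bar> \<le> ennreal C * Z n \<omega>"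
    using plug_mean_error by (elim exE conjE)
  have rM: "\<forall>h\<in>{muh, pih, lamh, beth}. random_function M (h n)" for n using random by blast
  have D2m: "(\<lambda>(\<omega>, ob). D2 n \<omega> ob) \<in> borel_measurable (M \<Otimes>\<^sub>M borel)" and D3m: "(\<lambda>(\<omega>, ob). D3 n \<omega> ob) \<in> borel_measurable (M \<Otimes>\<^sub>M borel)" for n
  proof -
    note [measurable] = parts_measurable[OF rM]
    show "(\<lambda>(\<omega>, ob). D2 n \<omega> ob) \<in> borel_measurable (M \<Otimes>\<^sub>M borel)" unfolding D2_eq by measurable
    show "(\<lambda>(\<omega>, ob). D3 n \<omega> ob) \<in> borel_measurable (M \<Otimes>\<^sub>M borel)" unfolding D3_eq by measurable
  qed
  let ?E = "\<lambda>D n \<omega>. ennreal \<bar>emp P n (D n \<omega>) (\<lambda>i. Obs i \<omega>)\<bar>"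
  let ?S = "\<lambda>n \<omega>. ?E D1 n \<omega> + ?E D2 n \<omega> + ?E D3 n \<omega> + ennreal (sqrt (real n)) * Z n \<omega>"
  note [measurable] = emp_Obs_measurable[OF parts_measurable(1)[OF rM]] emp_Obs_measurable[OF D2m] emp_Obs_measurable[OF D3m]
  have Zs: "small_oP M (\<lambda>n \<omega>. ennreal (sqrt (real n)) * Z n \<omega>) (\<lambda>_. 1)"
    using Z_small unfolding small_oP_root_n[symmetric] .
  have "small_oP M ?S (\<lambda>_. 1)"
    by (intro small_oP_add emp_D_small[OF assms] Zs) simp_all
  then have "small_oP M (\<lambda>n \<omega>. ennreal (sqrt (real n)) * ennreal \<bar>psi_hat Obs muh pih lamh beth n \<omega> - psi P - (\<Sum>i<n. phi_psi P (Obs i \<omega>)) / real n\<bar>) (\<lambda>_. 1)"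
  proof (rule small_oP_dominated[where c="1 + C" and Bad=Bad, rotated])
    fix n :: nat assume n: "0 < n"
    show "AE \<omega> in M. \<omega> \<notin> Bad n \<longrightarrow>
       ennreal (sqrt (real n)) * ennreal \<bar>psi_hat Obs muh pih lamh beth n \<omega> - psi P - (\<Sum>i<n. phi_psi P (Obs i \<omega>)) / real n\<bar>
         \<le> ennreal (1 + C) * ?S n \<omega>"
      using C(2)[rule_format, of n] integrable_D[of n]
    proof eventually_elim
      case (elim \<omega>)
      show ?case
      proof
        assume nB: "\<omega> \<notin> Bad n"
        let ?R = "sqrt (real n) * ((\<integral>ob. plug n \<omega> ob \<partial>P) - psi P)"
        let ?x1 = "emp P n (D1 n \<omega>) (\<lambda>i. Obs i \<omega>)" and ?x2 = "emp P n (D2 n \<omega>) (\<lambda>i. Obs i \<omega>)"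
          and ?x3 = "emp P n (D3 n \<omega>) (\<lambda>i. Obs i \<omega>)"
        have "ennreal (sqrt (real n)) * ennreal \<bar>psi_hat Obs muh pih lamh beth n \<omega> - psi P - (\<Sum>i<n. phi_psi P (Obs i \<omega>)) / real n\<bar>
            = ennreal \<bar>sqrt (real n) * (psi_hat Obs muh pih lamh beth n \<omega> - psi P - (\<Sum>i<n. phi_psi P (Obs i \<omega>)) / real n)\<bar>"
          by (simp add: ennreal_mult[symmetric] abs_mult)
        also have "\<dots> = ennreal \<bar>?x1 + ?x2 - ?x3 + ?R\<bar>"
          using elim(2) nB by (subst error_decomposition[OF n]) simp_all
        also have "\<dots> \<le> ennreal \<bar>?x1\<bar> + ennreal \<bar>?x2\<bar> + ennreal \<bar>?x3\<bar> + ennreal \<bar>?R\<bar>"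
          by (simp flip: ennreal_plus add: ennreal_leI)
        also have "\<dots> \<le> ennreal \<bar>?x1\<bar> + ennreal \<bar>?x2\<bar> + ennreal \<bar>?x3\<bar> + ennreal C * (ennreal (sqrt (real n)) * Z n \<omega>)"
        proof (intro add_mono order_refl)
          have "ennreal \<bar>?R\<bar> = ennreal (sqrt (real n)) * ennreal \<bar>(\<integral>ob. plug n \<omega> ob \<partial>P) - psi P\<bar>"
            by (simp add: ennreal_mult[symmetric] abs_mult)
          also have "\<dots> \<le> ennreal (sqrt (real n)) * (ennreal C * Z n \<omega>)"
            using elim(1) nB by (intro mult_left_mono) auto
          finally show "ennreal \<bar>?R\<bar> \<le> ennreal C * (ennreal (sqrt (real n)) * Z n \<omega>)" by (simp only: mult_ac)
        qed
        also have "\<dots> \<le> ennreal (1 + C) * ?S n \<omega>"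
        proof -
          have c: "ennreal (1 + C) = 1 + ennreal C" using C(1) by simp
          show ?thesis unfolding c distrib_left distrib_right
            by (simp add: add_increasing2 add_mono add_increasing)
        qed
        finally show "ennreal (sqrt (real n)) * ennreal \<bar>psi_hat Obs muh pih lamh beth n \<omega> - psi P - (\<Sum>i<n. phi_psi P (Obs i \<omega>)) / real n\<bar>
         \<le> ennreal (1 + C) * ?S n \<omega>" .
      qed
    qed
  qed (use C(1) in \<open>simp_all add: Bad_small\<close>)
  then show ?thesis unfolding asymptotically_linear_def small_oP_root_n .
qed

end

section \<open>Regular asymptotic linearity\<close>

context moment_law
begin

text \<open>The local alternative is a tilted law with \<open>s = (B + 1) / \<surd>n\<close>, so that \<open>\<surd>n\<close> times the quadratic remainder of
  \<open>psi_tilted\<close> tends to zero.\<close>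

lemma psi_pathwise_derivative:
  assumes path: "local_alternative M Obs P p g B"
  shows "(\<lambda>n. sqrt (real n) * (psi (density P (\<lambda>ob. ennreal (p (1 / sqrt (real n)) ob))) - psi P))
    \<longlonglongrightarrow> (\<integral>ob. g ob * phi_psi P ob \<partial>P)"
proof -
  interpret A: local_alternative M Obs P p g B by (rule path)
  let ?Q = "\<lambda>n. density P (\<lambda>ob. ennreal (A.pn n ob))"
  let ?C = "(lambda_const * (22 * \<kappa>\<^sup>2) + 4 * \<kappa>\<^sup>2 + \<kappa> / eps * (4 * \<kappa>\<^sup>2)) / eps"
  let ?s = "\<lambda>n. (B + 1) / sqrt (real n)"
  let ?I = "\<lambda>n. \<integral>ob. A.score n ob * phi_psi P ob \<partial>P"
  obtain N where N: "0 < N" "\<forall>n\<ge>N. AE ob in P. \<bar>A.score n ob\<bar> \<le> B + 1"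
    using A.score_bounded by (elim exE conjE)
  have s0: "?s \<longlonglongrightarrow> 0" by real_asymp
  have close: "\<forall>\<^sub>F n in sequentially. \<bar>sqrt (real n) * (psi (?Q n) - psi P) - ?I n\<bar> \<le> ?C * (B + 1) * ?s n"
  proof -
    have "\<forall>\<^sub>F n in sequentially. ?s n < 1/2" by (rule order_tendstoD(2)[OF s0]) simp
    moreover have "\<forall>\<^sub>F n in sequentially. 44 * \<kappa>\<^sup>2 * ?s n < eps"
      by (rule order_tendstoD(2)[of _ 0]) (use tendsto_mult_right_zero[OF s0, of "44 * \<kappa>\<^sup>2"] eps_pos in simp_all)
    ultimately show ?thesis using eventually_ge_at_top[of N]
    proof eventually_elim
      case (elim n)
      have n: "0 < n" using elim N by simp
      have r: "0 < sqrt (real n)" using n by simp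
      interpret T: tilted_moment_law P eps K "A.pn n" "?s n"
      proof unfold_locales
        show "A.pn n \<in> borel_measurable borel" by (rule A.pn_measurable)
        show "0 \<le> A.pn n ob" for ob by simp
        show "(\<integral>\<^sup>+ob. ennreal (A.pn n ob) \<partial>P) = 1" by (rule A.pn_total)
        show "AE ob in P. \<bar>A.pn n ob - 1\<bar> \<le> ?s n"
          using N(2)[rule_format, OF elim(3)]
        proof eventually_elim
          case (elim ob)
          then show ?case using r by (simp add: A.score_def abs_mult pos_le_divide_eq mult.commute)
        qed
      qed (use elim in auto)
      have ip: "integrable P (\<lambda>ob. A.pn n ob * phi_psi P ob)"
      proof (rule Bochner_Integration.integrable_bound)
        show "integrable P (\<lambda>ob. 2 * phi_psi P ob)" using integrable_phi_psi by simp
        show "AE ob in P. norm (A.pn n ob * phi_psi P ob) \<le> norm (2 * phi_psi P ob)"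
          using T.q_close
        proof eventually_elim
          case (elim ob)
          have "\<bar>A.pn n ob - 1\<bar> \<le> 1 / 2" by (rule order_trans[OF elim T.s_half])
          then have "\<bar>A.pn n ob\<bar> \<le> 2" by linarith
          then show ?case by (simp add: abs_mult mult_right_mono)
        qed
      qed measurable
      have "?I n = (\<integral>ob. sqrt (real n) * (A.pn n ob * phi_psi P ob) - sqrt (real n) * phi_psi P ob \<partial>P)"
        by (simp add: A.score_def algebra_simps)
      also have "\<dots> = sqrt (real n) * (\<integral>ob. A.pn n ob * phi_psi P ob \<partial>P)"
        using ip integrable_phi_psi integral_phi_psi by simp
      finally have I: "?I n = sqrt (real n) * (\<integral>ob. A.pn n ob * phi_psi P ob \<partial>P)" .
      have "\<bar>sqrt (real n) * (psi (?Q n) - psi P) - ?I n\<bar>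
          = sqrt (real n) * \<bar>psi (?Q n) - psi P - (\<integral>ob. A.pn n ob * phi_psi P ob \<partial>P)\<bar>"
        unfolding I right_diff_distrib[symmetric] abs_mult using r by simp
      also have "\<dots> \<le> sqrt (real n) * (?C * (?s n)\<^sup>2)"
        using T.psi_tilted by (intro mult_left_mono) simp_all
      also have "\<dots> = ?C * (B + 1) * ?s n"
      proof -
        have cancel: "x * (c * (b / x)\<^sup>2) = c * b * (b / x)" if "x \<noteq> 0" for x c b :: real
          using that by (simp add: power2_eq_square)
        show ?thesis by (rule cancel) (use r in simp)
      qed
      finally show ?case .
    qed
  qed
  have "(\<lambda>n. sqrt (real n) * (psi (?Q n) - psi P) - ?I n) \<longlonglongrightarrow> 0"
    by (rule Lim_null_comparison[OF _ tendsto_mult_right_zero[OF s0, of "?C * (B + 1)"]])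
      (unfold real_norm_def, rule close)
  from tendsto_add[OF this A.score_integral_limit[OF integrable_phi_psi]]
  show ?thesis by (simp only: A.pn_def diff_add_cancel add_0_left)
qed

end

theorem theorem4:
  fixes M :: "'w measure"
    and Obs :: "nat \<Rightarrow> 'w \<Rightarrow> 'p::finite obs"
    and P :: "'p obs measure"
    and muh pih lamh beth :: "('w, 'p) estimator"
    and eps K \<nu> \<tau> :: real
  assumes "prob_space M"
    and "prob_space.indep_vars M (\<lambda>_. borel) Obs UNIV"
    and "\<And>i. distr M borel (Obs i) = P"
    and "integrable P resp" and "integrable P trt"
    and "\<And>n h. h \<in> {muh, pih, lamh, beth} \<Longrightarrow> random_function M (h n)"
    and "consistent M P muh (mu_fun P)" and "consistent M P pih (pi_fun P)"
    and "consistent M P lamh (lambda_fun P)" and "consistent M P beth (beta_fun P)"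
    and "eps > 0" and "K > 0"
    and "\<And>n. AE \<omega> in M. AE ob in P. eps < beth n \<omega> (covs ob)"
    and "AE ob in P. beta_fun P (covs ob) \<in> {eps<..<K}"
    and "\<And>n. AE \<omega> in M. AE ob in P. lamh n \<omega> (covs ob) \<in> {-K<..<K}"
    and "cond_mean_below P (\<lambda>ob. (resp ob - mu_fun P (covs ob))\<^sup>2) K"
    and "cond_mean_below P (\<lambda>ob. (resp ob - mu_fun P (covs ob)) ^ 4) K"
    and "cond_mean_below P (\<lambda>ob. (trt ob - pi_fun P (covs ob)) ^ 4) K"
    and "sample_splitting M Obs {muh, pih, lamh, beth} \<or> donsker_condition M P muh pih lamh beth"
    and "\<nu> \<ge> 1" and "\<tau> \<ge> 0" and "\<nu> + \<tau> \<ge> 2"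
    and "small_oP M (est_err P pih (pi_fun P)) (\<lambda>n. real n powr (- \<nu> / 4))"
    and "small_oP M (est_err P muh (mu_fun P)) (\<lambda>n. real n powr (- \<tau> / 4))"
    and "small_oP M (\<lambda>n \<omega>. est_err P lamh (lambda_fun P) n \<omega> * est_err P beth (beta_fun P) n \<omega>)
           (\<lambda>n. real n powr (- 1 / 2))"
  shows "RAL M Obs P psi (psi_hat Obs muh pih lamh beth) (phi_psi P)
    \<and> integrable P (\<lambda>ob. (phi_psi P ob)\<^sup>2)
    \<and> weak_conv_m
        (\<lambda>n. distr M borel (\<lambda>\<omega>. sqrt (real n) * (psi_hat Obs muh pih lamh beth n \<omega> - psi P)))
        (normal_law (\<integral>ob. (phi_psi P ob)\<^sup>2 \<partial>P))"
proof -
  have iid: "iid_sample M Obs P"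
    using assms(1-3) by (simp add: iid_sample_def iid_sample_axioms_def)
  interpret iid_sample M Obs P by (rule iid)
  have law: "moment_law P eps K"
    using assms P.prob_space_axioms sets_law
    by (simp add: moment_law_def moment_law_axioms_def obs_law_def obs_law_axioms_def)
  interpret plug_in_estimation M Obs P eps K muh pih lamh beth \<nu> \<tau>
    unfolding plug_in_estimation_def plug_in_estimation_axioms_def
    by (intro conjI iid law allI impI) (fact assms)+
  note limit = regular_and_normal[where Psi=psi and T="psi_hat Obs muh pih lamh beth" and \<phi>="phi_psi P",
      OF L.phi_psi_measurable L.integrable_phi_psi_square L.integral_phi_psi psi_hat_measurable
        psi_hat_asymptotically_linear[OF assms(19)]]
  have "RAL M Obs P psi (psi_hat Obs muh pih lamh beth) (phi_psi P)"
    by (rule limit(1)) (rule L.psi_pathwise_derivative)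
  moreover have "weak_conv_m (\<lambda>n. distr M borel (\<lambda>\<omega>. sqrt (real n) * (psi_hat Obs muh pih lamh beth n \<omega> - psi P)))
      (normal_law (\<integral>ob. (phi_psi P ob)\<^sup>2 \<partial>P))"
    by (rule limit(2)) (rule L.psi_pathwise_derivative)
  ultimately show ?thesis using L.integrable_phi_psi_square by blast
qed

end
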